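(* Let $Z$ be a normed space and $X,Y$ topological spaces, and let $\mathcal M$, $\mathsf M=\{\langle\mathsf M_x,\mathcal A_x\rangle\}_{x\in X}$ and the bundle $\mathfrak V(\mathsf M,\mathcal M)$ with projection $\pi_{\mathsf M}$ be as in the context. Let $\mathfrak V$ be the trivial Banach bundle over $X$ with constant stalk $Z$ (so that $\Gamma(\pi)\simeq\mathcal C_b(X,Z)$), and let $\Theta=\{B_v:v\in\mathcal C_b(X,Z)\}$ with $B_v(x)=\{v(x)\}$. Let $x_\infty\in X$. Then: (1) $\langle\mathfrak V,\mathfrak V(\mathsf M,\mathcal M);X,Y\rangle$ is a $(\Theta,\mathcal C_b(X,Z))$-structure; moreover if $X$ is compact and $Y$ is locally compact then it is compatible. (2) Let $f\in\prod_{x\in X}\mathsf M_x$ be such that $\sup_{(x,s)\in X\times K}\|f(x)(s)\|_{B(Z)}<\infty$ for all compact $K\subseteq Y$. Then the following are equivalent: (a) $f\in\Gamma^{x_\infty}(\pi_{\mathsf M})$; (b) for all compact $K\subseteq Y$ and all $v\in\mathcal C_b(X,Z)$, $\lim_{x\to x_\infty}\sup_{s\in K}\|f(x)(s)v(x)-f(x_\infty)(s)v(x)\|=0$; (c) $f:X\to\mathcal C_c(Y,B_s(Z))$ is continuous at $x_\infty$; (d) for all compact $K\subseteq Y$ and all $w\in Z$, $\lim_{x\to x_\infty}\sup_{s\in K}\|f(x)(s)w-f(x_\infty)(s)w\|=0$.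
   Context: $B(Z)$ denotes the bounded linear operators on $Z$ with operator norm, $B_s(Z)$ ($=\mathcal L_s(Z)$) the same space with the strong operator topology; $\mathcal C_c(Y,B_s(Z))$ is the space of continuous maps $Y\to B_s(Z)$ with the topology of uniform convergence on compact subsets of $Y$; $\mathcal C_b(X,E)$ denotes bounded continuous maps. $\mathcal M=\{F\in\mathcal C_b(X,\mathcal C_c(Y,B_s(Z))):\sup_{(x,s)\in X\times K}\|F(x)(s)\|_{B(Z)}<\infty\ \forall K\subseteq Y\text{ compact}\}$; $\mathsf M_x$ is the closure in $\mathcal C_c(Y,B_s(Z))$ of $\{F(x):F\in\mathcal M\}$; for $v\in\mathcal C_b(X,Z)$ and $K\subseteq Y$ compact, $\mu^K_{(v,x)}(G)=\sup_{s\in K}\|G(s)v(x)\|$ for $G\in\mathsf M_x$; $\mathcal A_x=\{\mu^K_{(w,x)}:K\subseteq Y\text{ compact},\ w\in\mathcal C_b(X,Z)\}$ (where a directed family is needed, take finite suprema). Bundles. A bundle of $\Omega$-spaces $\langle\langle\mathfrak E,\tau\rangle,\pi,X,\mathfrak N\rangle$ (Gierz) consists of topological spaces $\langle\mathfrak E,\tau\rangle$ and $X$, a continuous open surjection $\pi:\mathfrak E\to X$, a vector space structure on each stalk $\mathfrak E_x=\pi^{-1}(x)$ such that addition $\{(a,b):\pi(a)=\pi(b)\}\to\mathfrak E$ and scalar multiplication are continuous, and a set $\mathfrak N=\{\nu_j:j\in J\}$ of functions $\mathfrak E\to[0,\infty[$ whose restrictions to each $\mathfrak E_x$ form a directed family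 of seminorms generating the (Hausdorff) topology induced by $\tau$ on $\mathfrak E_x$. $\Gamma_U(\pi)$ (resp. $\Gamma_U^x(\pi)$) is the set of sections $\sigma$ over $U\subseteq X$ with $\sup_{x\in U}\nu_j(\sigma(x))<\infty$ for all $j$ which are continuous (resp. continuous at $x\in U$); $U$ is omitted if $U=X$. The tubes $\{\beta:\pi(\beta)\in U,\nu_j(\beta-\sigma(\pi(\beta)))<\varepsilon\}$ ($U$ open, $\sigma\in\Gamma_U(\pi)$, $\varepsilon>0$, $j\in J$) form a base of $\tau$. Generated bundle. $\mathfrak V(\mathsf M,\mathcal M)$ is the bundle of $\Omega$-spaces with total space $\bigcup_{x}\{x\}\times\mathsf M_x$, projection $\pi_{\mathsf M}(x,g)=x$, seminorms $(x,g)\mapsto p^x(g)$, $p$ ranging over finite suprema of the $\mu^K_{(w,\cdot)}$, and topology with neighbourhood base at $(x,g)$ the sets $\{(y,h):y\in U,\ p^y(h-\sigma(y))<\varepsilon\}$, $U\ni x$ open, $\sigma\in\mathcal M$, $\varepsilon>0$, $p^x(g-\sigma(x))<\varepsilon$. Sections of this bundle are identified with elements of $\prod_x\mathsf M_x$. $(\Theta,\mathcal E)$-structure. Let $\mathcal E\subseteq\Gamma(\pi)$, $\Theta\subseteq\prod_xBounded(\mathfrak E_x)$, $\mathsf D(B,\mathcal E)=\mathcal E\cap\prod_xB(x)$, $\mathcal B_B^x=\{v(x):v\in\mathsf D(B,\mathcal E)\}$, $S_x=\{\mathcal B_B^x:B\in\Theta\}$, $\mathcal E(\Theta)=\bigcup_B\mathsf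 D(B,\mathcal E)$; $\mathcal L_{S_x}(\mathfrak E_x)$ is the space of continuous linear endomorphisms with uniform convergence on members of $S_x$. $\langle\mathfrak V,\mathfrak W;X,Y\rangle$, $\mathfrak W=\langle\langle\mathfrak M,\gamma\rangle,\rho,X,\mathfrak R\rangle$, is a $(\Theta,\mathcal E)$-structure if $Y$ is Hausdorff, $\mathsf D(B,\mathcal E)\ne\emptyset$ for all $B\in\Theta$, $\bigcup_{B}\mathcal B_B^x$ is total in $\mathfrak E_x$ for all $x$, and $\mathfrak W$ is a bundle of $\Omega$-spaces with stalks $\mathfrak M_x$ linear subspaces of $\mathcal C(Y,\mathcal L_{S_x}(\mathfrak E_x))$ and directed family of seminorms $\sup_{(K,j,B)\in O}q^x_{(K,j,B)}$, $O$ finite $\subset Comp(Y)\times J\times\Theta$, $q^x_{(K,j,B)}(f)=\sup_{t\in K}\sup_{v\in\mathsf D(B,\mathcal E)}\nu_j(f(t)v(x))$. It is compatible if for all $t\in Y$, $F\in\Gamma(\rho)$ and $w\in\mathcal E(\Theta)$ the section $x\mapsto F(x)(t)w(x)$ belongs to $\Gamma(\pi)$. Standing assumption: $Y$ is Hausdorff. *)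

theory Defs
  imports "HOL-Analysis.Analysis"
begin

text \<open>Supremum in \<open>[0,\<infinity>[\<close> of a bounded family of nonnegative reals. Inserting \<open>0\<close> changes nothing
  for a nonempty family and makes the supremum of the empty family \<open>0\<close>
  (\<^term>\<open>Sup {} :: real\<close> is unspecified).\<close>

definition nsup :: "('i \<Rightarrow> real) \<Rightarrow> 'i set \<Rightarrow> real" where
  "nsup f A = Sup (insert 0 (f ` A))"

text \<open>The topology on \<open>V\<close> whose neighbourhood base at \<open>g\<close> consists of the finite intersections of
  the balls \<open>{h \<in> V. d g h < \<epsilon>}\<close>, \<open>d \<in> D\<close>. A family \<open>P\<close> of seminorms generates the topology
  given by the functions \<open>\<lambda>g h. p (h - g)\<close>, \<open>p \<in> P\<close>.\<close>

definition gauge_topology :: "'a set \<Rightarrow> ('a \<Rightarrow> 'a \<Rightarrow> real) set \<Rightarrow> 'a topology" where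
  "gauge_topology V D = topology (\<lambda>W. W \<subseteq> V \<and>
     (\<forall>g\<in>W. \<exists>F \<epsilon>. finite F \<and> F \<subseteq> D \<and> 0 < \<epsilon> \<and> {h \<in> V. \<forall>d\<in>F. d g h < \<epsilon>} \<subseteq> W))"

lemma openin_gauge_topology:
  "openin (gauge_topology V D) W \<longleftrightarrow> W \<subseteq> V \<and>
     (\<forall>g\<in>W. \<exists>F \<epsilon>. finite F \<and> F \<subseteq> D \<and> 0 < \<epsilon> \<and> {h \<in> V. \<forall>d\<in>F. d g h < \<epsilon>} \<subseteq> W)"
proof -
  define N where "N W g \<longleftrightarrow>
    (\<exists>F \<epsilon>. finite F \<and> F \<subseteq> D \<and> 0 < \<epsilon> \<and> {h \<in> V. \<forall>d\<in>F. d g h < \<epsilon>} \<subseteq> W)" for W g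
  have inter: "N (S \<inter> T) g" if ST: "N S g" "N T g" for S T g
  proof -
    obtain F a where F: "finite F" "F \<subseteq> D" "0 < (a::real)" "{h \<in> V. \<forall>d\<in>F. d g h < a} \<subseteq> S"
      using ST(1) unfolding N_def by blast
    obtain G b where G: "finite G" "G \<subseteq> D" "0 < (b::real)" "{h \<in> V. \<forall>d\<in>G. d g h < b} \<subseteq> T"
      using ST(2) unfolding N_def by blast
    have "{h \<in> V. \<forall>d\<in>F \<union> G. d g h < min a b} \<subseteq> S \<inter> T"
      using F(4) G(4) by auto
    moreover have "finite (F \<union> G)" "F \<union> G \<subseteq> D" "0 < min a b"
      using F G by auto
    ultimately show ?thesis
      unfolding N_def by blast
  qed
  have mono: "N T g" if "N S g" "S \<subseteq> T" for S T g
    using that unfolding N_def by (meson order_trans)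
  have "istopology (\<lambda>W. W \<subseteq> V \<and> (\<forall>g\<in>W. N W g))"
    unfolding istopology_def
  proof (intro conjI allI impI)
    fix S T assume "S \<subseteq> V \<and> (\<forall>g\<in>S. N S g)" "T \<subseteq> V \<and> (\<forall>g\<in>T. N T g)"
    then show "S \<inter> T \<subseteq> V" "\<forall>g\<in>S \<inter> T. N (S \<inter> T) g"
      using inter by blast+
  next
    fix \<K> assume *: "\<forall>K\<in>\<K>. K \<subseteq> V \<and> (\<forall>g\<in>K. N K g)"
    then show "\<Union>\<K> \<subseteq> V" by blast
    show "\<forall>g\<in>\<Union>\<K>. N (\<Union>\<K>) g"
    proof
      fix g assume "g \<in> \<Union>\<K>"
      then obtain K where "K \<in> \<K>" "g \<in> K" by blast
      then show "N (\<Union>\<K>) g"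
        using * mono[of K g "\<Union>\<K>"] by blast
    qed
  qed
  then show ?thesis
    unfolding gauge_topology_def N_def by (simp add: topology_inverse')
qed

lemma topspace_gauge_topology [simp]: "topspace (gauge_topology V D) = V"
proof (rule subset_antisym)
  show "topspace (gauge_topology V D) \<subseteq> V"
    using openin_topspace[of "gauge_topology V D"] unfolding openin_gauge_topology by blast
  have "\<exists>F \<epsilon>. finite F \<and> F \<subseteq> D \<and> 0 < \<epsilon> \<and> {h \<in> V. \<forall>d\<in>F. d g h < \<epsilon>} \<subseteq> V" for g
    by (rule exI[of _ "{}"], rule exI[of _ "1::real"]) simp
  then have "openin (gauge_topology V D) V"
    unfolding openin_gauge_topology by blast
  then show "V \<subseteq> topspace (gauge_topology V D)"
    by (rule openin_subset)
qed

text \<open>Maps whose domain is the underlying set of a topological space are taken extensional.\<close>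

definition cont_maps :: "'a topology \<Rightarrow> 'b topology \<Rightarrow> ('a \<Rightarrow> 'b) set" where
  "cont_maps Y W = {g \<in> extensional (topspace Y). continuous_map Y W g}"

definition Comp :: "'y topology \<Rightarrow> 'y set set" where
  "Comp Y = {K. compactin Y K}"


section \<open>Bundles of Omega-spaces\<close>

record ('k, 'e, 'x) omega_bundle =
  tot :: "'e topology"
  proj :: "'e \<Rightarrow> 'x"
  base :: "'x topology"
  szero :: "'x \<Rightarrow> 'e"
  sadd :: "'e \<Rightarrow> 'e \<Rightarrow> 'e"
  smult :: "'k \<Rightarrow> 'e \<Rightarrow> 'e"
  semi :: "('e \<Rightarrow> real) set"

definition stalk :: "('k, 'e, 'x) omega_bundle \<Rightarrow> 'x \<Rightarrow> 'e set" where
  "stalk \<VV> x = {a \<in> topspace (tot \<VV>). proj \<VV> a = x}"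

definition stalk_top :: "('k, 'e, 'x) omega_bundle \<Rightarrow> 'x \<Rightarrow> 'e topology" where
  "stalk_top \<VV> x = subtopology (tot \<VV>) (stalk \<VV> x)"

definition sdiff :: "('k::real_normed_field, 'e, 'x) omega_bundle \<Rightarrow> 'e \<Rightarrow> 'e \<Rightarrow> 'e" where
  "sdiff \<VV> a b = sadd \<VV> a (smult \<VV> (-1) b)"

definition stalk_vector_space :: "('k::real_normed_field, 'e, 'x) omega_bundle \<Rightarrow> 'x \<Rightarrow> bool" where
  "stalk_vector_space \<VV> x \<longleftrightarrow>
     szero \<VV> x \<in> stalk \<VV> x \<and>
     (\<forall>a\<in>stalk \<VV> x. \<forall>b\<in>stalk \<VV> x. sadd \<VV> a b \<in> stalk \<VV> x) \<and>
     (\<forall>k. \<forall>a\<in>stalk \<VV> x. smult \<VV> k a \<in> stalk \<VV> x) \<and>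
     (\<forall>a\<in>stalk \<VV> x. \<forall>b\<in>stalk \<VV> x. \<forall>c\<in>stalk \<VV> x.
        sadd \<VV> (sadd \<VV> a b) c = sadd \<VV> a (sadd \<VV> b c)) \<and>
     (\<forall>a\<in>stalk \<VV> x. \<forall>b\<in>stalk \<VV> x. sadd \<VV> a b = sadd \<VV> b a) \<and>
     (\<forall>a\<in>stalk \<VV> x. sadd \<VV> (szero \<VV> x) a = a) \<and>
     (\<forall>a\<in>stalk \<VV> x. sdiff \<VV> a a = szero \<VV> x) \<and>
     (\<forall>k. \<forall>a\<in>stalk \<VV> x. \<forall>b\<in>stalk \<VV> x.
        smult \<VV> k (sadd \<VV> a b) = sadd \<VV> (smult \<VV> k a) (smult \<VV> k b)) \<and>
     (\<forall>k l. \<forall>a\<in>stalk \<VV> x. smult \<VV> (k + l) a = sadd \<VV> (smult \<VV> k a) (smult \<VV> l a)) \<and>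
     (\<forall>k l. \<forall>a\<in>stalk \<VV> x. smult \<VV> (k * l) a = smult \<VV> k (smult \<VV> l a)) \<and>
     (\<forall>a\<in>stalk \<VV> x. smult \<VV> 1 a = a)"

definition stalk_seminorm ::
  "('k::real_normed_field, 'e, 'x) omega_bundle \<Rightarrow> 'x \<Rightarrow> ('e \<Rightarrow> real) \<Rightarrow> bool" where
  "stalk_seminorm \<VV> x \<nu> \<longleftrightarrow>
     (\<forall>a\<in>stalk \<VV> x. 0 \<le> \<nu> a) \<and>
     (\<forall>a\<in>stalk \<VV> x. \<forall>b\<in>stalk \<VV> x. \<nu> (sadd \<VV> a b) \<le> \<nu> a + \<nu> b) \<and>
     (\<forall>k. \<forall>a\<in>stalk \<VV> x. \<nu> (smult \<VV> k a) = norm k * \<nu> a)"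

definition bounded_sections :: "('k, 'e, 'x) omega_bundle \<Rightarrow> 'x set \<Rightarrow> ('x \<Rightarrow> 'e) set" where
  "bounded_sections \<VV> U =
     {\<sigma> \<in> (\<Pi>\<^sub>E x\<in>U. stalk \<VV> x). \<forall>\<nu>\<in>semi \<VV>. bdd_above ((\<lambda>x. \<nu> (\<sigma> x)) ` U)}"

definition Gamma_on :: "('k, 'e, 'x) omega_bundle \<Rightarrow> 'x set \<Rightarrow> ('x \<Rightarrow> 'e) set" where
  "Gamma_on \<VV> U =
     {\<sigma> \<in> bounded_sections \<VV> U. continuous_map (subtopology (base \<VV>) U) (tot \<VV>) \<sigma>}"

definition Gamma :: "('k, 'e, 'x) omega_bundle \<Rightarrow> ('x \<Rightarrow> 'e) set" where
  "Gamma \<VV> = Gamma_on \<VV> (topspace (base \<VV>))"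

definition Gamma_at :: "('k, 'e, 'x) omega_bundle \<Rightarrow> 'x \<Rightarrow> ('x \<Rightarrow> 'e) set" where
  "Gamma_at \<VV> x =
     {\<sigma> \<in> bounded_sections \<VV> (topspace (base \<VV>)). topcontinuous_at (base \<VV>) (tot \<VV>) \<sigma> x}"

definition tubes :: "('k::real_normed_field, 'e, 'x) omega_bundle \<Rightarrow> 'e set set" where
  "tubes \<VV> =
     {{\<beta> \<in> topspace (tot \<VV>). proj \<VV> \<beta> \<in> U \<and> \<nu> (sdiff \<VV> \<beta> (\<sigma> (proj \<VV> \<beta>))) < \<epsilon>} | U \<sigma> \<nu> \<epsilon>.
        openin (base \<VV>) U \<and> \<sigma> \<in> Gamma_on \<VV> U \<and> \<nu> \<in> semi \<VV> \<and> 0 < \<epsilon>}"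

definition is_omega_bundle :: "('k::real_normed_field, 'e, 'x) omega_bundle \<Rightarrow> bool" where
  "is_omega_bundle \<VV> \<longleftrightarrow>
     continuous_map (tot \<VV>) (base \<VV>) (proj \<VV>) \<and>
     open_map (tot \<VV>) (base \<VV>) (proj \<VV>) \<and>
     proj \<VV> ` topspace (tot \<VV>) = topspace (base \<VV>) \<and>
     (\<forall>x\<in>topspace (base \<VV>). stalk_vector_space \<VV> x) \<and>
     continuous_map
       (subtopology (prod_topology (tot \<VV>) (tot \<VV>)) {(a, b). proj \<VV> a = proj \<VV> b})
       (tot \<VV>) (\<lambda>(a, b). sadd \<VV> a b) \<and>
     continuous_map (prod_topology euclidean (tot \<VV>)) (tot \<VV>) (\<lambda>(k, a). smult \<VV> k a) \<and>
     semi \<VV> \<noteq> {} \<and>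
     (\<forall>x\<in>topspace (base \<VV>).
        (\<forall>\<nu>\<in>semi \<VV>. stalk_seminorm \<VV> x \<nu>) \<and>
        (\<forall>\<nu>\<^sub>1\<in>semi \<VV>. \<forall>\<nu>\<^sub>2\<in>semi \<VV>. \<exists>\<nu>\<in>semi \<VV>. \<forall>a\<in>stalk \<VV> x. \<nu>\<^sub>1 a \<le> \<nu> a \<and> \<nu>\<^sub>2 a \<le> \<nu> a) \<and>
        stalk_top \<VV> x = gauge_topology (stalk \<VV> x) {\<lambda>a b. \<nu> (sdiff \<VV> b a) | \<nu>. \<nu> \<in> semi \<VV>} \<and>
        Hausdorff_space (stalk_top \<VV> x)) \<and>
     openin (tot \<VV>) = arbitrary union_of (\<lambda>S. S \<in> tubes \<VV>)"


section \<open>\<open>(\<Theta>, \<E>)\<close>-structures\<close>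

definition stalk_bounded :: "('k, 'e, 'x) omega_bundle \<Rightarrow> 'x \<Rightarrow> 'e set set" where
  "stalk_bounded \<VV> x = {A. A \<subseteq> stalk \<VV> x \<and> (\<forall>\<nu>\<in>semi \<VV>. bdd_above (\<nu> ` A))}"

definition stalk_subspace :: "('k::real_normed_field, 'e, 'x) omega_bundle \<Rightarrow> 'x \<Rightarrow> 'e set \<Rightarrow> bool" where
  "stalk_subspace \<VV> x L \<longleftrightarrow> L \<subseteq> stalk \<VV> x \<and> szero \<VV> x \<in> L \<and>
     (\<forall>a\<in>L. \<forall>b\<in>L. sadd \<VV> a b \<in> L) \<and> (\<forall>k. \<forall>a\<in>L. smult \<VV> k a \<in> L)"

definition total_in_stalk :: "('k::real_normed_field, 'e, 'x) omega_bundle \<Rightarrow> 'x \<Rightarrow> 'e set \<Rightarrow> bool" where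
  "total_in_stalk \<VV> x A \<longleftrightarrow> A \<subseteq> stalk \<VV> x \<and>
     stalk_top \<VV> x closure_of (stalk_subspace \<VV> x hull A) = stalk \<VV> x"

definition stalk_endo :: "('k::real_normed_field, 'e, 'x) omega_bundle \<Rightarrow> 'x \<Rightarrow> ('e \<Rightarrow> 'e) set" where
  "stalk_endo \<VV> x =
     {T \<in> extensional (stalk \<VV> x).
        continuous_map (stalk_top \<VV> x) (stalk_top \<VV> x) T \<and>
        (\<forall>a\<in>stalk \<VV> x. \<forall>b\<in>stalk \<VV> x. T (sadd \<VV> a b) = sadd \<VV> (T a) (T b)) \<and>
        (\<forall>k. \<forall>a\<in>stalk \<VV> x. T (smult \<VV> k a) = smult \<VV> k (T a))}"

definition L_top ::
  "('k::real_normed_field, 'e, 'x) omega_bundle \<Rightarrow> 'x \<Rightarrow> 'e set set \<Rightarrow> ('e \<Rightarrow> 'e) topology" where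
  "L_top \<VV> x S = gauge_topology (stalk_endo \<VV> x)
     {\<lambda>T T'. nsup (\<lambda>a. \<nu> (sdiff \<VV> (T' a) (T a))) A | A \<nu>. A \<in> S \<and> \<nu> \<in> semi \<VV>}"

definition DD :: "'x topology \<Rightarrow> ('x \<Rightarrow> 'e) set \<Rightarrow> ('x \<Rightarrow> 'e set) \<Rightarrow> ('x \<Rightarrow> 'e) set" where
  "DD X \<E> B = \<E> \<inter> (\<Pi>\<^sub>E x\<in>topspace X. B x)"

definition BB :: "'x topology \<Rightarrow> ('x \<Rightarrow> 'e) set \<Rightarrow> ('x \<Rightarrow> 'e set) \<Rightarrow> 'x \<Rightarrow> 'e set" where
  "BB X \<E> B x = {v x | v. v \<in> DD X \<E> B}"

text \<open>The stalks of \<open>\<WW>\<close> are spaces of maps from \<open>Y\<close> to endomorphisms of the stalks of \<open>\<VV>\<close>. Since the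
  stalks of a bundle are disjoint, an element \<open>m\<close> of the total space is a map together with its
  base point; \<open>ev m\<close> is the underlying map. The realization \<open>ev\<close> is
  required to be linear and injective on each stalk.\<close>

definition q_semi ::
  "('x \<Rightarrow> 'e) set \<Rightarrow> ('k, 'm, 'x) omega_bundle \<Rightarrow> ('m \<Rightarrow> 'y \<Rightarrow> 'e \<Rightarrow> 'e) \<Rightarrow>
   'y set \<times> ('e \<Rightarrow> real) \<times> ('x \<Rightarrow> 'e set) \<Rightarrow> 'm \<Rightarrow> real" where
  "q_semi \<E> \<WW> ev = (\<lambda>(K, \<nu>, B) m.
     nsup (\<lambda>t. nsup (\<lambda>v. \<nu> (ev m t (v (proj \<WW> m)))) (DD (base \<WW>) \<E> B)) K)"

definition is_structure ::
  "('x \<Rightarrow> 'e set) set \<Rightarrow> ('x \<Rightarrow> 'e) set \<Rightarrow>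
   ('k::real_normed_field, 'e, 'x) omega_bundle \<Rightarrow> ('k, 'm, 'x) omega_bundle \<Rightarrow>
   ('m \<Rightarrow> 'y \<Rightarrow> 'e \<Rightarrow> 'e) \<Rightarrow> 'x topology \<Rightarrow> 'y topology \<Rightarrow> bool" where
  "is_structure \<Theta> \<E> \<VV> \<WW> ev X Y \<longleftrightarrow>
     is_omega_bundle \<VV> \<and> base \<VV> = X \<and>
     \<E> \<subseteq> Gamma \<VV> \<and>
     \<Theta> \<subseteq> (\<Pi>\<^sub>E x\<in>topspace X. stalk_bounded \<VV> x) \<and>
     Hausdorff_space Y \<and>
     (\<forall>B\<in>\<Theta>. DD X \<E> B \<noteq> {}) \<and>
     (\<forall>x\<in>topspace X. total_in_stalk \<VV> x (\<Union>B\<in>\<Theta>. BB X \<E> B x)) \<and>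
     is_omega_bundle \<WW> \<and> base \<WW> = X \<and>
     (\<forall>x\<in>topspace X.
        inj_on ev (stalk \<WW> x) \<and>
        ev ` stalk \<WW> x \<subseteq> cont_maps Y (L_top \<VV> x {BB X \<E> B x | B. B \<in> \<Theta>}) \<and>
        (\<forall>m\<in>stalk \<WW> x. \<forall>m'\<in>stalk \<WW> x. \<forall>t\<in>topspace Y. \<forall>a\<in>stalk \<VV> x.
           ev (sadd \<WW> m m') t a = sadd \<VV> (ev m t a) (ev m' t a)) \<and>
        (\<forall>k. \<forall>m\<in>stalk \<WW> x. \<forall>t\<in>topspace Y. \<forall>a\<in>stalk \<VV> x.
           ev (smult \<WW> k m) t a = smult \<VV> k (ev m t a))) \<and>
     (\<lambda>r. restrict r (topspace (tot \<WW>))) ` semi \<WW> =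
       {\<lambda>m\<in>topspace (tot \<WW>). nsup (\<lambda>i. q_semi \<E> \<WW> ev i m) Q | Q.
          finite Q \<and> Q \<subseteq> Comp Y \<times> semi \<VV> \<times> \<Theta>}"

definition is_compatible ::
  "('x \<Rightarrow> 'e set) set \<Rightarrow> ('x \<Rightarrow> 'e) set \<Rightarrow>
   ('k::real_normed_field, 'e, 'x) omega_bundle \<Rightarrow> ('k, 'm, 'x) omega_bundle \<Rightarrow>
   ('m \<Rightarrow> 'y \<Rightarrow> 'e \<Rightarrow> 'e) \<Rightarrow> 'x topology \<Rightarrow> 'y topology \<Rightarrow> bool" where
  "is_compatible \<Theta> \<E> \<VV> \<WW> ev X Y \<longleftrightarrow>
     (\<forall>t\<in>topspace Y. \<forall>F\<in>Gamma \<WW>. \<forall>w\<in>(\<Union>B\<in>\<Theta>. DD X \<E> B).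
        (\<lambda>x\<in>topspace X. ev (F x) t (w x)) \<in> Gamma \<VV>)"


section \<open>Operators on a normed space and the generated bundle\<close>

text \<open>A normed space over \<open>'k\<close>, that is over \<open>\<real>\<close> or \<open>\<complex>\<close>: a real normed space with a scalar
  multiplication \<open>sc\<close> by \<open>'k\<close> that extends the real one. The real case is \<open>sc = scaleR\<close>.\<close>

definition normed_space_over ::
  "('k::real_normed_field \<Rightarrow> 'z::real_normed_vector \<Rightarrow> 'z) \<Rightarrow> bool" where
  "normed_space_over sc \<longleftrightarrow> vector_space sc \<and>
     (\<forall>r z. sc (of_real r) z = r *\<^sub>R z) \<and> (\<forall>k z. norm (sc k z) = norm k * norm z)"

definition B_ops ::
  "('k::real_normed_field \<Rightarrow> 'z::real_normed_vector \<Rightarrow> 'z) \<Rightarrow> ('z \<Rightarrow>\<^sub>L 'z) set" where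
  "B_ops sc = {T. Vector_Spaces.linear sc sc (blinfun_apply T)}"

definition Bs ::
  "('k::real_normed_field \<Rightarrow> 'z::real_normed_vector \<Rightarrow> 'z) \<Rightarrow> ('z \<Rightarrow>\<^sub>L 'z) topology" where
  "Bs sc = subtopology strong_operator_topology (B_ops sc)"

definition Cc ::
  "('k::real_normed_field \<Rightarrow> 'z::real_normed_vector \<Rightarrow> 'z) \<Rightarrow> 'y topology \<Rightarrow>
   ('y \<Rightarrow> 'z \<Rightarrow>\<^sub>L 'z) topology" where
  "Cc sc Y = gauge_topology (cont_maps Y (Bs sc))
     {\<lambda>g h. nsup (\<lambda>s. norm (blinfun_apply (h s) z - blinfun_apply (g s) z)) K | K z. K \<in> Comp Y}"

definition Cb :: "'x topology \<Rightarrow> ('x \<Rightarrow> 'z::real_normed_vector) set" where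
  "Cb X = {v \<in> cont_maps X euclidean. bounded (v ` topspace X)}"

text \<open>The second condition is boundedness of the range of \<open>F\<close> in the locally convex space \<^term>\<open>Cc sc Y\<close>.\<close>

definition MM ::
  "('k::real_normed_field \<Rightarrow> 'z::real_normed_vector \<Rightarrow> 'z) \<Rightarrow> 'x topology \<Rightarrow> 'y topology \<Rightarrow>
   ('x \<Rightarrow> 'y \<Rightarrow> 'z \<Rightarrow>\<^sub>L 'z) set" where
  "MM sc X Y = {F \<in> cont_maps X (Cc sc Y).
     (\<forall>K\<in>Comp Y. \<forall>z. bdd_above ((\<lambda>(x, s). norm (blinfun_apply (F x s) z)) ` (topspace X \<times> K))) \<and>
     (\<forall>K\<in>Comp Y. bdd_above ((\<lambda>(x, s). norm (F x s)) ` (topspace X \<times> K)))}"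

definition M_stalk ::
  "('k::real_normed_field \<Rightarrow> 'z::real_normed_vector \<Rightarrow> 'z) \<Rightarrow> 'x topology \<Rightarrow> 'y topology \<Rightarrow>
   'x \<Rightarrow> ('y \<Rightarrow> 'z \<Rightarrow>\<^sub>L 'z) set" where
  "M_stalk sc X Y x = Cc sc Y closure_of {F x | F. F \<in> MM sc X Y}"

definition mu :: "'y set \<Rightarrow> ('x \<Rightarrow> 'z::real_normed_vector) \<Rightarrow> 'x \<Rightarrow> ('y \<Rightarrow> 'z \<Rightarrow>\<^sub>L 'z) \<Rightarrow> real" where
  "mu K v x G = nsup (\<lambda>s. norm (blinfun_apply (G s) (v x))) K"

definition mu_sup ::
  "('y set \<times> ('x \<Rightarrow> 'z::real_normed_vector)) set \<Rightarrow> 'x \<Rightarrow> ('y \<Rightarrow> 'z \<Rightarrow>\<^sub>L 'z) \<Rightarrow> real" where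
  "mu_sup Q x G = nsup (\<lambda>(K, w). mu K w x G) Q"

definition mu_index :: "'x topology \<Rightarrow> 'y topology \<Rightarrow> ('y set \<times> ('x \<Rightarrow> 'z::real_normed_vector)) set set" where
  "mu_index X Y = {Q. finite Q \<and> Q \<subseteq> Comp Y \<times> Cb X}"

definition fdiff :: "'y topology \<Rightarrow> ('y \<Rightarrow> 'b::ab_group_add) \<Rightarrow> ('y \<Rightarrow> 'b) \<Rightarrow> ('y \<Rightarrow> 'b)" where
  "fdiff Y g h = (\<lambda>s\<in>topspace Y. g s - h s)"

definition M_tube ::
  "('k::real_normed_field \<Rightarrow> 'z::real_normed_vector \<Rightarrow> 'z) \<Rightarrow> 'x topology \<Rightarrow> 'y topology \<Rightarrow>
   'x set \<Rightarrow> ('x \<Rightarrow> 'y \<Rightarrow> 'z \<Rightarrow>\<^sub>L 'z) \<Rightarrow> ('y set \<times> ('x \<Rightarrow> 'z)) set \<Rightarrow> real \<Rightarrow>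
   ('x \<times> ('y \<Rightarrow> 'z \<Rightarrow>\<^sub>L 'z)) set" where
  "M_tube sc X Y U \<sigma> Q \<epsilon> =
     {(y, h). y \<in> U \<and> h \<in> M_stalk sc X Y y \<and> mu_sup Q y (fdiff Y h (\<sigma> y)) < \<epsilon>}"

definition M_top ::
  "('k::real_normed_field \<Rightarrow> 'z::real_normed_vector \<Rightarrow> 'z) \<Rightarrow> 'x topology \<Rightarrow> 'y topology \<Rightarrow>
   ('x \<times> ('y \<Rightarrow> 'z \<Rightarrow>\<^sub>L 'z)) topology" where
  "M_top sc X Y = topology (\<lambda>W. W \<subseteq> (SIGMA x:topspace X. M_stalk sc X Y x) \<and>
     (\<forall>(x, g)\<in>W. \<exists>U \<sigma> Q \<epsilon>. openin X U \<and> x \<in> U \<and> \<sigma> \<in> MM sc X Y \<and> Q \<in> mu_index X Y \<and> 0 < \<epsilon> \<and>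
        mu_sup Q x (fdiff Y g (\<sigma> x)) < \<epsilon> \<and> M_tube sc X Y U \<sigma> Q \<epsilon> \<subseteq> W))"

definition generated_bundle ::
  "('k::real_normed_field \<Rightarrow> 'z::real_normed_vector \<Rightarrow> 'z) \<Rightarrow> 'x topology \<Rightarrow> 'y topology \<Rightarrow>
   ('k, 'x \<times> ('y \<Rightarrow> 'z \<Rightarrow>\<^sub>L 'z), 'x) omega_bundle" where
  "generated_bundle sc X Y = \<lparr>
     tot = M_top sc X Y,
     proj = fst,
     base = X,
     szero = (\<lambda>x. (x, \<lambda>s\<in>topspace Y. 0)),
     sadd = (\<lambda>(x, g) (x', h). (x, \<lambda>s\<in>topspace Y. g s + h s)),
     smult = (\<lambda>k (x, g). (x, \<lambda>s\<in>topspace Y. Blinfun (\<lambda>z. sc k (blinfun_apply (g s) z)))),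
     semi = {\<lambda>(x, g). mu_sup Q x g | Q. Q \<in> mu_index X Y}\<rparr>"

definition trivial_bundle ::
  "('k::real_normed_field \<Rightarrow> 'z::real_normed_vector \<Rightarrow> 'z) \<Rightarrow> 'x topology \<Rightarrow>
   ('k, 'x \<times> 'z, 'x) omega_bundle" where
  "trivial_bundle sc X = \<lparr>
     tot = prod_topology X euclidean,
     proj = fst,
     base = X,
     szero = (\<lambda>x. (x, 0)),
     sadd = (\<lambda>(x, a) (x', b). (x, a + b)),
     smult = (\<lambda>k (x, a). (x, sc k a)),
     semi = {\<lambda>(x, a). norm a}\<rparr>"

text \<open>Identification of a family \<open>f\<close> with the section \<open>x \<mapsto> (x, f x)\<close>, and of an operator-valued map
  with a map into the endomorphisms of the stalk \<open>{x} \<times> Z\<close> of the trivial bundle.\<close>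

definition graph_section :: "'x topology \<Rightarrow> ('x \<Rightarrow> 'a) \<Rightarrow> 'x \<Rightarrow> 'x \<times> 'a" where
  "graph_section X f = (\<lambda>x\<in>topspace X. (x, f x))"

definition op_ev ::
  "'y topology \<Rightarrow> 'x \<times> ('y \<Rightarrow> 'z::real_normed_vector \<Rightarrow>\<^sub>L 'z) \<Rightarrow> 'y \<Rightarrow> 'x \<times> 'z \<Rightarrow> 'x \<times> 'z" where
  "op_ev Y = (\<lambda>(x, g). \<lambda>s\<in>topspace Y. \<lambda>a\<in>{x} \<times> UNIV. (x, blinfun_apply (g s) (snd a)))"

definition Theta_pt :: "'x topology \<Rightarrow> ('x \<Rightarrow> ('x \<times> 'z::real_normed_vector) set) set" where
  "Theta_pt X = {\<lambda>x\<in>topspace X. {(x, v x)} | v. v \<in> Cb X}"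

end

theory Submission
  imports Defs
begin

text \<open>
  On a selection that is norm bounded over compact sets and continuous at \<open>x\<close> into \<open>Cc sc Y\<close>
  (\<open>tame\<close>), every seminorm \<open>mu_sup Q\<close> is upper semicontinuous at \<open>x\<close>: in
  \<open>F(y)(s) w(y) - F(x)(s) w(x) = F(y)(s) (w(y) - w(x)) + (F(y)(s) - F(x)(s)) w(x)\<close> the norm bound controls
  the first term and continuity the second. Applied to differences of members of \<open>MM\<close> this makes the
  tubes a neighbourhood base of a bundle topology, and the fibrewise density of \<open>MM\<close> gives the
  remaining bundle axioms by approximation. The same two facts show that a norm-bounded selection is
  continuous at \<open>x\<close> into the bundle iff it is continuous at \<open>x\<close> into \<open>Cc sc Y\<close>, and moving the vector
  costs only the norm bound, so constant vectors and bounded continuous ones test the same continuity.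
\<close>

section \<open>Suprema and gauge topologies\<close>

text \<open>Basic tubes are centred at members of \<open>MM\<close>, so two tubes through a point
  usually have different centres, and a stalk element need not lie on any centre. The recurring move
  is therefore to change the centre: a member of \<open>MM\<close> close enough to the element at
  one point gives a smaller tube inside the old one, because the strict bounds used at that point
  persist nearby. Two kinds of selections must be kept apart. Members of \<open>MM\<close> are norm
  bounded over compact sets, whereas a continuous section of the bundle is bounded only in the
  seminorms; as \<open>Z\<close> need not be complete, pointwise bounds do not yield norm bounds. So
  the norm bound is carried explicitly in \<open>tame\<close>, and \<open>section_cont\<close>
  describes continuity into the bundle without it, by comparison with members of \<open>MM\<close>.
  The second notion covers tubes around arbitrary sections and the sections that occur in
  compatibility. Both notions refer to a single point, since the selection in (2) is tested at one
  point only.\<close>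

lemma nsup_upper: "bdd_above (f ` A) \<Longrightarrow> a \<in> A \<Longrightarrow> f a \<le> nsup f A"
  unfolding nsup_def by (intro cSup_upper) (auto simp: bdd_above_insert)

lemma nsup_nonneg: "bdd_above (f ` A) \<Longrightarrow> 0 \<le> nsup f A"
  unfolding nsup_def by (intro cSup_upper) (auto simp: bdd_above_insert)

lemma nsup_least: "0 \<le> c \<Longrightarrow> (\<And>a. a \<in> A \<Longrightarrow> f a \<le> c) \<Longrightarrow> nsup f A \<le> c"
  unfolding nsup_def by (intro cSup_least) auto

lemma nsup_cong: "A = B \<Longrightarrow> (\<And>a. a \<in> B \<Longrightarrow> f a = g a) \<Longrightarrow> nsup f A = nsup g B"
  unfolding nsup_def by (metis image_cong)

lemma nsup_image: "nsup f (g ` A) = nsup (\<lambda>a. f (g a)) A"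
  unfolding nsup_def by (simp add: image_image)

lemma nsup_empty [simp]: "nsup f {} = 0"
  by (simp add: nsup_def)

lemma nsup_singleton: "0 \<le> f a \<Longrightarrow> nsup f {a} = f a"
  by (intro antisym nsup_least nsup_upper) auto

lemma nsup_zero [simp]: "nsup (\<lambda>_. 0) A = 0"
  by (intro antisym nsup_least nsup_nonneg) auto

text \<open>Over a finite index set the supremum is a maximum, so strict bounds pass through it; the
  conjunct \<open>0 < c\<close> reflects the inserted 0.\<close>

lemma nsup_less_finite_iff:
  assumes "finite A"
  shows "nsup f A < c \<longleftrightarrow> 0 < c \<and> (\<forall>a\<in>A. f a < c)"
  unfolding nsup_def using assms by (simp add: cSup_eq_Max)

lemma nsup_mult_left:
  assumes "0 \<le> c" "bdd_above (f ` A)"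
  shows "nsup (\<lambda>a. c * f a) A = c * nsup f A"
proof (cases "c = 0")
  case False
  then have c: "0 < c" using assms by simp
  have b: "bdd_above ((\<lambda>a. c * f a) ` A)"
    using bdd_above.I2[of A "\<lambda>a. c * f a" "c * nsup f A"] nsup_upper[OF assms(2)] c by simp
  have "nsup f A \<le> nsup (\<lambda>a. c * f a) A / c"
    using c nsup_nonneg[OF b] nsup_upper[OF b]
    by (intro nsup_least) (auto simp: field_simps)
  moreover have "nsup (\<lambda>a. c * f a) A \<le> c * nsup f A"
    using c nsup_nonneg[OF assms(2)] nsup_upper[OF assms(2)] by (intro nsup_least) auto
  ultimately show ?thesis
    using c by (simp add: field_simps)
qed simp

section \<open>Gauge topologies of pseudometrics: balls, closure, continuity, separation\<close>

lemma gauge_topology_ballE: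
  assumes "openin (gauge_topology V D) W" "g \<in> W"
  obtains F \<epsilon> where "finite F" "F \<subseteq> D" "0 < \<epsilon>" "{h \<in> V. \<forall>d\<in>F. d g h < \<epsilon>} \<subseteq> W"
  using assms unfolding openin_gauge_topology by meson

text \<open>\<open>gauge_topology\<close> accepts arbitrary functions; these laws are what makes its
  balls open, hence a neighbourhood base.\<close>

definition pseudometrics :: "'a set \<Rightarrow> ('a \<Rightarrow> 'a \<Rightarrow> real) set \<Rightarrow> bool" where
  "pseudometrics V D \<longleftrightarrow> (\<forall>d\<in>D. \<forall>g\<in>V. d g g = 0 \<and>
     (\<forall>h\<in>V. d g h = d h g \<and> (\<forall>k\<in>V. d g k \<le> d g h + d h k)))"

lemma pseudometrics_refl: "pseudometrics V D \<Longrightarrow> d \<in> D \<Longrightarrow> g \<in> V \<Longrightarrow> d g g = 0"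
  unfolding pseudometrics_def by blast

lemma openin_gauge_ball:
  assumes D: "pseudometrics V D" "finite F" "F \<subseteq> D" "g \<in> V"
  shows "openin (gauge_topology V D) {h \<in> V. \<forall>d\<in>F. d g h < \<epsilon>}"
  unfolding openin_gauge_topology
proof (intro conjI ballI)
  fix h assume h: "h \<in> {h \<in> V. \<forall>d\<in>F. d g h < \<epsilon>}"
  \<comment> \<open>The least room left by finitely many gauges; the inserted 1 gives
    \<open>Min\<close> a positive value also for empty \<open>F\<close>.\<close>
  define \<delta> where "\<delta> = Min (insert 1 ((\<lambda>d. \<epsilon> - d g h) ` F))"
  have "0 < \<delta>"
    unfolding \<delta>_def using h D(2) by (subst Min_gr_iff) auto
  moreover have "\<delta> \<le> \<epsilon> - d g h" if "d \<in> F" for d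
    unfolding \<delta>_def using D(2) that by (intro Min_le) auto
  moreover have "d g k \<le> d g h + d h k" if "d \<in> F" "k \<in> V" for d k
    using D h that unfolding pseudometrics_def by blast
  ultimately have "{k \<in> V. \<forall>d\<in>F. d h k < \<delta>} \<subseteq> {k \<in> V. \<forall>d\<in>F. d g k < \<epsilon>}"
    by (smt (verit) mem_Collect_eq subsetI)
  then show "\<exists>F' \<delta>. finite F' \<and> F' \<subseteq> D \<and> 0 < \<delta> \<and>
      {k \<in> V. \<forall>d\<in>F'. d h k < \<delta>} \<subseteq> {h \<in> V. \<forall>d\<in>F. d g h < \<epsilon>}"
    using D \<open>0 < \<delta>\<close> by blast
qed blast

lemma in_closure_of_gauge_topology:
  assumes D: "pseudometrics V D"
  shows "g \<in> gauge_topology V D closure_of S \<longleftrightarrow>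
    g \<in> V \<and> (\<forall>F \<epsilon>. finite F \<and> F \<subseteq> D \<and> 0 < \<epsilon> \<longrightarrow> (\<exists>h\<in>S \<inter> V. \<forall>d\<in>F. d g h < \<epsilon>))"
    (is "?L \<longleftrightarrow> ?R")
proof
  assume L: ?L
  have g: "g \<in> V"
    using L by (simp add: in_closure_of)
  have "\<exists>h\<in>S \<inter> V. \<forall>d\<in>F. d g h < \<epsilon>" if F: "finite F" "F \<subseteq> D" "0 < \<epsilon>" for F \<epsilon>
  proof -
    have "g \<in> {h \<in> V. \<forall>d\<in>F. d g h < \<epsilon>}"
      using g F pseudometrics_refl[OF D] by (smt (verit) mem_Collect_eq subsetD)
    then obtain h where "h \<in> S" "h \<in> {h \<in> V. \<forall>d\<in>F. d g h < \<epsilon>}"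
      using L openin_gauge_ball[OF D F(1,2) g, of \<epsilon>] unfolding in_closure_of by meson
    then show ?thesis
      by simp (meson IntI)
  qed
  then show ?R
    using g by simp
next
  assume R: ?R
  show ?L
    unfolding in_closure_of
  proof (intro conjI allI impI)
    fix T assume "g \<in> T \<and> openin (gauge_topology V D) T"
    then have "openin (gauge_topology V D) T" "g \<in> T" by auto
    then obtain F \<epsilon> where F: "finite F" "F \<subseteq> D" "0 < \<epsilon>" "{h \<in> V. \<forall>d\<in>F. d g h < \<epsilon>} \<subseteq> T"
      by (rule gauge_topology_ballE)
    have "\<exists>h\<in>S \<inter> V. \<forall>d\<in>F. d g h < \<epsilon>"
      using F(1-3) R by simp
    then obtain h where h: "h \<in> S \<inter> V" "\<forall>d\<in>F. d g h < \<epsilon>"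
      by (rule bexE)
    then have "h \<in> T"
      by (intro subsetD[OF F(4)]) simp
    then show "\<exists>y. y \<in> S \<and> y \<in> T"
      using h(1) by auto
  qed (use R in simp)
qed

text \<open>Gauges can be tested one at a time: an open set contains a ball for finitely many of
  them, and finitely many eventual bounds hold simultaneously.\<close>

lemma topcontinuous_at_gauge_topology:
  assumes D: "pseudometrics V D"
  shows "topcontinuous_at X (gauge_topology V D) f x \<longleftrightarrow>
    x \<in> topspace X \<and> f \<in> topspace X \<rightarrow> V \<and>
    (\<forall>d\<in>D. \<forall>\<epsilon>>0. \<forall>\<^sub>F y in nhdsin X x. d (f x) (f y) < \<epsilon>)"
    (is "?L \<longleftrightarrow> ?R")
proof
  assume L: ?L
  then have x: "x \<in> topspace X" "f \<in> topspace X \<rightarrow> V"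
    by (auto simp: topcontinuous_at_def)
  have "\<forall>\<^sub>F y in nhdsin X x. d (f x) (f y) < \<epsilon>" if d: "d \<in> D" "0 < \<epsilon>" for d \<epsilon>
  proof -
    have "f x \<in> {h \<in> V. \<forall>d\<in>{d}. d (f x) h < \<epsilon>}"
      using pseudometrics_refl[OF D d(1), of "f x"] d(2) funcset_mem[OF x(2,1)] by simp
    then obtain U where "openin X U" "x \<in> U" "\<forall>y\<in>U. f y \<in> {h \<in> V. \<forall>d\<in>{d}. d (f x) h < \<epsilon>}"
      using L openin_gauge_ball[OF D, of "{d}" "f x" \<epsilon>] x d(1)
      unfolding topcontinuous_at_def by blast
    then show ?thesis
      unfolding eventually_nhdsin by auto
  qed
  then show ?R
    using x by blast
next
  assume R: ?R
  show ?L
    unfolding topcontinuous_at_def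
  proof (intro conjI allI impI)
    fix W assume "openin (gauge_topology V D) W \<and> f x \<in> W"
    then have "openin (gauge_topology V D) W" "f x \<in> W" by auto
    then obtain F \<epsilon> where F: "finite F" "F \<subseteq> D" "0 < \<epsilon>" "{h \<in> V. \<forall>d\<in>F. d (f x) h < \<epsilon>} \<subseteq> W"
      by (rule gauge_topology_ballE)
    have "\<forall>\<^sub>F y in nhdsin X x. \<forall>d\<in>F. d (f x) (f y) < \<epsilon>"
      using F R by (intro eventually_ball_finite) auto
    then obtain U where U: "openin X U" "x \<in> U" "\<forall>y\<in>U. \<forall>d\<in>F. d (f x) (f y) < \<epsilon>"
      using R unfolding eventually_nhdsin by blast
    have "f y \<in> W" if "y \<in> U" for y
    proof (rule subsetD[OF F(4)])
      have "f y \<in> V"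
        using R openin_subset[OF U(1)] that by blast
      then show "f y \<in> {h \<in> V. \<forall>d\<in>F. d (f x) h < \<epsilon>}"
        using U(3) that by simp
    qed
    then show "\<exists>U. openin X U \<and> x \<in> U \<and> (\<forall>y\<in>U. f y \<in> W)"
      using U(1,2) by blast
  qed (use R in auto)
qed

lemma Hausdorff_gauge_topology:
  assumes D: "pseudometrics V D"
    and sep: "\<And>g h. g \<in> V \<Longrightarrow> h \<in> V \<Longrightarrow> g \<noteq> h \<Longrightarrow> \<exists>d\<in>D. 0 < d g h"
  shows "Hausdorff_space (gauge_topology V D)"
  unfolding Hausdorff_space_def
proof (intro allI impI)
  fix g h assume "g \<in> topspace (gauge_topology V D) \<and> h \<in> topspace (gauge_topology V D) \<and> g \<noteq> h"
  then have g: "g \<in> V" "h \<in> V" "g \<noteq> h" by auto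
  then obtain d where d: "d \<in> D" "0 < d g h"
    using sep by blast
  have laws: "d g g = 0" "d h h = 0" "\<And>k. k \<in> V \<Longrightarrow> d g h \<le> d g k + d k h"
      "\<And>k. k \<in> V \<Longrightarrow> d k h = d h k"
    using D d g unfolding pseudometrics_def by blast+
  define A where "A c = {k \<in> V. \<forall>e\<in>{d}. e c k < d g h / 2}" for c
  have "openin (gauge_topology V D) (A g)" "openin (gauge_topology V D) (A h)"
    unfolding A_def by (rule openin_gauge_ball[OF D]; use d g in simp)+
  moreover have "disjnt (A g) (A h)"
    unfolding disjnt_iff A_def using laws(3,4) by (smt (verit) field_sum_of_halves mem_Collect_eq insertI1)
  moreover have "g \<in> A g" "h \<in> A h"
    unfolding A_def using g d laws(1,2) by auto
  ultimately show "\<exists>U V'. openin (gauge_topology V D) U \<and> openin (gauge_topology V D) V' \<and>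
      g \<in> U \<and> h \<in> V' \<and> disjnt U V'"
    by blast
qed

text \<open>\<open>atin\<close> is the punctured filter; since \<phi> vanishes at x, including the
  point adds no constraint.\<close>

lemma tendsto_zero_atin_iff:
  fixes \<phi> :: "'a \<Rightarrow> real"
  assumes "x \<in> topspace X" "\<phi> x = 0" "\<And>y. y \<in> topspace X \<Longrightarrow> 0 \<le> \<phi> y"
  shows "(\<phi> \<longlongrightarrow> 0) (atin X x) \<longleftrightarrow> (\<forall>\<epsilon>>0. \<forall>\<^sub>F y in nhdsin X x. \<phi> y < \<epsilon>)"
proof -
  have "(\<forall>\<^sub>F y in atin X x. dist (\<phi> y) 0 < \<epsilon>) \<longleftrightarrow> (\<forall>\<^sub>F y in nhdsin X x. \<phi> y < \<epsilon>)" if "0 < \<epsilon>" for \<epsilon>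
  proof -
    have "(\<forall>y\<in>U - {x}. dist (\<phi> y) 0 < \<epsilon>) \<longleftrightarrow> (\<forall>y\<in>U. \<phi> y < \<epsilon>)" if "openin X U" for U
    proof -
      have "\<bar>\<phi> y\<bar> = \<phi> y" if "y \<in> U" for y
        using assms(3) openin_subset[OF \<open>openin X U\<close>] that by auto
      then show ?thesis
        using assms(2) \<open>0 < \<epsilon>\<close> by (auto simp: dist_real_def)
    qed
    then show ?thesis
      unfolding eventually_atin eventually_nhdsin using assms(1) by blast
  qed
  then show ?thesis
    unfolding tendsto_iff by blast
qed

lemma continuous_map_euclidean_iff_nhdsin:
  fixes w :: "'a \<Rightarrow> 'b::real_normed_vector"
  shows "continuous_map T euclidean w \<longleftrightarrow>
    (\<forall>t\<in>topspace T. \<forall>\<epsilon>>0. \<forall>\<^sub>F s in nhdsin T t. norm (w s - w t) < \<epsilon>)"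
  unfolding continuous_map_eq_topcontinuous_at
proof (rule ball_cong[OF refl], rule iffI, intro allI impI)
  fix t and \<epsilon> :: real assume "topcontinuous_at T euclidean w t" "0 < \<epsilon>"
  then obtain U where "openin T U" "t \<in> U" "\<forall>s\<in>U. w s \<in> ball (w t) \<epsilon>"
    unfolding topcontinuous_at_def by (metis centre_in_ball open_ball open_openin)
  then show "\<forall>\<^sub>F s in nhdsin T t. norm (w s - w t) < \<epsilon>"
    unfolding eventually_nhdsin by (auto simp: dist_norm norm_minus_commute)
next
  fix t assume t: "t \<in> topspace T" and ev: "\<forall>\<epsilon>>0. \<forall>\<^sub>F s in nhdsin T t. norm (w s - w t) < \<epsilon>"
  have "\<exists>U. openin T U \<and> t \<in> U \<and> (\<forall>s\<in>U. w s \<in> A)" if A: "open A" "w t \<in> A" for A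
  proof -
    obtain \<epsilon> where \<epsilon>: "0 < \<epsilon>" "ball (w t) \<epsilon> \<subseteq> A"
      using A open_contains_ball by blast
    then have "\<forall>\<^sub>F s in nhdsin T t. norm (w s - w t) < \<epsilon>"
      using ev by blast
    then have "\<forall>\<^sub>F s in nhdsin T t. w s \<in> A"
      by eventually_elim (use \<epsilon>(2) in \<open>auto simp: dist_norm norm_minus_commute\<close>)
    then show ?thesis
      using t unfolding eventually_nhdsin by blast
  qed
  then show "topcontinuous_at T euclidean w t"
    unfolding topcontinuous_at_def using t by auto
qed

lemma openin_prod_euclidean_ballE:
  fixes z :: "'b::real_normed_vector"
  assumes "openin (prod_topology X euclidean) W" "(x, z) \<in> W"
  obtains U \<epsilon> where "openin X U" "x \<in> U" "0 < \<epsilon>" "\<And>y a. y \<in> U \<Longrightarrow> norm (a - z) < \<epsilon> \<Longrightarrow> (y, a) \<in> W"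
proof -
  have "\<exists>U T. openin X U \<and> openin euclidean T \<and> x \<in> U \<and> z \<in> T \<and> U \<times> T \<subseteq> W"
    using assms unfolding openin_prod_topology_alt by simp
  then obtain U T where U: "openin X U" "open T" "x \<in> U" "z \<in> T" "U \<times> T \<subseteq> W"
    by auto
  obtain \<epsilon> where \<epsilon>: "0 < \<epsilon>" "ball z \<epsilon> \<subseteq> T"
    using U(2,4) open_contains_ball by blast
  have "(y, a) \<in> W" if "y \<in> U" "norm (a - z) < \<epsilon>" for y a
    using \<epsilon>(2) U(5) that by (auto simp: subset_iff dist_norm norm_minus_commute)
  then show ?thesis
    using that U(1,3) \<epsilon>(1) by blast
qed

section \<open>Operator-valued maps\<close>

locale operator_fields =
  fixes sc :: "'k::real_normed_field \<Rightarrow> 'z::real_normed_vector \<Rightarrow> 'z"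
    and X :: "'x topology" and Y :: "'y topology"
  assumes normed_space: "normed_space_over sc"
begin

sublocale sc: vector_space sc
  using normed_space by (simp add: normed_space_over_def)

lemma norm_sc: "norm (sc k z) = norm k * norm z"
  using normed_space by (simp add: normed_space_over_def)

lemma sc_of_real: "sc (of_real r) z = r *\<^sub>R z"
  using normed_space by (simp add: normed_space_over_def)

text \<open>Real scalars act through \<open>of_real\<close>, so commutativity of the field makes
  \<open>sc k\<close> real-linear. This is what gives \<open>Blinfun\<close> its intended value in
  the scalar multiples of operators.\<close>

lemma bounded_linear_sc: "bounded_linear (sc k)"
proof (rule bounded_linear_intro)
  show "sc k (r *\<^sub>R z) = r *\<^sub>R sc k z" for r z
    by (simp flip: sc_of_real add: mult.commute)
  show "norm (sc k z) \<le> norm z * norm k" for z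
    by (simp add: norm_sc mult.commute)
qed (simp add: sc.scale_right_distrib)

lemma bounded_bilinear_sc: "bounded_bilinear sc"
proof
  show "\<exists>K. \<forall>a b. norm (sc a b) \<le> norm a * norm b * K"
    by (rule exI[of _ 1]) (simp add: norm_sc)
  show "sc (r *\<^sub>R a) b = r *\<^sub>R sc a b" for r a b
    by (simp flip: sc_of_real add: scaleR_conv_of_real)
  show "sc a (r *\<^sub>R b) = r *\<^sub>R sc a b" for r a b
    by (simp flip: sc_of_real add: mult.commute)
qed (simp_all add: sc.scale_left_distrib sc.scale_right_distrib)

lemma Blinfun_sc_apply [simp]: "blinfun_apply (Blinfun (\<lambda>z. sc k (blinfun_apply T z))) z = sc k (blinfun_apply T z)"
  using bounded_linear_compose[OF bounded_linear_sc[of k] blinfun.bounded_linear_right[of T]]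
  by (simp only: bounded_linear_Blinfun_apply)

lemma norm_Blinfun_sc: "norm (Blinfun (\<lambda>z. sc k (blinfun_apply T z))) \<le> norm k * norm T"
proof (rule norm_blinfun_bound)
  show "norm (blinfun_apply (Blinfun (\<lambda>z. sc k (blinfun_apply T z))) z) \<le> norm k * norm T * norm z" for z
    using mult_left_mono[OF norm_blinfun[of T z] norm_ge_zero[of k]] by (simp add: norm_sc mult.assoc)
qed simp

section \<open>Pointwise operations and the seminorms of \<open>Cc sc Y\<close>\<close>

abbreviation V :: "('y \<Rightarrow> 'z \<Rightarrow>\<^sub>L 'z) set" where
  "V \<equiv> cont_maps Y (Bs sc)"

definition madd :: "('y \<Rightarrow> 'z \<Rightarrow>\<^sub>L 'z) \<Rightarrow> ('y \<Rightarrow> 'z \<Rightarrow>\<^sub>L 'z) \<Rightarrow> 'y \<Rightarrow> 'z \<Rightarrow>\<^sub>L 'z" where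
  "madd g h = (\<lambda>s\<in>topspace Y. g s + h s)"

definition mscale :: "'k \<Rightarrow> ('y \<Rightarrow> 'z \<Rightarrow>\<^sub>L 'z) \<Rightarrow> 'y \<Rightarrow> 'z \<Rightarrow>\<^sub>L 'z" where
  "mscale k g = (\<lambda>s\<in>topspace Y. Blinfun (\<lambda>z. sc k (blinfun_apply (g s) z)))"

definition mzero :: "'y \<Rightarrow> 'z \<Rightarrow>\<^sub>L 'z" where
  "mzero = (\<lambda>s\<in>topspace Y. 0)"

definition pn :: "'y set \<Rightarrow> 'z \<Rightarrow> ('y \<Rightarrow> 'z \<Rightarrow>\<^sub>L 'z) \<Rightarrow> real" where
  "pn K z g = nsup (\<lambda>s. norm (blinfun_apply (g s) z)) K"

lemma mu_eq_pn: "mu K v x g = pn K (v x) g"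
  by (simp add: mu_def pn_def)

lemma Comp_subset: "K \<in> Comp Y \<Longrightarrow> K \<subseteq> topspace Y"
  by (simp add: Comp_def compactin_subset_topspace)

lemma V_iff:
  "g \<in> V \<longleftrightarrow> g \<in> extensional (topspace Y) \<and>
    (\<forall>s\<in>topspace Y. Vector_Spaces.linear sc sc (blinfun_apply (g s))) \<and>
    (\<forall>z. continuous_map Y euclidean (\<lambda>s. blinfun_apply (g s) z))"
  unfolding cont_maps_def Bs_def B_ops_def continuous_map_in_subtopology
    continuous_on_strong_operator_topo_iff_coordinatewise by auto

lemma V_extensional: "g \<in> V \<Longrightarrow> g \<in> extensional (topspace Y)"
  by (simp add: V_iff)

lemma linear_add_sc:
  "Vector_Spaces.linear sc sc (\<lambda>z. f z + g z)"
  if "Vector_Spaces.linear sc sc f" "Vector_Spaces.linear sc sc g"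
  using that unfolding Vector_Spaces.linear_def module_hom_def module_hom_axioms_def
  by (auto simp: sc.scale_right_distrib algebra_simps)

lemma linear_scale_sc:
  "Vector_Spaces.linear sc sc (\<lambda>z. sc k (f z))" if "Vector_Spaces.linear sc sc f"
  using that unfolding Vector_Spaces.linear_def module_hom_def module_hom_axioms_def
  by (auto simp: sc.scale_right_distrib mult.commute)

lemma linear_zero_sc: "Vector_Spaces.linear sc sc (\<lambda>z. 0)"
  unfolding Vector_Spaces.linear_def module_hom_def module_hom_axioms_def
  by (auto intro: sc.vector_space_axioms sc.module_axioms)

lemma V_zero: "mzero \<in> V"
proof -
  have "continuous_map Y euclidean (\<lambda>s. blinfun_apply (mzero s) z)" for z
    by (rule continuous_map_eq[of _ _ "\<lambda>_. 0"]) (auto simp: mzero_def)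
  then show ?thesis
    using linear_zero_sc by (simp add: V_iff mzero_def zero_blinfun.rep_eq)
qed

lemma V_add: assumes "g \<in> V" "h \<in> V" shows "madd g h \<in> V"
proof -
  have "continuous_map Y euclidean (\<lambda>s. blinfun_apply (madd g h s) z)" for z
    by (rule continuous_map_eq[OF continuous_map_add[of Y "\<lambda>s. blinfun_apply (g s) z"
            "\<lambda>s. blinfun_apply (h s) z"]])
      (use assms in \<open>auto simp: V_iff madd_def blinfun.add_left\<close>)
  moreover have "blinfun_apply (g s + h s) = (\<lambda>z. blinfun_apply (g s) z + blinfun_apply (h s) z)" for s
    by (auto simp: blinfun.add_left)
  ultimately show ?thesis
    using assms by (simp add: V_iff madd_def linear_add_sc)
qed

lemma V_scale: assumes "g \<in> V" shows "mscale k g \<in> V"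
proof -
  have "continuous_map Y euclidean (sc k \<circ> (\<lambda>s. blinfun_apply (g s) z))" for z
    using assms linear_continuous_on[OF bounded_linear_sc[of k]]
    by (intro continuous_map_compose[of _ euclidean]) (auto simp: V_iff)
  then have "continuous_map Y euclidean (\<lambda>s. blinfun_apply (mscale k g s) z)" for z
    by (rule continuous_map_eq) (auto simp: mscale_def)
  moreover have "blinfun_apply (Blinfun (\<lambda>z. sc k (blinfun_apply (g s) z))) =
      (\<lambda>z. sc k (blinfun_apply (g s) z))" for s
    by auto
  ultimately show ?thesis
    using assms by (simp add: V_iff mscale_def linear_scale_sc)
qed

text \<open>Reduces differences to sums and multiples, for \<open>V\<close> and for
  \<open>tame\<close>, and identifies \<open>fdiff\<close> with the \<open>sdiff\<close> of the
  generated bundle.\<close>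

lemma fdiff_eq: "fdiff Y g h = madd g (mscale (-1) h)"
proof -
  have "g s - h s = g s + Blinfun (\<lambda>z. sc (-1) (blinfun_apply (h s) z))" for s
    by (rule blinfun_eqI, subst blinfun.add_left, subst Blinfun_sc_apply)
      (simp add: blinfun.diff_left)
  then show ?thesis
    unfolding fdiff_def madd_def mscale_def by (intro restrict_ext) simp
qed

lemma V_diff: "g \<in> V \<Longrightarrow> h \<in> V \<Longrightarrow> fdiff Y g h \<in> V"
  by (simp add: fdiff_eq V_add V_scale)

text \<open>Strong continuity makes s \<mapsto> norm (g s z) continuous, hence bounded on a compact
  set for each vector z separately. So \<open>pn\<close> is a genuine supremum, although no operator
  norm bound is available on \<open>V\<close>.\<close>

lemma V_bdd:
  assumes "g \<in> V" "K \<in> Comp Y"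
  shows "bdd_above ((\<lambda>s. norm (blinfun_apply (g s) z)) ` K)"
proof -
  have "continuous_map Y euclidean (\<lambda>s. norm (blinfun_apply (g s) z))"
    using assms by (intro continuous_map_norm) (simp add: V_iff)
  then have "compactin euclidean ((\<lambda>s. norm (blinfun_apply (g s) z)) ` K)"
    using assms(2) by (intro image_compactin) (auto simp: Comp_def)
  then show ?thesis
    by (simp add: bounded_imp_bdd_above compact_imp_bounded)
qed

lemma pn_nonneg: "g \<in> V \<Longrightarrow> K \<in> Comp Y \<Longrightarrow> 0 \<le> pn K z g"
  unfolding pn_def by (rule nsup_nonneg[OF V_bdd])

lemma pn_upper: "g \<in> V \<Longrightarrow> K \<in> Comp Y \<Longrightarrow> s \<in> K \<Longrightarrow> norm (blinfun_apply (g s) z) \<le> pn K z g"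
  unfolding pn_def by (rule nsup_upper[OF V_bdd])

lemma pn_add:
  assumes "g \<in> V" "h \<in> V" "K \<in> Comp Y"
  shows "pn K z (madd g h) \<le> pn K z g + pn K z h"
  unfolding pn_def[of _ _ "madd g h"]
proof (rule nsup_least)
  fix s assume s: "s \<in> K"
  then have "madd g h s = g s + h s"
    using Comp_subset[OF assms(3)] by (auto simp: madd_def)
  then have "norm (blinfun_apply (madd g h s) z) \<le> norm (blinfun_apply (g s) z) + norm (blinfun_apply (h s) z)"
    by (simp add: blinfun.add_left norm_triangle_ineq)
  also have "\<dots> \<le> pn K z g + pn K z h"
    using assms s by (intro add_mono pn_upper)
  finally show "norm (blinfun_apply (madd g h s) z) \<le> pn K z g + pn K z h" .
qed (simp add: assms pn_nonneg)

lemma pn_scale: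
  assumes "g \<in> V" "K \<in> Comp Y"
  shows "pn K z (mscale k g) = norm k * pn K z g"
proof -
  have "pn K z (mscale k g) = nsup (\<lambda>s. norm k * norm (blinfun_apply (g s) z)) K"
    unfolding pn_def using Comp_subset[OF assms(2)]
    by (intro nsup_cong) (auto simp: mscale_def norm_sc)
  then show ?thesis
    by (simp add: nsup_mult_left V_bdd assms pn_def)
qed

lemma pn_fdiff:
  "K \<in> Comp Y \<Longrightarrow> pn K z (fdiff Y g h) = nsup (\<lambda>s. norm (blinfun_apply (g s) z - blinfun_apply (h s) z)) K"
  unfolding pn_def using Comp_subset[of K]
  by (intro nsup_cong) (auto simp: fdiff_def blinfun.diff_left)

lemma pn_fdiff_commute: "K \<in> Comp Y \<Longrightarrow> pn K z (fdiff Y g h) = pn K z (fdiff Y h g)"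
  by (simp add: pn_fdiff norm_minus_commute)

lemma madd_fdiff: "fdiff Y g k = madd (fdiff Y g h) (fdiff Y h k)"
  unfolding madd_def fdiff_def by (rule restrict_ext) simp

lemma pn_fdiff_triangle:
  "\<lbrakk>g \<in> V; h \<in> V; k \<in> V; K \<in> Comp Y\<rbrakk> \<Longrightarrow> pn K z (fdiff Y g k) \<le> pn K z (fdiff Y g h) + pn K z (fdiff Y h k)"
  by (subst madd_fdiff[of g k h]) (intro pn_add V_diff)

lemma fdiff_self: "fdiff Y g g = mzero"
  by (auto simp: fdiff_def mzero_def)

lemma madd_commute: "madd g h = madd h g"
  by (simp add: madd_def add.commute)

lemma pn_zero [simp]: "K \<in> Comp Y \<Longrightarrow> pn K z mzero = 0"
  using pn_fdiff[of K z mzero mzero] by (simp add: fdiff_self)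

section \<open>The seminorms \<open>mu_sup\<close>\<close>

abbreviation idx :: "('y set \<times> ('x \<Rightarrow> 'z)) set set" where
  "idx \<equiv> mu_index X Y"

lemma mu_index_pair: "Q \<in> idx \<Longrightarrow> (K, w) \<in> Q \<Longrightarrow> K \<in> Comp Y \<and> w \<in> Cb X"
  by (auto simp: mu_index_def)

lemma mu_index_finite: "Q \<in> idx \<Longrightarrow> finite Q"
  by (simp add: mu_index_def)

lemma mu_index_empty: "{} \<in> idx"
  by (simp add: mu_index_def)

lemma mu_index_insert: "K \<in> Comp Y \<Longrightarrow> w \<in> Cb X \<Longrightarrow> Q \<in> idx \<Longrightarrow> insert (K, w) Q \<in> idx"
  by (simp add: mu_index_def)

lemma mu_index_Un: "Q \<in> idx \<Longrightarrow> Q' \<in> idx \<Longrightarrow> Q \<union> Q' \<in> idx"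
  by (simp add: mu_index_def)

lemma mu_sup_less_iff:
  "Q \<in> idx \<Longrightarrow> mu_sup Q x g < c \<longleftrightarrow> 0 < c \<and> (\<forall>(K, w)\<in>Q. pn K (w x) g < c)"
  unfolding mu_sup_def by (auto simp: nsup_less_finite_iff[OF mu_index_finite] mu_eq_pn)

lemma mu_sup_upper: "Q \<in> idx \<Longrightarrow> (K, w) \<in> Q \<Longrightarrow> pn K (w x) g \<le> mu_sup Q x g"
  unfolding mu_sup_def using nsup_upper[of "\<lambda>(K, w). mu K w x g" Q "(K, w)"]
  by (simp add: mu_eq_pn mu_index_finite)

lemma mu_sup_nonneg: "Q \<in> idx \<Longrightarrow> 0 \<le> mu_sup Q x g"
  unfolding mu_sup_def by (intro nsup_nonneg) (simp add: mu_index_finite)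

lemma mu_sup_least:
  "0 \<le> c \<Longrightarrow> (\<And>K w. (K, w) \<in> Q \<Longrightarrow> pn K (w x) g \<le> c) \<Longrightarrow> mu_sup Q x g \<le> c"
  unfolding mu_sup_def by (rule nsup_least) (auto simp: mu_eq_pn)

lemma mu_sup_mono:
  "Q \<subseteq> Q' \<Longrightarrow> Q' \<in> idx \<Longrightarrow> mu_sup Q x g \<le> mu_sup Q' x g"
  by (rule mu_sup_least) (auto intro: mu_sup_upper mu_sup_nonneg)

lemma mu_sup_zero: "Q \<in> idx \<Longrightarrow> mu_sup Q x mzero = 0"
  by (intro antisym mu_sup_least mu_sup_nonneg) (auto dest: mu_index_pair)

lemma mu_sup_add:
  assumes "g \<in> V" "h \<in> V" "Q \<in> idx"
  shows "mu_sup Q x (madd g h) \<le> mu_sup Q x g + mu_sup Q x h"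
proof (rule mu_sup_least)
  fix K w assume Kw: "(K, w) \<in> Q"
  have "pn K (w x) (madd g h) \<le> pn K (w x) g + pn K (w x) h"
    using assms Kw mu_index_pair by (intro pn_add) auto
  also have "\<dots> \<le> mu_sup Q x g + mu_sup Q x h"
    using assms(3) Kw by (intro add_mono mu_sup_upper)
  finally show "pn K (w x) (madd g h) \<le> mu_sup Q x g + mu_sup Q x h" .
qed (simp add: mu_sup_nonneg assms)

lemma mu_sup_scale:
  assumes "g \<in> V" "Q \<in> idx"
  shows "mu_sup Q x (mscale k g) = norm k * mu_sup Q x g"
proof -
  have "mu_sup Q x (mscale k g) = nsup (\<lambda>i. norm k * (\<lambda>(K, w). mu K w x g) i) Q"
    unfolding mu_sup_def using assms
    by (intro nsup_cong) (auto simp: mu_eq_pn pn_scale dest: mu_index_pair)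
  then show ?thesis
    by (simp add: mu_sup_def nsup_mult_left mu_index_finite[OF assms(2)])
qed

lemma mu_sup_fdiff_commute:
  "Q \<in> idx \<Longrightarrow> mu_sup Q x (fdiff Y g h) = mu_sup Q x (fdiff Y h g)"
  unfolding mu_sup_def
  by (intro nsup_cong) (auto simp: mu_eq_pn dest!: mu_index_pair intro!: pn_fdiff_commute)

lemma mu_sup_fdiff_triangle:
  "\<lbrakk>g \<in> V; h \<in> V; k \<in> V; Q \<in> idx\<rbrakk> \<Longrightarrow>
    mu_sup Q x (fdiff Y g k) \<le> mu_sup Q x (fdiff Y g h) + mu_sup Q x (fdiff Y h k)"
  by (subst madd_fdiff[of g k h]) (intro mu_sup_add V_diff)

text \<open>Constants make every seminorm \<open>pn K z\<close> of \<open>Cc sc Y\<close> occur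
  among the \<open>mu_sup\<close>; the restriction is there because members of \<open>Cb X\<close>
  are extensional.\<close>

lemma const_Cb: "(\<lambda>x\<in>topspace X. z) \<in> Cb X"
proof -
  have "continuous_map X euclidean (\<lambda>x\<in>topspace X. z)"
    by (rule continuous_map_eq[of _ _ "\<lambda>_. z"]) auto
  moreover have "(\<lambda>x\<in>topspace X. z) ` topspace X \<subseteq> {z}"
    by auto
  ultimately show ?thesis
    unfolding Cb_def cont_maps_def by (auto intro: bounded_subset[of "{z}"])
qed

section \<open>Norm-bounded selections continuous at a point\<close>

lemma eventually_topspace: "\<forall>\<^sub>F y in nhdsin X x. y \<in> topspace X"
  unfolding eventually_nhdsin using openin_subset by blast

lemma eventually_nhdsin_at: "eventually P (nhdsin X x) \<Longrightarrow> x \<in> topspace X \<Longrightarrow> P x"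
  unfolding eventually_nhdsin by blast

lemma Cb_bounded: "w \<in> Cb X \<Longrightarrow> \<exists>C. \<forall>x\<in>topspace X. norm (w x) \<le> C"
  unfolding Cb_def bounded_iff by auto

lemma Cb_eventually_near:
  assumes "w \<in> Cb X" "x \<in> topspace X" "0 < \<epsilon>"
  shows "\<forall>\<^sub>F y in nhdsin X x. norm (w y - w x) < \<epsilon>"
  using assms by (auto simp: Cb_def cont_maps_def continuous_map_euclidean_iff_nhdsin)

definition norm_bounded :: "('x \<Rightarrow> 'y \<Rightarrow> 'z \<Rightarrow>\<^sub>L 'z) \<Rightarrow> bool" where
  "norm_bounded f \<longleftrightarrow> (\<forall>K\<in>Comp Y. \<exists>C. \<forall>x\<in>topspace X. \<forall>s\<in>K. norm (f x s) \<le> C)"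

lemma norm_bounded_iff:
  "norm_bounded f \<longleftrightarrow> (\<forall>K\<in>Comp Y. bdd_above ((\<lambda>(x, s). norm (f x s)) ` (topspace X \<times> K)))"
  unfolding norm_bounded_def bdd_above_def by (intro ball_cong refl ex_cong) auto

text \<open>Values are required in \<open>V\<close> rather than in the stalks, and extensionality is
  not imposed, so closure under sums and multiples can be proved first and then used to show that
  the stalks are vector spaces.\<close>

definition tame :: "('x \<Rightarrow> 'y \<Rightarrow> 'z \<Rightarrow>\<^sub>L 'z) \<Rightarrow> 'x \<Rightarrow> bool" where
  "tame f x \<longleftrightarrow> f \<in> topspace X \<rightarrow> V \<and> norm_bounded f \<and>
     (\<forall>K\<in>Comp Y. \<forall>z. \<forall>\<epsilon>>0. \<forall>\<^sub>F y in nhdsin X x. pn K z (fdiff Y (f y) (f x)) < \<epsilon>)"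

lemma tame_eventually:
  "\<lbrakk>tame f x; K \<in> Comp Y; 0 < \<epsilon>\<rbrakk> \<Longrightarrow> \<forall>\<^sub>F y in nhdsin X x. pn K z (fdiff Y (f y) (f x)) < \<epsilon>"
  unfolding tame_def by blast

lemma tame_cong:
  assumes "x \<in> topspace X" "\<And>y. y \<in> topspace X \<Longrightarrow> f y = g y" "tame f x"
  shows "tame g x"
proof -
  have "\<forall>\<^sub>F y in nhdsin X x. pn K z (fdiff Y (g y) (g x)) < \<epsilon>" if "K \<in> Comp Y" "0 < \<epsilon>" for K z \<epsilon>
  proof -
    have "\<forall>\<^sub>F y in nhdsin X x. pn K z (fdiff Y (f y) (f x)) < \<epsilon>"
      using assms(3) that unfolding tame_def by blast
    with eventually_topspace show ?thesis
      by eventually_elim (simp add: assms)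
  qed
  moreover have "g \<in> topspace X \<rightarrow> V" "norm_bounded g"
    using assms unfolding tame_def norm_bounded_def by (auto simp: Pi_iff)
  ultimately show ?thesis
    unfolding tame_def by blast
qed

lemma tame_zero: "tame (\<lambda>_. mzero) x"
proof -
  have "norm (mzero s) \<le> 0" if "s \<in> K" "K \<in> Comp Y" for s K
    using that Comp_subset[of K] by (auto simp: mzero_def)
  then show ?thesis
    unfolding tame_def norm_bounded_def by (auto simp: V_zero fdiff_self)
qed

lemma tame_add:
  assumes "tame f x" "tame g x" "x \<in> topspace X"
  shows "tame (\<lambda>y. madd (f y) (g y)) x"
  unfolding tame_def
proof (intro conjI ballI allI impI)
  have V: "f y \<in> V" "g y \<in> V" if "y \<in> topspace X" for y
    using assms that unfolding tame_def by auto
  then show "(\<lambda>y. madd (f y) (g y)) \<in> topspace X \<rightarrow> V"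
    using V_add by auto
  show "norm_bounded (\<lambda>y. madd (f y) (g y))"
    unfolding norm_bounded_def
  proof
    fix K assume K: "K \<in> Comp Y"
    obtain C where C: "\<forall>x\<in>topspace X. \<forall>s\<in>K. norm (f x s) \<le> C"
      using assms(1) K unfolding tame_def norm_bounded_def by blast
    obtain C' where C': "\<forall>x\<in>topspace X. \<forall>s\<in>K. norm (g x s) \<le> C'"
      using assms(2) K unfolding tame_def norm_bounded_def by blast
    have "norm (madd (f y) (g y) s) \<le> C + C'" if "y \<in> topspace X" "s \<in> K" for y s
    proof -
      have "madd (f y) (g y) s = f y s + g y s"
        using that Comp_subset[OF K] by (auto simp: madd_def)
      then show ?thesis
        using norm_triangle_mono C C' that by metis
    qed
    then show "\<exists>C. \<forall>x\<in>topspace X. \<forall>s\<in>K. norm (madd (f x) (g x) s) \<le> C"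
      by blast
  qed
  fix K z and \<epsilon> :: real
  assume K: "K \<in> Comp Y" and \<epsilon>: "0 < \<epsilon>"
  have "\<forall>\<^sub>F y in nhdsin X x. pn K z (fdiff Y (f y) (f x)) < \<epsilon>/2"
    "\<forall>\<^sub>F y in nhdsin X x. pn K z (fdiff Y (g y) (g x)) < \<epsilon>/2"
    using tame_eventually[OF _ K half_gt_zero[OF \<epsilon>]] assms by blast+
  with eventually_topspace
  show "\<forall>\<^sub>F y in nhdsin X x. pn K z (fdiff Y (madd (f y) (g y)) (madd (f x) (g x))) < \<epsilon>"
  proof eventually_elim
    case (elim y)
    have "fdiff Y (madd (f y) (g y)) (madd (f x) (g x)) = madd (fdiff Y (f y) (f x)) (fdiff Y (g y) (g x))"
      unfolding madd_def fdiff_def by (rule restrict_ext) simp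
    then show ?case
      using pn_add[of "fdiff Y (f y) (f x)" "fdiff Y (g y) (g x)" K z] elim V[of x] V[of y] K assms(3)
      by (simp add: V_diff)
  qed
qed

lemma fdiff_mscale: "fdiff Y (mscale k g) (mscale k h) = mscale k (fdiff Y g h)"
  unfolding mscale_def fdiff_def
  by (rule restrict_ext, rule blinfun_eqI, subst Blinfun_sc_apply)
    (simp add: blinfun.diff_left sc.scale_right_diff_distrib)

lemma tame_scale:
  assumes "tame f x" "x \<in> topspace X"
  shows "tame (\<lambda>y. mscale k (f y)) x"
  unfolding tame_def
proof (intro conjI ballI allI impI)
  have V: "f y \<in> V" if "y \<in> topspace X" for y
    using assms that unfolding tame_def by auto
  then show "(\<lambda>y. mscale k (f y)) \<in> topspace X \<rightarrow> V"
    using V_scale by auto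
  show "norm_bounded (\<lambda>y. mscale k (f y))"
    unfolding norm_bounded_def
  proof
    fix K assume K: "K \<in> Comp Y"
    obtain C where C: "\<forall>x\<in>topspace X. \<forall>s\<in>K. norm (f x s) \<le> C"
      using assms(1) K unfolding tame_def norm_bounded_def by blast
    have "norm (mscale k (f y) s) \<le> norm k * C" if "y \<in> topspace X" "s \<in> K" for y s
    proof -
      have "mscale k (f y) s = Blinfun (\<lambda>z. sc k (blinfun_apply (f y s) z))"
        using that Comp_subset[OF K] by (auto simp: mscale_def)
      then have "norm (mscale k (f y) s) \<le> norm k * norm (f y s)"
        using norm_Blinfun_sc by simp
      also have "\<dots> \<le> norm k * C"
        using C that by (intro mult_left_mono) auto
      finally show ?thesis .
    qed
    then show "\<exists>C. \<forall>x\<in>topspace X. \<forall>s\<in>K. norm (mscale k (f x) s) \<le> C"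
      by blast
  qed
  fix K z and \<epsilon> :: real
  assume K: "K \<in> Comp Y" and \<epsilon>: "0 < \<epsilon>"
  \<comment> \<open>Dividing by \<open>norm k + 1\<close> instead of \<open>norm k\<close> covers k
    = 0.\<close>
  have pos: "0 < norm k + 1"
    by (rule add_nonneg_pos) auto
  then have "\<forall>\<^sub>F y in nhdsin X x. pn K z (fdiff Y (f y) (f x)) < \<epsilon> / (norm k + 1)"
    using assms K \<epsilon> unfolding tame_def by simp
  with eventually_topspace
  show "\<forall>\<^sub>F y in nhdsin X x. pn K z (fdiff Y (mscale k (f y)) (mscale k (f x))) < \<epsilon>"
  proof eventually_elim
    case (elim y)
    then have VV: "fdiff Y (f y) (f x) \<in> V"
      using V assms(2) by (simp add: V_diff)
    have "norm k * pn K z (fdiff Y (f y) (f x)) \<le> (norm k + 1) * pn K z (fdiff Y (f y) (f x))"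
      using pn_nonneg[OF VV K] by (intro mult_right_mono) auto
    also have "\<dots> < \<epsilon>"
      using elim pos by (simp add: field_simps)
    finally show ?case
      by (simp add: fdiff_mscale pn_scale VV K)
  qed
qed

lemma tame_diff:
  "tame f x \<Longrightarrow> tame g x \<Longrightarrow> x \<in> topspace X \<Longrightarrow> tame (\<lambda>y. fdiff Y (f y) (g y)) x"
  unfolding fdiff_eq by (intro tame_add tame_scale)

text \<open>The moving operator \<open>f y\<close> acts on the increment \<open>w y - w x\<close>,
  so the norm bound has to hold at the points y near x, uniformly over K.\<close>

lemma tame_eventually_near:
  assumes "tame f x" "x \<in> topspace X" "w \<in> Cb X" "K \<in> Comp Y" "0 < \<epsilon>"
  shows "\<forall>\<^sub>F y in nhdsin X x. \<forall>s\<in>K. norm (blinfun_apply (f y s) (w y) - blinfun_apply (f x s) (w x)) < \<epsilon>"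
proof -
  obtain C' where C': "\<forall>x\<in>topspace X. \<forall>s\<in>K. norm (f x s) \<le> C'"
    using assms(1,4) unfolding tame_def norm_bounded_def by blast
  \<comment> \<open>The maximum with 1 makes C a positive divisor.\<close>
  define C where "C = max 1 C'"
  have C: "0 < C" "\<And>y s. y \<in> topspace X \<Longrightarrow> s \<in> K \<Longrightarrow> norm (f y s) \<le> C"
    using C' unfolding C_def by (auto simp: le_max_iff_disj)
  have V: "f y \<in> V" if "y \<in> topspace X" for y
    using assms(1) that unfolding tame_def by auto
  have "\<forall>\<^sub>F y in nhdsin X x. pn K (w x) (fdiff Y (f y) (f x)) < \<epsilon>/2"
    using assms by (intro tame_eventually) auto
  moreover have "\<forall>\<^sub>F y in nhdsin X x. norm (w y - w x) < \<epsilon> / (2 * C)"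
    using assms C(1) by (intro Cb_eventually_near) auto
  ultimately show ?thesis
    using eventually_topspace
  proof eventually_elim
    case (elim y)
    show ?case
    proof
      fix s assume s: "s \<in> K"
      then have sY: "s \<in> topspace Y"
        using Comp_subset assms(4) by blast
      have "norm (blinfun_apply (f y s) (w y - w x)) \<le> norm (f y s) * norm (w y - w x)"
        by (rule norm_blinfun)
      also have "\<dots> \<le> C * norm (w y - w x)"
        using C(2) elim s by (intro mult_right_mono) auto
      also have "\<dots> < \<epsilon>/2"
        using elim C(1) by (simp add: field_simps)
      finally have 1: "norm (blinfun_apply (f y s) (w y - w x)) < \<epsilon>/2" .
      have "norm (blinfun_apply (fdiff Y (f y) (f x) s) (w x)) \<le> pn K (w x) (fdiff Y (f y) (f x))"
        using V elim assms s by (intro pn_upper V_diff) auto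
      then have 2: "norm (blinfun_apply (f y s - f x s) (w x)) < \<epsilon>/2"
        using elim sY by (simp add: fdiff_def)
      have "blinfun_apply (f y s) (w y) - blinfun_apply (f x s) (w x) =
          blinfun_apply (f y s) (w y - w x) + blinfun_apply (f y s - f x s) (w x)"
        by (simp add: blinfun.diff_left blinfun.diff_right)
      then show "norm (blinfun_apply (f y s) (w y) - blinfun_apply (f x s) (w x)) < \<epsilon>"
        using norm_triangle_lt[of "blinfun_apply (f y s) (w y - w x)" "blinfun_apply (f y s - f x s) (w x)" \<epsilon>] 1 2
        by simp
    qed
  qed
qed

lemma tame_eventually_mu_sup_less:
  assumes "tame f x" "x \<in> topspace X" "Q \<in> idx" "mu_sup Q x (f x) < \<epsilon>"
  shows "\<forall>\<^sub>F y in nhdsin X x. mu_sup Q y (f y) < \<epsilon>"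
proof -
  have V: "f y \<in> V" if "y \<in> topspace X" for y
    using assms(1) that unfolding tame_def by auto
  have "\<forall>\<^sub>F y in nhdsin X x. \<forall>i\<in>Q. pn (fst i) (snd i y) (f y) < \<epsilon>"
  proof (intro eventually_ball_finite ballI)
    fix i assume i: "i \<in> Q"
    obtain K w where Kw: "i = (K, w)" by fastforce
    have K: "K \<in> Comp Y" "w \<in> Cb X"
      using mu_index_pair assms(3) i Kw by auto
    \<comment> \<open>Half of the gap, so that a strict inequality survives the supremum over
      K.\<close>
    define \<eta> where "\<eta> = (\<epsilon> - pn K (w x) (f x)) / 2"
    have lt: "pn K (w x) (f x) < \<epsilon>"
      using assms(3,4) i Kw mu_sup_less_iff by fastforce
    then have "0 < \<eta>" by (simp add: \<eta>_def)
    from tame_eventually_near[OF assms(1,2) K(2,1) this] eventually_topspace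
    show "\<forall>\<^sub>F y in nhdsin X x. pn (fst i) (snd i y) (f y) < \<epsilon>"
    proof eventually_elim
      case (elim y)
      have "pn K (w y) (f y) \<le> pn K (w x) (f x) + \<eta>"
        unfolding pn_def[of K "w y"]
      proof (rule nsup_least)
        show "0 \<le> pn K (w x) (f x) + \<eta>"
          using \<open>0 < \<eta>\<close> pn_nonneg[OF V K(1), of x "w x"] assms(2) by simp
        fix s assume s: "s \<in> K"
        have "norm (blinfun_apply (f y s) (w y)) \<le>
            norm (blinfun_apply (f x s) (w x)) + norm (blinfun_apply (f y s) (w y) - blinfun_apply (f x s) (w x))"
          by (rule norm_triangle_sub)
        also have "\<dots> \<le> pn K (w x) (f x) + \<eta>"
          using pn_upper[OF V K(1) s, of x "w x"] elim(1) s assms(2) by (intro add_mono) auto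
        finally show "norm (blinfun_apply (f y s) (w y)) \<le> pn K (w x) (f x) + \<eta>" .
      qed
      then show ?case
        using lt unfolding Kw \<eta>_def by (simp add: field_simps)
    qed
  qed (simp add: mu_index_finite assms(3))
  then show ?thesis
  proof eventually_elim
    case (elim y)
    have "0 < \<epsilon>"
      using assms(4) mu_sup_nonneg[OF assms(3)] by (rule le_less_trans[rotated])
    with elim show ?case
      unfolding mu_sup_less_iff[OF assms(3)] by auto
  qed
qed

lemma mu_sup_bdd:
  assumes "f \<in> topspace X \<rightarrow> V" "norm_bounded f" "Q \<in> idx"
  shows "bdd_above ((\<lambda>x. mu_sup Q x (f x)) ` topspace X)"
proof -
  have "\<exists>B. \<forall>x\<in>topspace X. pn (fst i) (snd i x) (f x) \<le> B" if i: "i \<in> Q" for i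
  proof -
    obtain K w where Kw: "i = (K, w)" by fastforce
    have K: "K \<in> Comp Y" "w \<in> Cb X"
      using mu_index_pair assms(3) i Kw by auto
    obtain C where C: "\<forall>x\<in>topspace X. \<forall>s\<in>K. norm (f x s) \<le> C"
      using assms(2) K unfolding norm_bounded_def by blast
    obtain B where B: "\<forall>x\<in>topspace X. norm (w x) \<le> B"
      using Cb_bounded[OF K(2)] by blast
    \<comment> \<open>Absolute values keep the bound nonnegative, as \<open>nsup_least\<close>
      demands, even for empty K.\<close>
    have "pn K (w x) (f x) \<le> \<bar>C\<bar> * \<bar>B\<bar>" if "x \<in> topspace X" for x
      unfolding pn_def
    proof (rule nsup_least)
      fix s assume s: "s \<in> K"
      have "norm (f x s) \<le> \<bar>C\<bar>" "norm (w x) \<le> \<bar>B\<bar>"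
        using C B s that by force+
      then have "norm (f x s) * norm (w x) \<le> \<bar>C\<bar> * \<bar>B\<bar>"
        by (intro mult_mono) auto
      then show "norm (blinfun_apply (f x s) (w x)) \<le> \<bar>C\<bar> * \<bar>B\<bar>"
        using norm_blinfun[of "f x s" "w x"] by linarith
    qed simp
    then show ?thesis
      using Kw by auto
  qed
  then obtain b where b: "\<And>i x. i \<in> Q \<Longrightarrow> x \<in> topspace X \<Longrightarrow> pn (fst i) (snd i x) (f x) \<le> b i"
    by metis
  have fin: "bdd_above (b ` Q)"
    using mu_index_finite[OF assms(3)] by simp
  have "mu_sup Q x (f x) \<le> nsup b Q" if "x \<in> topspace X" for x
  proof (rule mu_sup_least)
    fix K w assume "(K, w) \<in> Q"
    then show "pn K (w x) (f x) \<le> nsup b Q"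
      using b[of "(K, w)" x] nsup_upper[OF fin, of "(K, w)"] that by simp
  qed (rule nsup_nonneg[OF fin])
  then show ?thesis
    by (rule bdd_above.I2)
qed

section \<open>The space \<open>MM\<close> and its stalks\<close>

text \<open>Writing the gauges as an image lets a finite set of them be pulled back to a finite set
  of pairs (K, z).\<close>

lemma Cc_eq: "Cc sc Y = gauge_topology V ((\<lambda>(K, z) g h. pn K z (fdiff Y h g)) ` (Comp Y \<times> UNIV))"
proof -
  have eq: "(\<lambda>g h. nsup (\<lambda>s. norm (blinfun_apply (h s) z - blinfun_apply (g s) z)) K) =
      (\<lambda>g h. pn K z (fdiff Y h g))" if "K \<in> Comp Y" for K z
    using that by (simp add: pn_fdiff)
  have "{\<lambda>g h. nsup (\<lambda>s. norm (blinfun_apply (h s) z - blinfun_apply (g s) z)) K | K z. K \<in> Comp Y} =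
      (\<lambda>(K, z) g h. nsup (\<lambda>s. norm (blinfun_apply (h s) z - blinfun_apply (g s) z)) K) ` (Comp Y \<times> UNIV)"
    by (auto simp: image_iff)
  also have "\<dots> = (\<lambda>(K, z) g h. pn K z (fdiff Y h g)) ` (Comp Y \<times> UNIV)"
    by (rule image_cong) (auto intro: eq)
  finally show ?thesis
    unfolding Cc_def by simp
qed

lemma pseudometrics_Cc: "pseudometrics V ((\<lambda>(K, z) g h. pn K z (fdiff Y h g)) ` (Comp Y \<times> UNIV))"
proof -
  have "pn K z (fdiff Y k g) \<le> pn K z (fdiff Y h g) + pn K z (fdiff Y k h)"
    if "K \<in> Comp Y" "g \<in> V" "h \<in> V" "k \<in> V" for K z g h k
    using pn_fdiff_triangle[of k h g K z] that by simp
  then show ?thesis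
    unfolding pseudometrics_def by (auto simp: fdiff_self intro!: pn_fdiff_commute)
qed

lemma topcontinuous_at_Cc:
  "topcontinuous_at X (Cc sc Y) f x \<longleftrightarrow> x \<in> topspace X \<and> f \<in> topspace X \<rightarrow> V \<and>
    (\<forall>K\<in>Comp Y. \<forall>z. \<forall>\<epsilon>>0. \<forall>\<^sub>F y in nhdsin X x. pn K z (fdiff Y (f y) (f x)) < \<epsilon>)"
  unfolding Cc_eq topcontinuous_at_gauge_topology[OF pseudometrics_Cc] by auto

lemma tame_iff:
  "x \<in> topspace X \<Longrightarrow> tame f x \<longleftrightarrow> norm_bounded f \<and> topcontinuous_at X (Cc sc Y) f x"
  unfolding tame_def topcontinuous_at_Cc by blast

abbreviation M :: "('x \<Rightarrow> 'y \<Rightarrow> 'z \<Rightarrow>\<^sub>L 'z) set" where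
  "M \<equiv> MM sc X Y"

abbreviation stk :: "'x \<Rightarrow> ('y \<Rightarrow> 'z \<Rightarrow>\<^sub>L 'z) set" where
  "stk \<equiv> M_stalk sc X Y"

text \<open>The norm bound yields the pointwise bounds through \<open>norm (F x s) * norm z\<close>,
  hence boundedness of the range in \<open>Cc sc Y\<close>; continuity on X is continuity at each
  point.\<close>

lemma M_iff:
  "F \<in> M \<longleftrightarrow> F \<in> extensional (topspace X) \<and> norm_bounded F \<and> (\<forall>x\<in>topspace X. tame F x)"
proof -
  have "bdd_above ((\<lambda>(x, s). norm (blinfun_apply (F x s) z)) ` (topspace X \<times> K))"
    if nb: "norm_bounded F" and K: "K \<in> Comp Y" for K z
  proof -
    obtain C where C: "\<forall>x\<in>topspace X. \<forall>s\<in>K. norm (F x s) \<le> C"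
      using nb K unfolding norm_bounded_def by blast
    have "norm (blinfun_apply (F x s) z) \<le> C * norm z" if "x \<in> topspace X" "s \<in> K" for x s
      using norm_blinfun[of "F x s" z] mult_right_mono[of "norm (F x s)" C "norm z"] C that by force
    then show ?thesis
      by (intro bdd_above.I2[of _ _ "C * norm z"]) auto
  qed
  then show ?thesis
    unfolding MM_def cont_maps_def continuous_map_eq_topcontinuous_at
    by (auto simp: norm_bounded_iff[symmetric] tame_iff)
qed

lemma M_tame: "F \<in> M \<Longrightarrow> x \<in> topspace X \<Longrightarrow> tame F x"
  by (simp add: M_iff)

lemma M_V: "F \<in> M \<Longrightarrow> x \<in> topspace X \<Longrightarrow> F x \<in> V"
  using M_tame[of F x] unfolding tame_def by auto

lemma restrict_M:
  assumes "\<And>x. x \<in> topspace X \<Longrightarrow> tame f x"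
  shows "restrict f (topspace X) \<in> M"
proof -
  have t: "tame (restrict f (topspace X)) x" if "x \<in> topspace X" for x
    by (rule tame_cong[OF that _ assms[OF that]]) simp
  moreover have "norm_bounded (restrict f (topspace X))"
  \<comment> \<open>Tameness at any one point already contains the bound on all of X; over an empty
    base the bound is vacuous.\<close>
  proof (cases "topspace X = {}")
    case False
    then show ?thesis using t unfolding tame_def by blast
  qed (auto simp only: norm_bounded_def)
  ultimately show ?thesis
    by (simp add: M_iff)
qed

lemma M_zero: "(\<lambda>x\<in>topspace X. mzero) \<in> M"
  by (intro restrict_M tame_zero)

lemma M_add: "F \<in> M \<Longrightarrow> G \<in> M \<Longrightarrow> (\<lambda>x\<in>topspace X. madd (F x) (G x)) \<in> M"
  by (intro restrict_M tame_add M_tame)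

lemma M_scale: "F \<in> M \<Longrightarrow> (\<lambda>x\<in>topspace X. mscale k (F x)) \<in> M"
  by (intro restrict_M tame_scale M_tame)

text \<open>At a fixed x, a function w enters a seminorm only through the vector \<open>w x\<close>,
  and constants reach every vector. Hence the closure in \<open>Cc sc Y\<close> is the same as
  approximation in the seminorms of the stalk.\<close>

lemma stk_iff:
  assumes x: "x \<in> topspace X"
  shows "g \<in> stk x \<longleftrightarrow> g \<in> V \<and> (\<forall>Q\<in>idx. \<forall>\<epsilon>>0. \<exists>F\<in>M. mu_sup Q x (fdiff Y g (F x)) < \<epsilon>)"
    (is "?L \<longleftrightarrow> ?R")
proof -
  define D where "D = (\<lambda>(K, z) g h. pn K z (fdiff Y h g)) ` (Comp Y \<times> (UNIV :: 'z set))"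
  have cl: "?L \<longleftrightarrow> g \<in> V \<and> (\<forall>F \<epsilon>. finite F \<and> F \<subseteq> D \<and> 0 < \<epsilon> \<longrightarrow>
      (\<exists>h\<in>{F x | F. F \<in> M} \<inter> V. \<forall>d\<in>F. d g h < \<epsilon>))"
    unfolding M_stalk_def Cc_eq D_def in_closure_of_gauge_topology[OF pseudometrics_Cc] by simp
  show ?thesis
  proof
    assume L: ?L
    have "\<exists>F\<in>M. mu_sup Q x (fdiff Y g (F x)) < \<epsilon>" if Q: "Q \<in> idx" and \<epsilon>: "0 < \<epsilon>" for Q \<epsilon>
    proof -
      define E where "E = (\<lambda>(K, w) g h. pn K (w x) (fdiff Y h g)) ` Q"
      have "finite E" "E \<subseteq> D"
        using mu_index_finite[OF Q] mu_index_pair[OF Q] unfolding E_def D_def by auto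
      then have "\<exists>h\<in>{F x | F. F \<in> M} \<inter> V. \<forall>d\<in>E. d g h < \<epsilon>"
        using L \<epsilon> unfolding cl by simp
      then obtain F where F: "F \<in> M" "\<forall>d\<in>E. d g (F x) < \<epsilon>"
        by auto
      have "pn K (w x) (fdiff Y g (F x)) < \<epsilon>" if Kw: "(K, w) \<in> Q" for K w
      proof -
        have "(\<lambda>g h. pn K (w x) (fdiff Y h g)) \<in> E"
          unfolding E_def using Kw by force
        then have "pn K (w x) (fdiff Y (F x) g) < \<epsilon>"
          using F(2) by fastforce
        then show ?thesis
          using pn_fdiff_commute[of K "w x" g "F x"] mu_index_pair[OF Q Kw] by simp
      qed
      then show ?thesis
        using F(1) \<epsilon> mu_sup_less_iff[OF Q] by auto
    qed
    then show ?R
      using L unfolding cl by simp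
  next
    assume R: ?R
    have "\<exists>h\<in>{F x | F. F \<in> M} \<inter> V. \<forall>d\<in>E. d g h < \<epsilon>"
      if E: "finite E" "E \<subseteq> D" and \<epsilon>: "0 < \<epsilon>" for E and \<epsilon> :: real
    proof -
      obtain P where P: "P \<subseteq> Comp Y \<times> UNIV" "finite P" "E = (\<lambda>(K, z) g h. pn K z (fdiff Y h g)) ` P"
        using finite_subset_image[OF E[unfolded D_def]] by metis
      define Q where "Q = (\<lambda>(K, z). (K, \<lambda>x\<in>topspace X. z)) ` P"
      have Q: "Q \<in> idx"
        using P const_Cb unfolding mu_index_def Q_def by auto
      obtain F where F: "F \<in> M" "mu_sup Q x (fdiff Y g (F x)) < \<epsilon>"
        using R Q \<epsilon> by blast
      have "pn K z (fdiff Y (F x) g) < \<epsilon>" if Kz: "(K, z) \<in> P" for K z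
      proof -
        have "(K, \<lambda>x\<in>topspace X. z) \<in> Q"
          unfolding Q_def using Kz by force
        then have "pn K z (fdiff Y g (F x)) < \<epsilon>"
          using F(2) x unfolding mu_sup_less_iff[OF Q] by fastforce
        then show ?thesis
          using pn_fdiff_commute[of K z g "F x"] P(1) Kz by auto
      qed
      then have "\<forall>d\<in>E. d g (F x) < \<epsilon>"
        unfolding P(3) by auto
      then show ?thesis
        using F(1) M_V[OF F(1) x] by (intro bexI[of _ "F x"]) auto
    qed
    then show ?L
      using R unfolding cl by blast
  qed
qed

section \<open>The topology of the generated bundle\<close>

lemma stk_V: "x \<in> topspace X \<Longrightarrow> g \<in> stk x \<Longrightarrow> g \<in> V"
  by (simp add: stk_iff)

lemma stk_approx:
  assumes "x \<in> topspace X" "g \<in> stk x" "Q \<in> idx" "0 < \<epsilon>"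
  obtains F where "F \<in> M" "mu_sup Q x (fdiff Y g (F x)) < \<epsilon>"
  using assms by (auto simp: stk_iff)

lemma M_stk: "F \<in> M \<Longrightarrow> x \<in> topspace X \<Longrightarrow> F x \<in> stk x"
  unfolding stk_iff using M_V[of F x] by (auto intro!: bexI[of _ F] simp: fdiff_self mu_sup_zero)

lemma stk_zero: "x \<in> topspace X \<Longrightarrow> mzero \<in> stk x"
  using M_stk[OF M_zero, of x] by simp

section \<open>Linear structure of the stalks by approximation\<close>

lemma fdiff_madd_madd: "fdiff Y (madd g h) (madd g' h') = madd (fdiff Y g g') (fdiff Y h h')"
  unfolding madd_def fdiff_def by (rule restrict_ext) simp

lemma mu_sup_madd_fdiff:
  assumes "g \<in> V" "h \<in> V" "g' \<in> V" "h' \<in> V" "Q \<in> idx"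
  shows "mu_sup Q x (fdiff Y (madd g h) (madd g' h')) \<le> mu_sup Q x (fdiff Y g g') + mu_sup Q x (fdiff Y h h')"
  unfolding fdiff_madd_madd using assms by (intro mu_sup_add V_diff)

lemma mu_sup_mscale_fdiff:
  "\<lbrakk>g \<in> V; h \<in> V; Q \<in> idx\<rbrakk> \<Longrightarrow>
    mu_sup Q x (fdiff Y (mscale k g) (mscale k h)) = norm k * mu_sup Q x (fdiff Y g h)"
  by (simp add: fdiff_mscale mu_sup_scale V_diff)

lemma stk_add:
  assumes "x \<in> topspace X" "g \<in> stk x" "h \<in> stk x"
  shows "madd g h \<in> stk x"
  unfolding stk_iff[OF assms(1)]
proof (intro conjI ballI allI impI)
  show "madd g h \<in> V"
    using assms by (intro V_add stk_V)
  fix Q and \<epsilon> :: real assume Q: "Q \<in> idx" and "0 < \<epsilon>"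
  then have \<epsilon>: "0 < \<epsilon> / 2" by simp
  obtain F where F: "F \<in> M" "mu_sup Q x (fdiff Y g (F x)) < \<epsilon> / 2"
    using stk_approx[OF assms(1,2) Q \<epsilon>] .
  obtain G where G: "G \<in> M" "mu_sup Q x (fdiff Y h (G x)) < \<epsilon> / 2"
    using stk_approx[OF assms(1,3) Q \<epsilon>] .
  have "mu_sup Q x (fdiff Y (madd g h) (madd (F x) (G x))) < \<epsilon>"
    using mu_sup_madd_fdiff[of g h "F x" "G x" Q x] F G Q assms M_V stk_V by fastforce
  then show "\<exists>F\<in>M. mu_sup Q x (fdiff Y (madd g h) (F x)) < \<epsilon>"
    using M_add[OF F(1) G(1)] assms(1) by (intro bexI[OF _ M_add[OF F(1) G(1)]]) simp
qed

lemma stk_scale: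
  assumes "x \<in> topspace X" "g \<in> stk x"
  shows "mscale k g \<in> stk x"
  unfolding stk_iff[OF assms(1)]
proof (intro conjI ballI allI impI)
  show "mscale k g \<in> V"
    using assms by (intro V_scale stk_V)
  fix Q and \<epsilon> :: real assume Q: "Q \<in> idx" and "0 < \<epsilon>"
  have pos: "0 < norm k + 1"
    by (rule add_nonneg_pos) auto
  then have \<epsilon>: "0 < \<epsilon> / (norm k + 1)"
    using \<open>0 < \<epsilon>\<close> by simp
  obtain F where F: "F \<in> M" "mu_sup Q x (fdiff Y g (F x)) < \<epsilon> / (norm k + 1)"
    using stk_approx[OF assms(1,2) Q \<epsilon>] .
  have "norm k * mu_sup Q x (fdiff Y g (F x)) \<le> (norm k + 1) * mu_sup Q x (fdiff Y g (F x))"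
    using mu_sup_nonneg[OF Q] by (intro mult_right_mono) auto
  also have "\<dots> < \<epsilon>"
    using F(2) pos by (simp add: field_simps)
  finally have "mu_sup Q x (fdiff Y (mscale k g) (mscale k (F x))) < \<epsilon>"
    using mu_sup_mscale_fdiff[of g "F x" Q x k] Q assms F(1) M_V stk_V by simp
  then show "\<exists>F\<in>M. mu_sup Q x (fdiff Y (mscale k g) (F x)) < \<epsilon>"
    using assms(1) by (intro bexI[OF _ M_scale[OF F(1)]]) simp
qed

text \<open>Continuity at x into the bundle, in terms of seminorms
  (\<open>topcontinuous_at_section_iff\<close>). No norm bound is included, and values in
  \<open>V\<close> are asked only near x, so that it applies to every continuous section over an
  open set. A positive \<epsilon> is implicit, since the seminorms are nonnegative.\<close>

definition section_cont :: "('x \<Rightarrow> 'y \<Rightarrow> 'z \<Rightarrow>\<^sub>L 'z) \<Rightarrow> 'x \<Rightarrow> bool" where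
  "section_cont \<sigma> x \<longleftrightarrow> (\<forall>\<^sub>F y in nhdsin X x. \<sigma> y \<in> V) \<and>
     (\<forall>Q\<in>idx. \<forall>F\<in>M. \<forall>\<epsilon>. mu_sup Q x (fdiff Y (\<sigma> x) (F x)) < \<epsilon> \<longrightarrow>
        (\<forall>\<^sub>F y in nhdsin X x. mu_sup Q y (fdiff Y (\<sigma> y) (F y)) < \<epsilon>))"

lemma tame_section_cont:
  assumes "tame \<sigma> x" "x \<in> topspace X"
  shows "section_cont \<sigma> x"
  unfolding section_cont_def
proof (intro conjI ballI allI impI)
  show "\<forall>\<^sub>F y in nhdsin X x. \<sigma> y \<in> V"
    using eventually_topspace by eventually_elim (use assms(1) in \<open>auto simp: tame_def\<close>)
  fix Q F and \<epsilon> :: real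
  assume "Q \<in> idx" "F \<in> M" "mu_sup Q x (fdiff Y (\<sigma> x) (F x)) < \<epsilon>"
  then show "\<forall>\<^sub>F y in nhdsin X x. mu_sup Q y (fdiff Y (\<sigma> y) (F y)) < \<epsilon>"
    using tame_eventually_mu_sup_less[OF tame_diff[OF assms(1) M_tame assms(2)] assms(2)] assms(2)
    by blast
qed

lemma M_section_cont: "F \<in> M \<Longrightarrow> x \<in> topspace X \<Longrightarrow> section_cont F x"
  by (intro tame_section_cont M_tame)

text \<open>The change of centre: \<sigma> is replaced by any F of \<open>M\<close> that is
  \<delta>-close to g at x. As \<delta> is fixed before F, the new centre may be chosen for a larger
  index set, or as a sum or multiple of other members of \<open>M\<close>. Allowing \<sigma> to be
  merely \<open>section_cont\<close> covers tubes around arbitrary bundle sections.\<close>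

lemma tube_refine:
  assumes x: "x \<in> topspace X" "g \<in> V" and \<sigma>: "section_cont \<sigma> x" and Q: "Q \<in> idx"
    and less: "mu_sup Q x (fdiff Y g (\<sigma> x)) < \<epsilon>"
  obtains \<delta> where "0 < \<delta>"
    "\<And>F. F \<in> M \<Longrightarrow> mu_sup Q x (fdiff Y g (F x)) < \<delta> \<Longrightarrow>
      \<forall>\<^sub>F y in nhdsin X x. \<forall>h\<in>V. mu_sup Q y (fdiff Y h (F y)) < \<delta> \<longrightarrow> mu_sup Q y (fdiff Y h (\<sigma> y)) < \<epsilon>"
proof
  \<comment> \<open>Half of the gap, spent twice: once at x in passing from g to F, leaving \<sigma>
    - F below \<epsilon> - \<delta>, and once near x on the distance from h to F.\<close>
  define \<delta> where "\<delta> = (\<epsilon> - mu_sup Q x (fdiff Y g (\<sigma> x))) / 2"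
  show "0 < \<delta>"
    using less by (simp add: \<delta>_def)
  fix F assume F: "F \<in> M" "mu_sup Q x (fdiff Y g (F x)) < \<delta>"
  have \<sigma>V: "\<forall>\<^sub>F y in nhdsin X x. \<sigma> y \<in> V"
    using \<sigma> by (simp add: section_cont_def)
  then have "\<sigma> x \<in> V"
    using eventually_nhdsin_at x(1) by fast
  then have "mu_sup Q x (fdiff Y (\<sigma> x) (F x)) \<le> mu_sup Q x (fdiff Y (\<sigma> x) g) + mu_sup Q x (fdiff Y g (F x))"
    using x M_V F Q by (intro mu_sup_fdiff_triangle) auto
  also have "\<dots> < \<epsilon> - \<delta>"
    using F(2) mu_sup_fdiff_commute[OF Q, of x "\<sigma> x" g] unfolding \<delta>_def by (simp add: field_simps)
  finally have "\<forall>\<^sub>F y in nhdsin X x. mu_sup Q y (fdiff Y (\<sigma> y) (F y)) < \<epsilon> - \<delta>"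
    using \<sigma> Q F(1) unfolding section_cont_def by blast
  with \<sigma>V eventually_topspace
  show "\<forall>\<^sub>F y in nhdsin X x. \<forall>h\<in>V. mu_sup Q y (fdiff Y h (F y)) < \<delta> \<longrightarrow> mu_sup Q y (fdiff Y h (\<sigma> y)) < \<epsilon>"
  proof eventually_elim
    case (elim y)
    show ?case
    proof (intro ballI impI)
      fix h assume h: "h \<in> V" "mu_sup Q y (fdiff Y h (F y)) < \<delta>"
      have "mu_sup Q y (fdiff Y h (\<sigma> y)) \<le> mu_sup Q y (fdiff Y h (F y)) + mu_sup Q y (fdiff Y (F y) (\<sigma> y))"
        using h elim M_V F Q by (intro mu_sup_fdiff_triangle) auto
      then show "mu_sup Q y (fdiff Y h (\<sigma> y)) < \<epsilon>"
        using h(2) elim mu_sup_fdiff_commute[OF Q, of y "F y" "\<sigma> y"] by linarith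
    qed
  qed
qed

section \<open>Tubes as a neighbourhood base\<close>

abbreviation Tot :: "('x \<times> ('y \<Rightarrow> 'z \<Rightarrow>\<^sub>L 'z)) set" where
  "Tot \<equiv> (SIGMA x:topspace X. stk x)"

abbreviation tube :: "'x set \<Rightarrow> ('x \<Rightarrow> 'y \<Rightarrow> 'z \<Rightarrow>\<^sub>L 'z) \<Rightarrow> ('y set \<times> ('x \<Rightarrow> 'z)) set \<Rightarrow> real \<Rightarrow>
    ('x \<times> ('y \<Rightarrow> 'z \<Rightarrow>\<^sub>L 'z)) set" where
  "tube \<equiv> M_tube sc X Y"

lemma mem_tube: "(y, h) \<in> tube U \<sigma> Q \<epsilon> \<longleftrightarrow> y \<in> U \<and> h \<in> stk y \<and> mu_sup Q y (fdiff Y h (\<sigma> y)) < \<epsilon>"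
  by (simp add: M_tube_def)

definition M_nbhd :: "('x \<times> ('y \<Rightarrow> 'z \<Rightarrow>\<^sub>L 'z)) set \<Rightarrow> 'x \<Rightarrow> ('y \<Rightarrow> 'z \<Rightarrow>\<^sub>L 'z) \<Rightarrow> bool" where
  "M_nbhd W x g \<longleftrightarrow> (\<exists>U \<sigma> Q \<epsilon>. openin X U \<and> \<sigma> \<in> M \<and> Q \<in> idx \<and> 0 < \<epsilon> \<and>
     (x, g) \<in> tube U \<sigma> Q \<epsilon> \<and> tube U \<sigma> Q \<epsilon> \<subseteq> W)"

text \<open>The two given centres are unrelated away from x. One F that approximates g for the union
  of both index sets, within the smaller tolerance, serves as a common new centre.\<close>

lemma M_nbhd_Int:
  assumes x: "x \<in> topspace X" "g \<in> stk x" and N: "M_nbhd S x g" "M_nbhd T x g"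
  shows "M_nbhd (S \<inter> T) x g"
proof -
  obtain U \<sigma> Q \<epsilon> where 1: "openin X U" "\<sigma> \<in> M" "Q \<in> idx" "(x, g) \<in> tube U \<sigma> Q \<epsilon>" "tube U \<sigma> Q \<epsilon> \<subseteq> S"
    using N(1) unfolding M_nbhd_def by blast
  obtain U' \<sigma>' Q' \<epsilon>' where 2: "openin X U'" "\<sigma>' \<in> M" "Q' \<in> idx" "(x, g) \<in> tube U' \<sigma>' Q' \<epsilon>'" "tube U' \<sigma>' Q' \<epsilon>' \<subseteq> T"
    using N(2) unfolding M_nbhd_def by blast
  have gV: "g \<in> V"
    using x stk_V by blast
  obtain \<delta> where \<delta>: "0 < \<delta>" "\<And>F. F \<in> M \<Longrightarrow> mu_sup Q x (fdiff Y g (F x)) < \<delta> \<Longrightarrow>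
      \<forall>\<^sub>F y in nhdsin X x. \<forall>h\<in>V. mu_sup Q y (fdiff Y h (F y)) < \<delta> \<longrightarrow> mu_sup Q y (fdiff Y h (\<sigma> y)) < \<epsilon>"
    by (rule tube_refine[OF x(1) gV M_section_cont[OF 1(2) x(1)] 1(3)]) (use 1(4) in \<open>auto simp: mem_tube\<close>)
  obtain \<delta>' where \<delta>': "0 < \<delta>'" "\<And>F. F \<in> M \<Longrightarrow> mu_sup Q' x (fdiff Y g (F x)) < \<delta>' \<Longrightarrow>
      \<forall>\<^sub>F y in nhdsin X x. \<forall>h\<in>V. mu_sup Q' y (fdiff Y h (F y)) < \<delta>' \<longrightarrow> mu_sup Q' y (fdiff Y h (\<sigma>' y)) < \<epsilon>'"
    by (rule tube_refine[OF x(1) gV M_section_cont[OF 2(2) x(1)] 2(3)]) (use 2(4) in \<open>auto simp: mem_tube\<close>)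
  define R where "R = Q \<union> Q'"
  have R: "R \<in> idx" "\<And>y g. mu_sup Q y g \<le> mu_sup R y g" "\<And>y g. mu_sup Q' y g \<le> mu_sup R y g"
    unfolding R_def using mu_index_Un[OF 1(3) 2(3)] by (auto intro: mu_sup_mono)
  have "0 < min \<delta> \<delta>'" using \<delta>(1) \<delta>'(1) by simp
  then obtain F where F: "F \<in> M" "mu_sup R x (fdiff Y g (F x)) < min \<delta> \<delta>'"
    by (rule stk_approx[OF x R(1)])
  have "mu_sup Q x (fdiff Y g (F x)) < \<delta>" "mu_sup Q' x (fdiff Y g (F x)) < \<delta>'"
    using F(2) R(2,3)[of x "fdiff Y g (F x)"] by simp_all
  note \<delta>(2)[OF F(1) this(1)] \<delta>'(2)[OF F(1) this(2)]
  then have "\<forall>\<^sub>F y in nhdsin X x.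
      (\<forall>h\<in>V. mu_sup Q y (fdiff Y h (F y)) < \<delta> \<longrightarrow> mu_sup Q y (fdiff Y h (\<sigma> y)) < \<epsilon>) \<and>
      (\<forall>h\<in>V. mu_sup Q' y (fdiff Y h (F y)) < \<delta>' \<longrightarrow> mu_sup Q' y (fdiff Y h (\<sigma>' y)) < \<epsilon>')"
    by (rule eventually_conj)
  then obtain U0 where U0: "openin X U0" "x \<in> U0"
    "\<And>y h. y \<in> U0 \<Longrightarrow> h \<in> V \<Longrightarrow> mu_sup Q y (fdiff Y h (F y)) < \<delta> \<Longrightarrow> mu_sup Q y (fdiff Y h (\<sigma> y)) < \<epsilon>"
    "\<And>y h. y \<in> U0 \<Longrightarrow> h \<in> V \<Longrightarrow> mu_sup Q' y (fdiff Y h (F y)) < \<delta>' \<Longrightarrow> mu_sup Q' y (fdiff Y h (\<sigma>' y)) < \<epsilon>'"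
    unfolding eventually_nhdsin using x(1) by blast
  define W where "W = U \<inter> U' \<inter> U0"
  have W: "openin X W"
    unfolding W_def using 1(1) 2(1) U0(1) by auto
  have "tube W F R (min \<delta> \<delta>') \<subseteq> S \<inter> T"
  proof
    fix p assume "p \<in> tube W F R (min \<delta> \<delta>')"
    then obtain y h where p: "p = (y, h)" "y \<in> W" "h \<in> stk y" "mu_sup R y (fdiff Y h (F y)) < min \<delta> \<delta>'"
      by (cases p) (auto simp: mem_tube)
    have hV: "h \<in> V"
      using p openin_subset[OF W] stk_V by blast
    have "mu_sup Q y (fdiff Y h (F y)) < \<delta>" "mu_sup Q' y (fdiff Y h (F y)) < \<delta>'"
      using p(4) R(2,3)[of y "fdiff Y h (F y)"] by simp_all
    then have "(y, h) \<in> tube U \<sigma> Q \<epsilon>" "(y, h) \<in> tube U' \<sigma>' Q' \<epsilon>'"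
      using U0(3,4)[OF _ hV] p unfolding mem_tube W_def by auto
    then show "p \<in> S \<inter> T"
      using p(1) 1(5) 2(5) by blast
  qed
  moreover have "(x, g) \<in> tube W F R (min \<delta> \<delta>')"
    using 1(4) 2(4) U0(2) F(2) unfolding mem_tube W_def by auto
  ultimately show ?thesis
    unfolding M_nbhd_def using W F(1) R(1) \<open>0 < min \<delta> \<delta>'\<close> by blast
qed

lemma openin_M_top: "openin (M_top sc X Y) W \<longleftrightarrow> W \<subseteq> Tot \<and> (\<forall>(x, g)\<in>W. M_nbhd W x g)"
proof -
  have mono: "M_nbhd T x g" if "M_nbhd S x g" "S \<subseteq> T" for S T x g
    using that unfolding M_nbhd_def by (meson order_trans)
  have "istopology (\<lambda>W. W \<subseteq> Tot \<and> (\<forall>(x, g)\<in>W. M_nbhd W x g))"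
    unfolding istopology_def
  proof (intro conjI allI impI)
    fix S T assume S: "S \<subseteq> Tot \<and> (\<forall>(x, g)\<in>S. M_nbhd S x g)" and T: "T \<subseteq> Tot \<and> (\<forall>(x, g)\<in>T. M_nbhd T x g)"
    then show "S \<inter> T \<subseteq> Tot" by blast
    show "\<forall>(x, g)\<in>S \<inter> T. M_nbhd (S \<inter> T) x g"
    proof safe
      fix x g assume "(x, g) \<in> S" "(x, g) \<in> T"
      then show "M_nbhd (S \<inter> T) x g"
        using S T by (intro M_nbhd_Int) auto
    qed
  next
    fix \<K> assume *: "\<forall>K\<in>\<K>. K \<subseteq> Tot \<and> (\<forall>(x, g)\<in>K. M_nbhd K x g)"
    then show "\<Union>\<K> \<subseteq> Tot" by blast
    show "\<forall>(x, g)\<in>\<Union>\<K>. M_nbhd (\<Union>\<K>) x g"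
    proof safe
      fix x g K assume "K \<in> \<K>" "(x, g) \<in> K"
      then show "M_nbhd (\<Union>\<K>) x g"
        using * mono[of K x g "\<Union>\<K>"] by blast
    qed
  qed
  \<comment> \<open>Inside a subset of \<open>Tot\<close>, membership of g in its stalk is
    automatic, so the neighbourhood clause of \<open>M_top\<close> agrees with
    \<open>M_nbhd\<close>.\<close>
  moreover have "(\<lambda>W. W \<subseteq> Tot \<and> (\<forall>(x, g)\<in>W. \<exists>U \<sigma> Q \<epsilon>. openin X U \<and> x \<in> U \<and> \<sigma> \<in> M \<and> Q \<in> idx \<and> 0 < \<epsilon> \<and>
        mu_sup Q x (fdiff Y g (\<sigma> x)) < \<epsilon> \<and> M_tube sc X Y U \<sigma> Q \<epsilon> \<subseteq> W)) =
      (\<lambda>W. W \<subseteq> Tot \<and> (\<forall>(x, g)\<in>W. M_nbhd W x g))"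
  proof (rule ext, rule conj_cong[OF refl], rule ball_cong[OF refl], unfold split_paired_all prod.case)
    fix W x g assume "W \<subseteq> Tot" "(x, g) \<in> W"
    then have "g \<in> stk x" by auto
    then show "(\<exists>U \<sigma> Q \<epsilon>. openin X U \<and> x \<in> U \<and> \<sigma> \<in> M \<and> Q \<in> idx \<and> 0 < \<epsilon> \<and>
        mu_sup Q x (fdiff Y g (\<sigma> x)) < \<epsilon> \<and> M_tube sc X Y U \<sigma> Q \<epsilon> \<subseteq> W) = M_nbhd W x g"
      unfolding M_nbhd_def mem_tube by (intro ex_cong1) auto
  qed
  ultimately show ?thesis
    unfolding M_top_def by (simp add: topology_inverse')
qed

lemma M_top_tubeE:
  assumes "openin (M_top sc X Y) W" "p \<in> W"
  obtains U \<sigma> Q \<epsilon> where "openin X U" "\<sigma> \<in> M" "Q \<in> idx" "0 < \<epsilon>" "p \<in> tube U \<sigma> Q \<epsilon>" "tube U \<sigma> Q \<epsilon> \<subseteq> W"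
proof -
  obtain x g where p: "p = (x, g)" by fastforce
  then have "M_nbhd W x g"
    using assms unfolding openin_M_top by blast
  then show ?thesis
    unfolding M_nbhd_def p[symmetric] using that by blast
qed

lemma openin_tube:
  assumes "openin X U" "\<sigma> \<in> M" "Q \<in> idx" "0 < \<epsilon>"
  shows "openin (M_top sc X Y) (tube U \<sigma> Q \<epsilon>)"
  unfolding openin_M_top
proof (intro conjI)
  show "tube U \<sigma> Q \<epsilon> \<subseteq> Tot"
    using openin_subset[OF assms(1)] unfolding M_tube_def by auto
  show "\<forall>(x, g)\<in>tube U \<sigma> Q \<epsilon>. M_nbhd (tube U \<sigma> Q \<epsilon>) x g"
    unfolding M_nbhd_def using assms by blast
qed

lemma topspace_M_top [simp]: "topspace (M_top sc X Y) = Tot"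
proof (rule subset_antisym)
  show "topspace (M_top sc X Y) \<subseteq> Tot"
    using openin_topspace[of "M_top sc X Y"] unfolding openin_M_top by blast
  \<comment> \<open>An empty index set imposes no seminorm: \<open>mu_sup {}\<close> is 0, so this
    tube is everything above its base set. The same tube over an open U shows that the projection is
    continuous.\<close>
  have "tube (topspace X) (\<lambda>x\<in>topspace X. mzero) {} 1 = Tot"
    by (auto simp: M_tube_def mu_sup_def)
  then show "Tot \<subseteq> topspace (M_top sc X Y)"
    using openin_tube[OF openin_topspace M_zero mu_index_empty, of 1] openin_subset by force
qed

lemma topcontinuous_at_M_top:
  "topcontinuous_at T (M_top sc X Y) \<phi> t \<longleftrightarrow> t \<in> topspace T \<and> \<phi> \<in> topspace T \<rightarrow> Tot \<and>
    (\<forall>U \<sigma> Q \<epsilon>. openin X U \<and> \<sigma> \<in> M \<and> Q \<in> idx \<and> \<phi> t \<in> tube U \<sigma> Q \<epsilon> \<longrightarrow>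
       (\<forall>\<^sub>F t' in nhdsin T t. \<phi> t' \<in> tube U \<sigma> Q \<epsilon>))"
    (is "?L \<longleftrightarrow> ?R")
proof
  assume L: ?L
  have "\<forall>\<^sub>F t' in nhdsin T t. \<phi> t' \<in> tube U \<sigma> Q \<epsilon>"
    if "openin X U" "\<sigma> \<in> M" "Q \<in> idx" "\<phi> t \<in> tube U \<sigma> Q \<epsilon>" for U \<sigma> Q \<epsilon>
  proof -
    \<comment> \<open>Positivity of \<epsilon> comes for free from a tube containing
      \<open>\<phi> t\<close>, since seminorms are nonnegative.\<close>
    have "0 < \<epsilon>"
      using that(4) mu_sup_nonneg[OF that(3)] by (cases "\<phi> t") (auto simp: mem_tube intro: le_less_trans)
    then show ?thesis
      using L openin_tube[OF that(1-3)] that(4) unfolding topcontinuous_at_def eventually_nhdsin by blast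
  qed
  then show ?R
    using L unfolding topcontinuous_at_def by simp
next
  assume R: ?R
  have "\<exists>U. openin T U \<and> t \<in> U \<and> (\<forall>t'\<in>U. \<phi> t' \<in> W)" if W: "openin (M_top sc X Y) W" "\<phi> t \<in> W" for W
  proof -
    obtain U \<sigma> Q \<epsilon> where U: "openin X U" "\<sigma> \<in> M" "Q \<in> idx" "\<phi> t \<in> tube U \<sigma> Q \<epsilon>" "tube U \<sigma> Q \<epsilon> \<subseteq> W"
      by (rule M_top_tubeE[OF W])
    have "\<forall>\<^sub>F t' in nhdsin T t. \<phi> t' \<in> tube U \<sigma> Q \<epsilon>"
      using R U(1-4) by simp
    then have "\<forall>\<^sub>F t' in nhdsin T t. \<phi> t' \<in> W"
      by eventually_elim (use U(5) in blast)
    moreover have "t \<in> topspace T"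
      using R by simp
    ultimately show ?thesis
      unfolding eventually_nhdsin by simp
  qed
  moreover have "t \<in> topspace T" "\<phi> \<in> topspace T \<rightarrow> Tot"
    using R by simp_all
  ultimately show ?L
    unfolding topcontinuous_at_def by simp
qed

lemma topcontinuous_at_section_iff:
  assumes U: "openin X U" "x \<in> U" and f: "\<And>y. y \<in> U \<Longrightarrow> f y \<in> stk y" "\<And>y. y \<in> U \<Longrightarrow> \<phi> y = (y, f y)"
  shows "topcontinuous_at (subtopology X U) (M_top sc X Y) \<phi> x \<longleftrightarrow> section_cont f x"
    (is "?L \<longleftrightarrow> ?R")
proof -
  have sub: "U \<subseteq> topspace X"
    using openin_subset[OF U(1)] .
  \<comment> \<open>U is open, so the neighbourhood filters of x in U and in X agree; this lets one
    pointwise notion serve local and global sections.\<close>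
  have ev: "eventually P (nhdsin (subtopology X U) x) \<longleftrightarrow> eventually P (nhdsin X x)" for P
    using U sub unfolding eventually_nhdsin openin_open_subtopology[OF U(1)]
    by simp (meson Int_lower1 Int_iff openin_Int inf_le2 subsetD)
  have evU: "\<forall>\<^sub>F y in nhdsin X x. y \<in> U"
    using U unfolding eventually_nhdsin by blast
  show ?thesis
  proof
    assume L: ?L
    show ?R
      unfolding section_cont_def
    proof (intro conjI ballI allI impI)
      show "\<forall>\<^sub>F y in nhdsin X x. f y \<in> V"
        using evU by eventually_elim (use f sub stk_V in blast)
      fix Q F and \<epsilon> :: real
      assume a: "Q \<in> idx" "F \<in> M" "mu_sup Q x (fdiff Y (f x) (F x)) < \<epsilon>"
      then have "\<phi> x \<in> tube U F Q \<epsilon>"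
        using f U(2) by (simp add: mem_tube)
      then have "\<forall>\<^sub>F y in nhdsin X x. \<phi> y \<in> tube U F Q \<epsilon>"
        using L U(1) a unfolding topcontinuous_at_M_top ev by blast
      with evU show "\<forall>\<^sub>F y in nhdsin X x. mu_sup Q y (fdiff Y (f y) (F y)) < \<epsilon>"
        by eventually_elim (simp add: f mem_tube)
    qed
  next
    assume R: ?R
    show ?L
      unfolding topcontinuous_at_M_top ev
    proof (intro conjI allI impI)
      show "x \<in> topspace (subtopology X U)" "\<phi> \<in> topspace (subtopology X U) \<rightarrow> Tot"
        using U f sub by auto
      fix U' F Q \<epsilon>
      assume a: "openin X U' \<and> F \<in> M \<and> Q \<in> idx \<and> \<phi> x \<in> tube U' F Q \<epsilon>"
      then have "x \<in> U'" "mu_sup Q x (fdiff Y (f x) (F x)) < \<epsilon>"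
        using f U(2) by (auto simp: mem_tube)
      then have "\<forall>\<^sub>F y in nhdsin X x. mu_sup Q y (fdiff Y (f y) (F y)) < \<epsilon>" "\<forall>\<^sub>F y in nhdsin X x. y \<in> U'"
        using R a unfolding section_cont_def eventually_nhdsin[of _ X x] by blast+
      with evU show "\<forall>\<^sub>F y in nhdsin X x. \<phi> y \<in> tube U' F Q \<epsilon>"
        by eventually_elim (simp add: f mem_tube)
    qed
  qed
qed

section \<open>The generated bundle is a bundle of Omega-spaces\<close>

abbreviation GB :: "('k, 'x \<times> ('y \<Rightarrow> 'z \<Rightarrow>\<^sub>L 'z), 'x) omega_bundle" where
  "GB \<equiv> generated_bundle sc X Y"

lemma GB_simps [simp]:
  "tot GB = M_top sc X Y" "proj GB = fst" "base GB = X" "szero GB x = (x, mzero)"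
  "sadd GB (x, g) (x', h) = (x, madd g h)" "smult GB k (x, g) = (x, mscale k g)"
  "sdiff GB (x, g) (x', h) = (x, fdiff Y g h)"
  by (simp_all add: generated_bundle_def sdiff_def mzero_def madd_def mscale_def fdiff_eq)

lemma semi_GB: "semi GB = (\<lambda>Q (x, g). mu_sup Q x g) ` idx"
  by (auto simp: generated_bundle_def)

lemma stalk_GB: "x \<in> topspace X \<Longrightarrow> stalk GB x = {x} \<times> stk x"
  by (auto simp: stalk_def)

section \<open>Vector space laws and seminorms on the stalks\<close>

lemma madd_assoc: "madd (madd g h) k = madd g (madd h k)"
  unfolding madd_def by (rule restrict_ext) simp

lemma madd_left_commute: "madd g (madd h k) = madd h (madd g k)"
  unfolding madd_def by (rule restrict_ext) simp

lemma madd_zero: "g \<in> V \<Longrightarrow> madd g mzero = g"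
  by (rule extensionalityI[of _ "topspace Y"]) (auto simp: madd_def mzero_def V_extensional)

lemma mscale_madd: "mscale k (madd g h) = madd (mscale k g) (mscale k h)"
  unfolding madd_def mscale_def
  by (rule restrict_ext, rule blinfun_eqI, subst Blinfun_sc_apply)
    (simp add: blinfun.add_left sc.scale_right_distrib)

lemma mscale_add: "mscale (k + l) g = madd (mscale k g) (mscale l g)"
  unfolding madd_def mscale_def
  by (rule restrict_ext, rule blinfun_eqI, subst Blinfun_sc_apply)
    (simp add: blinfun.add_left sc.scale_left_distrib)

lemma mscale_mult: "mscale (k * l) g = mscale k (mscale l g)"
  unfolding mscale_def
  by (rule restrict_ext, rule blinfun_eqI, subst Blinfun_sc_apply) simp

lemma mscale_one: "g \<in> V \<Longrightarrow> mscale 1 g = g"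
  by (rule extensionalityI[of _ "topspace Y"]) (auto simp: mscale_def V_extensional blinfun_apply_inverse)

lemma fdiff_mscale_left: "fdiff Y (mscale k g) (mscale l g) = mscale (k - l) g"
  unfolding mscale_def fdiff_def
  by (rule restrict_ext, rule blinfun_eqI, subst Blinfun_sc_apply)
    (simp add: blinfun.diff_left sc.scale_left_diff_distrib)

lemma stalk_vector_space_GB:
  assumes x: "x \<in> topspace X"
  shows "stalk_vector_space GB x"
  unfolding stalk_vector_space_def stalk_GB[OF x]
  using x stk_V[OF x]
  by (auto simp: stk_zero stk_add stk_scale madd_assoc madd_commute madd_left_commute madd_zero fdiff_self
      mscale_madd mscale_add mscale_mult mscale_one)

lemma stalk_seminorm_GB:
  assumes x: "x \<in> topspace X" and "\<nu> \<in> semi GB"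
  shows "stalk_seminorm GB x \<nu>"
proof -
  obtain Q where Q: "Q \<in> idx" "\<nu> = (\<lambda>(x, g). mu_sup Q x g)"
    using assms(2) by (auto simp: semi_GB)
  show ?thesis
    unfolding stalk_seminorm_def stalk_GB[OF x] Q(2)
    using stk_V[OF x] by (auto simp: mu_sup_nonneg mu_sup_add mu_sup_scale Q(1))
qed

lemma directed_GB:
  assumes "\<nu>\<^sub>1 \<in> semi GB" "\<nu>\<^sub>2 \<in> semi GB"
  shows "\<exists>\<nu>\<in>semi GB. \<forall>a\<in>A. \<nu>\<^sub>1 a \<le> \<nu> a \<and> \<nu>\<^sub>2 a \<le> \<nu> a"
proof -
  obtain Q\<^sub>1 where 1: "Q\<^sub>1 \<in> idx" "\<nu>\<^sub>1 = (\<lambda>(x, g). mu_sup Q\<^sub>1 x g)"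
    using assms(1) by (auto simp: semi_GB)
  obtain Q\<^sub>2 where 2: "Q\<^sub>2 \<in> idx" "\<nu>\<^sub>2 = (\<lambda>(x, g). mu_sup Q\<^sub>2 x g)"
    using assms(2) by (auto simp: semi_GB)
  note U = mu_index_Un[OF 1(1) 2(1)]
  show ?thesis
    unfolding semi_GB using U
    by (auto simp: 1(2) 2(2) intro!: bexI[OF _ U] mu_sup_mono[OF _ U])
qed

section \<open>Continuity of the projection and of the linear operations\<close>

lemma continuous_fst_M_top: "continuous_map (M_top sc X Y) X fst"
  unfolding continuous_map_def
proof (intro conjI allI impI)
  show "fst \<in> topspace (M_top sc X Y) \<rightarrow> topspace X"
    by auto
  fix U assume U: "openin X U"
  have "{p \<in> topspace (M_top sc X Y). fst p \<in> U} = tube U (\<lambda>x\<in>topspace X. mzero) {} 1"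
    using openin_subset[OF U] by (auto simp: M_tube_def mu_sup_def)
  then show "openin (M_top sc X Y) {p \<in> topspace (M_top sc X Y). fst p \<in> U}"
    using openin_tube[OF U M_zero mu_index_empty, of 1] by simp
qed

lemma open_fst_M_top: "open_map (M_top sc X Y) X fst"
  unfolding open_map_def
proof (intro allI impI)
  fix W assume W: "openin (M_top sc X Y) W"
  have "\<exists>U. openin X U \<and> x \<in> U \<and> U \<subseteq> fst ` W" if x: "x \<in> fst ` W" for x
  proof -
    obtain p where p: "p \<in> W" "x = fst p"
      using x by blast
    obtain U \<sigma> Q \<epsilon> where U: "openin X U" "\<sigma> \<in> M" "Q \<in> idx" "0 < \<epsilon>" "p \<in> tube U \<sigma> Q \<epsilon>" "tube U \<sigma> Q \<epsilon> \<subseteq> W"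
      by (rule M_top_tubeE[OF W p(1)])
    \<comment> \<open>The centre stays inside its own tube, so the tube projects onto all of
      U.\<close>
    have "(y, \<sigma> y) \<in> tube U \<sigma> Q \<epsilon>" if "y \<in> U" for y
      using that M_stk[OF U(2)] openin_subset[OF U(1)] U(3,4)
      by (auto simp: mem_tube fdiff_self mu_sup_zero)
    then have "y \<in> fst ` W" if "y \<in> U" for y
      using that U(6) by force
    moreover have "x \<in> U"
      using U(5) p(2) by (auto simp: M_tube_def)
    ultimately show ?thesis
      using U(1) by blast
  qed
  then show "openin X (fst ` W)"
    by (subst openin_subopen) blast
qed

text \<open>If F and G approximate g and h, then F + G lies in \<open>M\<close> and approximates g +
  h, so the target tube may be recentred there; the tubes of half the radius around F and G then add
  into it.\<close>

lemma continuous_sadd_GB: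
  "continuous_map (subtopology (prod_topology (M_top sc X Y) (M_top sc X Y)) {(a, b). fst a = fst b})
     (M_top sc X Y) (\<lambda>(a, b). sadd GB a b)"
  unfolding continuous_map_eq_topcontinuous_at
proof
  let ?T = "subtopology (prod_topology (M_top sc X Y) (M_top sc X Y)) {(a, b). fst a = fst b}"
  fix t assume t: "t \<in> topspace ?T"
  then obtain x g h where tx: "t = ((x, g), (x, h))" "x \<in> topspace X" "g \<in> stk x" "h \<in> stk x"
    by auto
  have gV: "g \<in> V" "h \<in> V" "madd g h \<in> V"
    using tx stk_V V_add by auto
  show "topcontinuous_at ?T (M_top sc X Y) (\<lambda>(a, b). sadd GB a b) t"
    unfolding topcontinuous_at_M_top
  proof (intro conjI allI impI)
    show "(\<lambda>(a, b). sadd GB a b) \<in> topspace ?T \<rightarrow> Tot"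
      using stk_add by auto
    fix U \<sigma> Q \<epsilon>
    assume a: "openin X U \<and> \<sigma> \<in> M \<and> Q \<in> idx \<and> (case t of (a, b) \<Rightarrow> sadd GB a b) \<in> tube U \<sigma> Q \<epsilon>"
    then have Q: "Q \<in> idx" and \<sigma>: "section_cont \<sigma> x" and U: "openin X U" "x \<in> U"
      and less: "mu_sup Q x (fdiff Y (madd g h) (\<sigma> x)) < \<epsilon>"
      using tx M_section_cont by (auto simp: mem_tube)
    obtain \<delta> where \<delta>: "0 < \<delta>" "\<And>F. F \<in> M \<Longrightarrow> mu_sup Q x (fdiff Y (madd g h) (F x)) < \<delta> \<Longrightarrow>
      \<forall>\<^sub>F y in nhdsin X x. \<forall>h\<in>V. mu_sup Q y (fdiff Y h (F y)) < \<delta> \<longrightarrow> mu_sup Q y (fdiff Y h (\<sigma> y)) < \<epsilon>"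
      by (rule tube_refine[OF tx(2) gV(3) \<sigma> Q less]) auto
    obtain F where F: "F \<in> M" "mu_sup Q x (fdiff Y g (F x)) < \<delta> / 2"
      by (rule stk_approx[OF tx(2,3) Q half_gt_zero[OF \<delta>(1)]])
    obtain G where G: "G \<in> M" "mu_sup Q x (fdiff Y h (G x)) < \<delta> / 2"
      by (rule stk_approx[OF tx(2,4) Q half_gt_zero[OF \<delta>(1)]])
    define H where "H = (\<lambda>x\<in>topspace X. madd (F x) (G x))"
    have H: "H \<in> M"
      unfolding H_def by (rule M_add[OF F(1) G(1)])
    have near: "mu_sup Q y (fdiff Y (madd g' h') (H y)) < \<delta>"
      if "y \<in> topspace X" "g' \<in> V" "h' \<in> V" "mu_sup Q y (fdiff Y g' (F y)) < \<delta> / 2"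
        "mu_sup Q y (fdiff Y h' (G y)) < \<delta> / 2" for y g' h'
      using mu_sup_madd_fdiff[OF that(2,3) M_V[OF F(1) that(1)] M_V[OF G(1) that(1)] Q, of y] that
      by (simp add: H_def)
    obtain U0 where U0: "openin X U0" "x \<in> U0"
      "\<And>y h. y \<in> U0 \<Longrightarrow> h \<in> V \<Longrightarrow> mu_sup Q y (fdiff Y h (H y)) < \<delta> \<Longrightarrow> mu_sup Q y (fdiff Y h (\<sigma> y)) < \<epsilon>"
      using \<delta>(2)[OF H near[OF tx(2) gV(1,2) F(2) G(2)]] tx(2) unfolding eventually_nhdsin by auto
    define W where "W = U \<inter> U0"
    have W: "openin X W"
      unfolding W_def using U U0 by auto
    define A where "A = tube W F Q (\<delta> / 2)"
    define B where "B = tube W G Q (\<delta> / 2)"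
    have "openin (prod_topology (M_top sc X Y) (M_top sc X Y)) (A \<times> B)"
      unfolding A_def B_def openin_prod_Times_iff using openin_tube[OF W _ Q] F(1) G(1) \<delta>(1) by simp
    then have "openin ?T (A \<times> B \<inter> {(a, b). fst a = fst b})"
      by (auto simp: openin_subtopology)
    moreover have "t \<in> A \<times> B \<inter> {(a, b). fst a = fst b}"
      unfolding tx(1) A_def B_def W_def using U U0 F G tx by (simp add: mem_tube)
    moreover have "(case t' of (a, b) \<Rightarrow> sadd GB a b) \<in> tube U \<sigma> Q \<epsilon>"
      if mem: "t' \<in> A \<times> B \<inter> {(a, b). fst a = fst b}" for t'
    proof -
      obtain y g' h' where t': "t' = ((y, g'), (y, h'))" "y \<in> W" "g' \<in> stk y" "h' \<in> stk y"
        "mu_sup Q y (fdiff Y g' (F y)) < \<delta> / 2" "mu_sup Q y (fdiff Y h' (G y)) < \<delta> / 2"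
        using mem unfolding A_def B_def by (auto simp: M_tube_def)
      have y: "y \<in> topspace X"
        using t'(2) openin_subset[OF W] by blast
      have V': "g' \<in> V" "h' \<in> V"
        using stk_V[OF y] t' by auto
      have "mu_sup Q y (fdiff Y (madd g' h') (\<sigma> y)) < \<epsilon>"
        using U0(3)[of y "madd g' h'"] near[OF y V' t'(5,6)] t'(2) V_add[OF V'] by (simp add: W_def)
      then show ?thesis
        using stk_add[OF y t'(3,4)] t'(1,2) by (simp add: mem_tube W_def)
    qed
    ultimately show "\<forall>\<^sub>F t' in nhdsin ?T t. (case t' of (a, b) \<Rightarrow> sadd GB a b) \<in> tube U \<sigma> Q \<epsilon>"
      unfolding eventually_nhdsin by blast
  qed (rule t)
qed

text \<open>The target tube is recentred at l F, and kh - lF = k(h - F) + (k - l)F is estimated with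
  half of the radius for each term.\<close>

lemma continuous_smult_GB:
  "continuous_map (prod_topology euclidean (M_top sc X Y)) (M_top sc X Y) (\<lambda>(k, a). smult GB k a)"
  unfolding continuous_map_eq_topcontinuous_at
proof
  let ?T = "prod_topology euclidean (M_top sc X Y) :: ('k \<times> 'x \<times> ('y \<Rightarrow> 'z \<Rightarrow>\<^sub>L 'z)) topology"
  fix t assume t: "t \<in> topspace ?T"
  then obtain l x g where tx: "t = (l, (x, g))" "x \<in> topspace X" "g \<in> stk x"
    by auto
  have gV: "g \<in> V" "mscale l g \<in> V"
    using tx stk_V V_scale by auto
  show "topcontinuous_at ?T (M_top sc X Y) (\<lambda>(k, a). smult GB k a) t"
    unfolding topcontinuous_at_M_top
  proof (intro conjI allI impI)
    show "(\<lambda>(k, a). smult GB k a) \<in> topspace ?T \<rightarrow> Tot"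
      using stk_scale by auto
    fix U \<sigma> Q \<epsilon>
    assume a: "openin X U \<and> \<sigma> \<in> M \<and> Q \<in> idx \<and> (case t of (k, a) \<Rightarrow> smult GB k a) \<in> tube U \<sigma> Q \<epsilon>"
    then have Q: "Q \<in> idx" and \<sigma>: "section_cont \<sigma> x" and U: "openin X U" "x \<in> U"
      and less: "mu_sup Q x (fdiff Y (mscale l g) (\<sigma> x)) < \<epsilon>"
      using tx M_section_cont by (auto simp: mem_tube)
    obtain \<delta> where \<delta>: "0 < \<delta>" "\<And>F. F \<in> M \<Longrightarrow> mu_sup Q x (fdiff Y (mscale l g) (F x)) < \<delta> \<Longrightarrow>
      \<forall>\<^sub>F y in nhdsin X x. \<forall>h\<in>V. mu_sup Q y (fdiff Y h (F y)) < \<delta> \<longrightarrow> mu_sup Q y (fdiff Y h (\<sigma> y)) < \<epsilon>"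
      by (rule tube_refine[OF tx(2) gV(2) \<sigma> Q less]) auto
    \<comment> \<open>Chosen so that \<open>(norm l + 1) * \<eta>\<close> is \<delta>/2; the factor
      bounds \<open>norm k\<close> once k is within distance 1 of l.\<close>
    define \<eta> where "\<eta> = \<delta> / (2 * (norm l + 1))"
    have lpos: "0 < norm l + 1"
      by (rule add_nonneg_pos) auto
    then have \<eta>: "0 < \<eta>" "(norm l + 1) * \<eta> = \<delta> / 2"
      using \<delta>(1) by (auto simp: \<eta>_def field_simps)
    obtain F where F: "F \<in> M" "mu_sup Q x (fdiff Y g (F x)) < \<eta>"
      by (rule stk_approx[OF tx(2,3) Q \<eta>(1)])
    \<comment> \<open>A strict upper bound at x for the seminorm of F; upper semicontinuity
      preserves it near x, where it controls the term (k - l)F.\<close>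
    define C where "C = mu_sup Q x (F x) + 1"
    have C: "0 < C"
      unfolding C_def using mu_sup_nonneg[OF Q] by (rule add_nonneg_pos) simp
    \<comment> \<open>The cap 1 gives \<open>norm k \<le> norm l + 1\<close>; the other entry makes
      \<open>r * C\<close> at most \<delta>/2.\<close>
    define r where "r = min 1 (\<delta> / (2 * C))"
    have r: "0 < r" "r \<le> 1" "r * C \<le> \<delta> / 2"
      using \<delta>(1) C by (auto simp: r_def min_def field_simps)
    define H where "H = (\<lambda>x\<in>topspace X. mscale l (F x))"
    have H: "H \<in> M"
      unfolding H_def by (rule M_scale[OF F(1)])
    have near: "mu_sup Q y (fdiff Y (mscale k h) (H y)) < \<delta>"
      if y: "y \<in> topspace X" and h: "h \<in> V" "mu_sup Q y (fdiff Y h (F y)) < \<eta>"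
        and k: "norm (k - l) < r" and c: "mu_sup Q y (F y) < C" for y h k
    proof -
      have FV: "F y \<in> V"
        using M_V F(1) y by blast
      have "norm k \<le> norm l + norm (k - l)"
        by (rule norm_triangle_sub)
      also have "\<dots> \<le> norm l + 1"
        using k r(2) by simp
      finally have "norm k * mu_sup Q y (fdiff Y h (F y)) \<le> (norm l + 1) * mu_sup Q y (fdiff Y h (F y))"
        using mu_sup_nonneg[OF Q] by (rule mult_right_mono)
      also have "\<dots> < (norm l + 1) * \<eta>"
        using h(2) lpos by (rule mult_strict_left_mono)
      finally have 1: "mu_sup Q y (fdiff Y (mscale k h) (mscale k (F y))) < \<delta> / 2"
        by (simp add: mu_sup_mscale_fdiff h(1) FV Q \<eta>(2))
      have "norm (k - l) * mu_sup Q y (F y) \<le> r * C"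
        using k c r(1) mu_sup_nonneg[OF Q] by (intro mult_mono) auto
      then have 2: "mu_sup Q y (fdiff Y (mscale k (F y)) (mscale l (F y))) \<le> \<delta> / 2"
        using r(3) by (simp add: fdiff_mscale_left mu_sup_scale FV Q)
      have "mu_sup Q y (fdiff Y (mscale k h) (mscale l (F y))) \<le>
          mu_sup Q y (fdiff Y (mscale k h) (mscale k (F y))) + mu_sup Q y (fdiff Y (mscale k (F y)) (mscale l (F y)))"
        using h(1) FV Q by (intro mu_sup_fdiff_triangle V_scale)
      then show ?thesis
        using 1 2 y by (simp add: H_def)
    qed
    have Fx: "mu_sup Q x (F x) < C"
      by (simp add: C_def)
    have "\<forall>\<^sub>F y in nhdsin X x. mu_sup Q y (F y) < C"
      by (rule tame_eventually_mu_sup_less[OF M_tame[OF F(1) tx(2)] tx(2) Q Fx])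
    moreover have "\<forall>\<^sub>F y in nhdsin X x. \<forall>h\<in>V. mu_sup Q y (fdiff Y h (H y)) < \<delta> \<longrightarrow> mu_sup Q y (fdiff Y h (\<sigma> y)) < \<epsilon>"
      using r(1) Fx by (intro \<delta>(2)[OF H near[OF tx(2) gV(1) F(2)]]) auto
    ultimately have "\<forall>\<^sub>F y in nhdsin X x. mu_sup Q y (F y) < C \<and>
        (\<forall>h\<in>V. mu_sup Q y (fdiff Y h (H y)) < \<delta> \<longrightarrow> mu_sup Q y (fdiff Y h (\<sigma> y)) < \<epsilon>)"
      by (rule eventually_conj)
    then obtain U0 where U0: "openin X U0" "x \<in> U0" "\<And>y. y \<in> U0 \<Longrightarrow> mu_sup Q y (F y) < C"
      "\<And>y h. y \<in> U0 \<Longrightarrow> h \<in> V \<Longrightarrow> mu_sup Q y (fdiff Y h (H y)) < \<delta> \<Longrightarrow> mu_sup Q y (fdiff Y h (\<sigma> y)) < \<epsilon>"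
      unfolding eventually_nhdsin using tx(2) by blast
    define W where "W = U \<inter> U0"
    have W: "openin X W"
      unfolding W_def using U U0 by auto
    define A where "A = tube W F Q \<eta>"
    have "openin ?T (ball l r \<times> A)"
      unfolding A_def openin_prod_Times_iff using openin_tube[OF W F(1) Q \<eta>(1)] by simp
    moreover have "t \<in> ball l r \<times> A"
      unfolding tx(1) A_def W_def using U U0 F r(1) tx by (simp add: mem_tube)
    moreover have "(case t' of (k, a) \<Rightarrow> smult GB k a) \<in> tube U \<sigma> Q \<epsilon>" if mem: "t' \<in> ball l r \<times> A" for t'
    proof -
      obtain k y h where t': "t' = (k, (y, h))" "y \<in> W" "h \<in> stk y"
        "mu_sup Q y (fdiff Y h (F y)) < \<eta>" "norm (k - l) < r"
        using mem unfolding A_def by (auto simp: M_tube_def dist_norm norm_minus_commute)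
      have y: "y \<in> topspace X"
        using t'(2) openin_subset[OF W] by blast
      have V': "h \<in> V"
        using stk_V[OF y] t' by auto
      have "mu_sup Q y (fdiff Y (mscale k h) (\<sigma> y)) < \<epsilon>"
        using U0(3)[of y] U0(4)[of y "mscale k h"] near[OF y V' t'(4,5)] t'(2) V_scale[OF V'] by (simp add: W_def)
      then show ?thesis
        using stk_scale[OF y t'(3)] t'(1,2) by (simp add: mem_tube W_def)
    qed
    ultimately show "\<forall>\<^sub>F t' in nhdsin ?T t. (case t' of (k, a) \<Rightarrow> smult GB k a) \<in> tube U \<sigma> Q \<epsilon>"
      unfolding eventually_nhdsin by blast
  qed (rule t)
qed

section \<open>Topology of the stalks\<close>

lemma gauge_GB:
  "{\<lambda>a b. \<nu> (sdiff GB b a) | \<nu>. \<nu> \<in> semi GB} = (\<lambda>Q a b. mu_sup Q (fst b) (fdiff Y (snd b) (snd a))) ` idx"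
proof -
  have "(\<lambda>a b. (\<lambda>(x, g). mu_sup Q x g) (sdiff GB b a)) = (\<lambda>a b. mu_sup Q (fst b) (fdiff Y (snd b) (snd a)))"
    for Q :: "('y set \<times> ('x \<Rightarrow> 'z)) set"
    by (simp add: fun_eq_iff)
  then show ?thesis
    unfolding Setcompr_eq_image semi_GB image_image by simp
qed

text \<open>A tube restricts to a stalk as a ball, in general not centred at the given element, so
  the triangle inequality is needed both ways: the gap left by the tube gives a ball around g, and
  conversely the tube of radius \<epsilon>/2 around an \<epsilon>/2-approximant of g contains g and
  stays within distance \<epsilon> of it.\<close>

lemma stalk_top_GB:
  assumes x: "x \<in> topspace X"
  shows "stalk_top GB x = gauge_topology (stalk GB x) {\<lambda>a b. \<nu> (sdiff GB b a) | \<nu>. \<nu> \<in> semi GB}"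
    (is "_ = gauge_topology _ ?D")
proof (rule topology_eq[THEN iffD2], rule allI)
  fix S
  show "openin (stalk_top GB x) S = openin (gauge_topology (stalk GB x) ?D) S"
    unfolding gauge_GB stalk_top_def stalk_GB[OF x] GB_simps
  proof
    assume "openin (subtopology (M_top sc X Y) ({x} \<times> stk x)) S"
    then obtain W where W: "openin (M_top sc X Y) W" "S = W \<inter> ({x} \<times> stk x)"
      by (auto simp: openin_subtopology)
    show "openin (gauge_topology ({x} \<times> stk x) ((\<lambda>Q a b. mu_sup Q (fst b) (fdiff Y (snd b) (snd a))) ` idx)) S"
      unfolding openin_gauge_topology
    proof (intro conjI ballI)
      show "S \<subseteq> {x} \<times> stk x"
        using W(2) by blast
      fix p assume "p \<in> S"
      then obtain g where g: "p = (x, g)" "g \<in> stk x" "p \<in> W"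
        using W(2) by auto
      obtain U \<sigma> Q \<epsilon> where U: "openin X U" "\<sigma> \<in> M" "Q \<in> idx" "0 < \<epsilon>" "p \<in> tube U \<sigma> Q \<epsilon>" "tube U \<sigma> Q \<epsilon> \<subseteq> W"
        by (rule M_top_tubeE[OF W(1) g(3)])
      define \<delta> where "\<delta> = \<epsilon> - mu_sup Q x (fdiff Y g (\<sigma> x))"
      have "0 < \<delta>" "x \<in> U"
        using U(5) g(1) by (auto simp: \<delta>_def mem_tube)
      have "(x, h) \<in> S" if h: "h \<in> stk x" "mu_sup Q x (fdiff Y h g) < \<delta>" for h
      proof -
        have "mu_sup Q x (fdiff Y h (\<sigma> x)) \<le> mu_sup Q x (fdiff Y h g) + mu_sup Q x (fdiff Y g (\<sigma> x))"
          using h g stk_V[OF x] M_V[OF U(2) x] U(3) by (intro mu_sup_fdiff_triangle) auto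
        then have "(x, h) \<in> tube U \<sigma> Q \<epsilon>"
          using h \<open>x \<in> U\<close> unfolding \<delta>_def by (simp add: mem_tube)
        then show ?thesis
          using U(6) W(2) h(1) by blast
      qed
      then have "{b \<in> {x} \<times> stk x. \<forall>d\<in>{\<lambda>a b. mu_sup Q (fst b) (fdiff Y (snd b) (snd a))}. d p b < \<delta>} \<subseteq> S"
        using g(1) by auto
      then show "\<exists>F \<epsilon>. finite F \<and> F \<subseteq> (\<lambda>Q a b. mu_sup Q (fst b) (fdiff Y (snd b) (snd a))) ` idx \<and> 0 < \<epsilon> \<and>
          {b \<in> {x} \<times> stk x. \<forall>d\<in>F. d p b < \<epsilon>} \<subseteq> S"
        using \<open>0 < \<delta>\<close> U(3)
        by (intro exI[of _ "{\<lambda>a b. mu_sup Q (fst b) (fdiff Y (snd b) (snd a))}"] exI[of _ \<delta>]) simp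
    qed
  next
    assume S: "openin (gauge_topology ({x} \<times> stk x) ((\<lambda>Q a b. mu_sup Q (fst b) (fdiff Y (snd b) (snd a))) ` idx)) S"
    have Sx: "S \<subseteq> {x} \<times> stk x"
      using openin_subset[OF S] by simp
    have "\<exists>T. openin (subtopology (M_top sc X Y) ({x} \<times> stk x)) T \<and> p \<in> T \<and> T \<subseteq> S" if p: "p \<in> S" for p
    proof -
      obtain F \<epsilon> where F: "finite F" "F \<subseteq> (\<lambda>Q a b. mu_sup Q (fst b) (fdiff Y (snd b) (snd a))) ` idx" "0 < \<epsilon>"
          "{b \<in> {x} \<times> stk x. \<forall>d\<in>F. d p b < \<epsilon>} \<subseteq> S"
        by (rule gauge_topology_ballE[OF S p])
      obtain I where I: "I \<subseteq> idx" "finite I" "F = (\<lambda>Q a b. mu_sup Q (fst b) (fdiff Y (snd b) (snd a))) ` I"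
        using finite_subset_image[OF F(1,2)] by (elim exE conjE) (rule that)
      \<comment> \<open>A union of index sets yields one seminorm that dominates the finitely many
        given ones.\<close>
      define R where "R = \<Union>I"
      have R: "R \<in> idx"
        unfolding R_def mu_index_def using I(1,2) by (auto simp: mu_index_def)
      obtain g where g: "p = (x, g)" "g \<in> stk x"
        using p Sx by auto
      obtain \<sigma> where \<sigma>: "\<sigma> \<in> M" "mu_sup R x (fdiff Y g (\<sigma> x)) < \<epsilon> / 2"
        by (rule stk_approx[OF x g(2) R half_gt_zero[OF F(3)]])
      define T where "T = tube (topspace X) \<sigma> R (\<epsilon> / 2) \<inter> ({x} \<times> stk x)"
      have "openin (subtopology (M_top sc X Y) ({x} \<times> stk x)) T"
        unfolding T_def using openin_tube[OF openin_topspace \<sigma>(1) R half_gt_zero[OF F(3)]]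
        by (auto simp: openin_subtopology)
      moreover have "p \<in> T"
        unfolding T_def using g \<sigma>(2) x by (simp add: mem_tube)
      moreover have "T \<subseteq> S"
      proof
        fix q assume "q \<in> T"
        then obtain h where h: "q = (x, h)" "h \<in> stk x" "mu_sup R x (fdiff Y h (\<sigma> x)) < \<epsilon> / 2"
          unfolding T_def M_tube_def by blast
        have "mu_sup R x (fdiff Y h g) \<le> mu_sup R x (fdiff Y h (\<sigma> x)) + mu_sup R x (fdiff Y (\<sigma> x) g)"
          using h g stk_V[OF x] M_V[OF \<sigma>(1) x] R by (intro mu_sup_fdiff_triangle) auto
        also have "\<dots> < \<epsilon>"
          using h(3) \<sigma>(2) mu_sup_fdiff_commute[OF R, of x g "\<sigma> x"] by linarith
        finally have less: "mu_sup R x (fdiff Y h g) < \<epsilon>" .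
        have "mu_sup Q x (fdiff Y h g) < \<epsilon>" if "Q \<in> I" for Q
        proof (rule le_less_trans[OF mu_sup_mono[OF _ R] less])
          show "Q \<subseteq> R"
            unfolding R_def using that by blast
        qed
        then have "q \<in> {b \<in> {x} \<times> stk x. \<forall>d\<in>F. d p b < \<epsilon>}"
          using h g unfolding I(3) by simp
        then show "q \<in> S"
          using F(4) by (rule subsetD[rotated])
      qed
      ultimately show ?thesis by blast
    qed
    then show "openin (subtopology (M_top sc X Y) ({x} \<times> stk x)) S"
      by (subst openin_subopen) blast
  qed
qed

lemma Hausdorff_stalk_GB:
  assumes x: "x \<in> topspace X"
  shows "Hausdorff_space (stalk_top GB x)"
proof -
  show ?thesis
    unfolding stalk_top_GB[OF x] gauge_GB stalk_GB[OF x]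
  proof (rule Hausdorff_gauge_topology)
    have tri: "mu_sup Q x (fdiff Y k g) \<le> mu_sup Q x (fdiff Y h g) + mu_sup Q x (fdiff Y k h)"
      if "Q \<in> idx" "g \<in> stk x" "h \<in> stk x" "k \<in> stk x" for Q g h k
      using mu_sup_fdiff_triangle[of k h g Q x] stk_V[OF x] that by simp
    show "pseudometrics ({x} \<times> stk x) ((\<lambda>Q a b. mu_sup Q (fst b) (fdiff Y (snd b) (snd a))) ` idx)"
      unfolding pseudometrics_def
      by (auto simp: fdiff_self mu_sup_zero tri intro: mu_sup_fdiff_commute)
    fix a b assume "a \<in> {x} \<times> stk x" "b \<in> {x} \<times> stk x" "a \<noteq> b"
    then obtain g h where gh: "a = (x, g)" "b = (x, h)" "g \<in> V" "h \<in> V" "g \<noteq> h"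
      using stk_V[OF x] by auto
    then obtain s where s: "s \<in> topspace Y" "g s \<noteq> h s"
      using V_extensional by (metis extensionalityI)
    then obtain z where z: "blinfun_apply (g s) z \<noteq> blinfun_apply (h s) z"
      using blinfun_eqI by metis
    have K: "{s} \<in> Comp Y"
      using s(1) by (simp add: Comp_def)
    \<comment> \<open>Distinct elements differ at some point s on some vector z; the compact set {s}
      with the constant z separates them.\<close>
    define Q where "Q = {({s}, \<lambda>x\<in>topspace X. z)}"
    have Q: "Q \<in> idx"
      unfolding Q_def by (intro mu_index_insert K const_Cb mu_index_empty)
    have "0 < norm (blinfun_apply (fdiff Y h g s) z)"
      using z s(1) by (simp add: fdiff_def blinfun.diff_left)
    also have "\<dots> \<le> pn {s} z (fdiff Y h g)"
      using gh K by (intro pn_upper V_diff) auto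
    also have "\<dots> \<le> mu_sup Q x (fdiff Y h g)"
      using mu_sup_upper[OF Q, of "{s}" "\<lambda>x\<in>topspace X. z" x "fdiff Y h g"] x by (simp add: Q_def)
    finally show "\<exists>d\<in>(\<lambda>Q a b. mu_sup Q (fst b) (fdiff Y (snd b) (snd a))) ` idx. 0 < d a b"
      using Q gh(1,2) by auto
  qed
qed

section \<open>Tubes around bundle sections as a base of the total space\<close>

lemma graph_in_Gamma_on:
  assumes U: "openin X U" and F: "F \<in> M"
  shows "(\<lambda>x\<in>U. (x, F x)) \<in> Gamma_on GB U"
proof -
  have sub: "U \<subseteq> topspace X"
    using openin_subset[OF U] .
  have "topcontinuous_at (subtopology X U) (M_top sc X Y) (\<lambda>x\<in>U. (x, F x)) x" if "x \<in> U" for x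
    using M_section_cont[OF F, of x] M_stk[OF F] sub that
    by (subst topcontinuous_at_section_iff[OF U that, of F]) auto
  then have "continuous_map (subtopology X U) (M_top sc X Y) (\<lambda>x\<in>U. (x, F x))"
    unfolding continuous_map_eq_topcontinuous_at by simp
  moreover have "bdd_above ((\<lambda>x. \<nu> ((\<lambda>x\<in>U. (x, F x)) x)) ` U)" if \<nu>: "\<nu> \<in> semi GB" for \<nu>
  proof -
    obtain Q where Q: "Q \<in> idx" "\<nu> = (\<lambda>(x, g). mu_sup Q x g)"
      using \<nu> by (auto simp: semi_GB)
    have "F \<in> topspace X \<rightarrow> V" "norm_bounded F"
      using F M_V by (auto simp: M_iff)
    from mu_sup_bdd[OF this Q(1)] have "bdd_above ((\<lambda>x. mu_sup Q x (F x)) ` U)"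
      by (rule bdd_above_mono) (use sub in blast)
    moreover have "(\<lambda>x. \<nu> ((\<lambda>x\<in>U. (x, F x)) x)) ` U = (\<lambda>x. mu_sup Q x (F x)) ` U"
      by (rule image_cong) (auto simp: Q(2))
    ultimately show ?thesis by simp
  qed
  moreover have "(\<lambda>x\<in>U. (x, F x)) \<in> (\<Pi>\<^sub>E x\<in>U. stalk GB x)"
    using sub M_stk[OF F] by (auto simp: stalk_def)
  ultimately show ?thesis
    unfolding Gamma_on_def bounded_sections_def by simp
qed

lemma tubes_GB_tube:
  assumes "openin X U" "\<sigma> \<in> M" "Q \<in> idx" "0 < \<epsilon>"
  shows "tube U \<sigma> Q \<epsilon> \<in> tubes GB"
proof -
  define \<nu> where "\<nu> = (\<lambda>(x :: 'x, g :: 'y \<Rightarrow> 'z \<Rightarrow>\<^sub>L 'z). mu_sup Q x g)"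
  have "\<nu> \<in> semi GB"
    unfolding \<nu>_def semi_GB using assms(3) by blast
  moreover have "tube U \<sigma> Q \<epsilon> = {\<beta> \<in> topspace (tot GB). proj GB \<beta> \<in> U \<and>
      \<nu> (sdiff GB \<beta> ((\<lambda>x\<in>U. (x, \<sigma> x)) (proj GB \<beta>))) < \<epsilon>}"
    using openin_subset[OF assms(1)] by (auto simp: M_tube_def \<nu>_def)
  ultimately show ?thesis
    unfolding tubes_def mem_Collect_eq using graph_in_Gamma_on[OF assms(1,2)] assms(1,4)
    by (intro exI[of _ U] exI[of _ "\<lambda>x\<in>U. (x, \<sigma> x)"] exI[of _ \<nu>] exI[of _ \<epsilon>]) simp
qed

text \<open>The bundle axiom admits tubes around every bounded continuous local section, not only
  around members of \<open>M\<close>. Such a section satisfies \<open>section_cont\<close>, which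
  suffices to recentre at a member of \<open>M\<close> around each point of the tube.\<close>

lemma openin_tubes_GB:
  assumes "S \<in> tubes GB"
  shows "openin (M_top sc X Y) S"
proof -
  obtain U \<phi> \<nu> \<epsilon> where S: "S = {\<beta> \<in> topspace (tot GB). proj GB \<beta> \<in> U \<and> \<nu> (sdiff GB \<beta> (\<phi> (proj GB \<beta>))) < \<epsilon>}"
    and U: "openin X U" and \<phi>: "\<phi> \<in> Gamma_on GB U" and \<nu>: "\<nu> \<in> semi GB"
    using assms unfolding tubes_def by auto
  obtain Q where Q: "Q \<in> idx" "\<nu> = (\<lambda>(x, g). mu_sup Q x g)"
    using \<nu> by (auto simp: semi_GB)
  have sub: "U \<subseteq> topspace X"
    using openin_subset[OF U] .
  define \<sigma> where "\<sigma> x = snd (\<phi> x)" for x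
  have \<sigma>: "\<phi> x = (x, \<sigma> x)" "\<sigma> x \<in> stk x" if "x \<in> U" for x
  proof -
    have "\<phi> x \<in> stalk GB x"
      using \<phi> that unfolding Gamma_on_def bounded_sections_def by auto
    moreover have "x \<in> topspace X"
      using that sub by blast
    ultimately have "\<phi> x \<in> {x} \<times> stk x"
      by (simp only: stalk_GB)
    then show "\<phi> x = (x, \<sigma> x)" "\<sigma> x \<in> stk x"
      by (auto simp: \<sigma>_def)
  qed
  have "continuous_map (subtopology X U) (M_top sc X Y) \<phi>"
    using \<phi> unfolding Gamma_on_def by simp
  then have cont: "section_cont \<sigma> x" if "x \<in> U" for x
    using topcontinuous_at_section_iff[OF U that \<sigma>(2,1)] that sub
    unfolding continuous_map_eq_topcontinuous_at by auto
  have mem: "(x, g) \<in> S \<longleftrightarrow> x \<in> U \<and> g \<in> stk x \<and> mu_sup Q x (fdiff Y g (\<sigma> x)) < \<epsilon>" for x g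
    unfolding S using sub by (auto simp: Q(2) \<sigma>(1))
  show ?thesis
  proof (subst openin_subopen, intro ballI)
    fix p assume p: "p \<in> S"
    obtain x g where xg: "p = (x, g)" by fastforce
    have x: "x \<in> U" "x \<in> topspace X" "g \<in> stk x" "g \<in> V" and less: "mu_sup Q x (fdiff Y g (\<sigma> x)) < \<epsilon>"
      using p xg mem sub stk_V by auto
    obtain \<delta> where \<delta>: "0 < \<delta>" "\<And>F. F \<in> M \<Longrightarrow> mu_sup Q x (fdiff Y g (F x)) < \<delta> \<Longrightarrow>
      \<forall>\<^sub>F y in nhdsin X x. \<forall>h\<in>V. mu_sup Q y (fdiff Y h (F y)) < \<delta> \<longrightarrow> mu_sup Q y (fdiff Y h (\<sigma> y)) < \<epsilon>"
      by (rule tube_refine[OF x(2,4) cont[OF x(1)] Q(1) less]) auto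
    obtain F where F: "F \<in> M" "mu_sup Q x (fdiff Y g (F x)) < \<delta>"
      by (rule stk_approx[OF x(2,3) Q(1) \<delta>(1)])
    obtain U0 where U0: "openin X U0" "x \<in> U0"
      "\<And>y h. y \<in> U0 \<Longrightarrow> h \<in> V \<Longrightarrow> mu_sup Q y (fdiff Y h (F y)) < \<delta> \<Longrightarrow> mu_sup Q y (fdiff Y h (\<sigma> y)) < \<epsilon>"
      using \<delta>(2)[OF F] x(2) unfolding eventually_nhdsin by auto
    have W: "openin X (U \<inter> U0)"
      using U U0(1) by auto
    have "tube (U \<inter> U0) F Q \<delta> \<subseteq> S"
    proof
      fix q assume "q \<in> tube (U \<inter> U0) F Q \<delta>"
      then obtain y h where q: "q = (y, h)" "y \<in> U" "y \<in> U0" "h \<in> stk y" "mu_sup Q y (fdiff Y h (F y)) < \<delta>"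
        unfolding M_tube_def by blast
      have "h \<in> V"
        using q stk_V sub by blast
      then show "q \<in> S"
        using U0(3)[OF q(3) _ q(5)] q mem by simp
    qed
    moreover have "p \<in> tube (U \<inter> U0) F Q \<delta>"
      using x F U0(2) by (simp add: xg mem_tube)
    ultimately show "\<exists>T. openin (M_top sc X Y) T \<and> p \<in> T \<and> T \<subseteq> S"
      using openin_tube[OF W F(1) Q(1) \<delta>(1)] by blast
  qed
qed

lemma is_omega_bundle_GB: "is_omega_bundle GB"
proof -
  have fst_image: "fst ` Tot = topspace X"
    using stk_zero by force
  have nonempty: "semi GB \<noteq> {}"
    unfolding semi_GB using mu_index_empty by auto
  have tubes: "openin (M_top sc X Y) = arbitrary union_of (\<lambda>S. S \<in> tubes GB)"
    unfolding openin_topology_base_unique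
  proof (intro conjI allI impI)
    fix W p assume "openin (M_top sc X Y) W \<and> p \<in> W"
    then have W: "openin (M_top sc X Y) W" "p \<in> W" by auto
    show "\<exists>S. S \<in> tubes GB \<and> p \<in> S \<and> S \<subseteq> W"
      by (rule M_top_tubeE[OF W]) (use tubes_GB_tube in blast)
  qed (rule openin_tubes_GB)
  show ?thesis
    unfolding is_omega_bundle_def GB_simps topspace_M_top
    by (intro conjI ballI continuous_fst_M_top open_fst_M_top fst_image stalk_vector_space_GB
        continuous_sadd_GB continuous_smult_GB nonempty stalk_seminorm_GB directed_GB stalk_top_GB
        Hausdorff_stalk_GB tubes; assumption)
qed

section \<open>The trivial bundle\<close>

abbreviation TB :: "('k, 'x \<times> 'z, 'x) omega_bundle" where
  "TB \<equiv> trivial_bundle sc X"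

lemma TB_simps [simp]:
  "tot TB = prod_topology X euclidean" "proj TB = fst" "base TB = X" "szero TB x = (x, 0)"
  "sadd TB p q = (fst p, snd p + snd q)" "smult TB k p = (fst p, sc k (snd p))"
  "sdiff TB p q = (fst p, snd p - snd q)" "semi TB = {\<lambda>p. norm (snd p)}"
  by (auto simp: trivial_bundle_def sdiff_def split: prod.splits)

lemma stalk_TB: "x \<in> topspace X \<Longrightarrow> stalk TB x = {x} \<times> UNIV"
  by (auto simp: stalk_def)

lemma gauge_TB: "{\<lambda>a b. \<nu> (sdiff TB b a) | \<nu>. \<nu> \<in> semi TB} = {\<lambda>a b. norm (snd b - snd a)}"
  by auto

lemma stalk_top_TB:
  assumes x: "x \<in> topspace X"
  shows "stalk_top TB x = gauge_topology (stalk TB x) {\<lambda>a b. \<nu> (sdiff TB b a) | \<nu>. \<nu> \<in> semi TB}"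
  unfolding gauge_TB
  unfolding stalk_top_def stalk_TB[OF x] TB_simps
proof (rule topology_eq[THEN iffD2], intro allI iffI)
  fix S :: "('x \<times> 'z) set" assume "openin (subtopology (prod_topology X euclidean) ({x} \<times> UNIV)) S"
  then obtain W where W: "openin (prod_topology X euclidean) W" "S = W \<inter> ({x} \<times> (UNIV :: 'z set))"
    by (auto simp: openin_subtopology)
  show "openin (gauge_topology ({x} \<times> UNIV) {\<lambda>a b. norm (snd b - snd a)}) S"
    unfolding openin_gauge_topology
  proof (intro conjI ballI)
    show "S \<subseteq> {x} \<times> UNIV"
      using W(2) by blast
    fix p assume "p \<in> S"
    then obtain z where z: "p = (x, z)" "(x, z) \<in> W"
      using W(2) by auto
    obtain U \<epsilon> where U: "openin X U" "x \<in> U" and \<epsilon>: "0 < \<epsilon>"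
        "\<And>y a. y \<in> U \<Longrightarrow> norm (a - z) < \<epsilon> \<Longrightarrow> (y, a) \<in> W"
      by (rule openin_prod_euclidean_ballE[OF W(1) z(2)]) auto
    have "{b \<in> {x} \<times> UNIV. \<forall>d\<in>{\<lambda>a b. norm (snd b - snd a)}. d p b < \<epsilon>} \<subseteq> S"
      using \<epsilon>(2)[OF U(2)] by (auto simp: z(1) W(2))
    then show "\<exists>F \<epsilon>. finite F \<and> F \<subseteq> {\<lambda>a b. norm (snd b - snd a)} \<and> 0 < \<epsilon> \<and>
        {b \<in> {x} \<times> UNIV. \<forall>d\<in>F. d p b < \<epsilon>} \<subseteq> S"
      using \<epsilon>(1) by (intro exI[of _ "{\<lambda>a b. norm (snd b - snd a)}"] exI[of _ \<epsilon>]) simp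
  qed
next
  fix S assume S: "openin (gauge_topology ({x} \<times> UNIV) {\<lambda>a b. norm (snd b - snd a)}) (S :: ('x \<times> 'z) set)"
  define T where "T = {z. (x, z) \<in> S}"
  have "\<exists>\<epsilon>>0. ball z \<epsilon> \<subseteq> T" if z: "z \<in> T" for z
  proof -
    have "(x, z) \<in> S"
      using z by (simp add: T_def)
    then obtain F \<epsilon> where F: "finite F" "F \<subseteq> {\<lambda>a b. norm (snd b - snd a)}" "0 < \<epsilon>"
        "{b \<in> {x} \<times> UNIV. \<forall>d\<in>F. d (x, z) b < \<epsilon>} \<subseteq> S"
      by (rule gauge_topology_ballE[OF S])
    have "y \<in> T" if "y \<in> ball z \<epsilon>" for y
    proof -
      have "(x, y) \<in> {b \<in> {x} \<times> UNIV. \<forall>d\<in>F. d (x, z) b < \<epsilon>}"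
        using F(2) that by (auto simp: dist_norm norm_minus_commute)
      then show ?thesis
        using F(4) by (auto simp: T_def)
    qed
    then show ?thesis
      using F(3) by blast
  qed
  then have "open T"
    by (simp add: open_contains_ball)
  then have "openin (prod_topology X euclidean) (topspace X \<times> T)"
    by (simp add: openin_prod_Times_iff)
  moreover have "S = (topspace X \<times> T) \<inter> ({x} \<times> UNIV)"
    using openin_subset[OF S] x by (auto simp: T_def)
  ultimately show "openin (subtopology (prod_topology X euclidean) ({x} \<times> UNIV)) S"
    by (auto simp: openin_subtopology)
qed

lemma Hausdorff_stalk_TB:
  assumes x: "x \<in> topspace X"
  shows "Hausdorff_space (stalk_top TB x)"
  unfolding stalk_top_TB[OF x] gauge_TB stalk_TB[OF x]
proof (rule Hausdorff_gauge_topology)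
  have "norm (c - a) \<le> norm (b - a) + norm (c - b)" for a b c :: 'z
    using norm_triangle_ineq[of "b - a" "c - b"] by simp
  then show "pseudometrics ({x} \<times> UNIV) {\<lambda>a b. norm (snd b - snd a :: 'z)}"
    unfolding pseudometrics_def by (auto intro: norm_minus_commute)
qed auto

text \<open>\<open>sadd\<close> keeps the base point of its left argument, so it is continuous on
  the whole product and then on any subset.\<close>

lemma continuous_sadd_TB:
  "continuous_map (subtopology (prod_topology (prod_topology X euclidean) (prod_topology X euclidean)) A)
     (prod_topology X euclidean) (\<lambda>(a, b). sadd TB a b)"
proof -
  let ?P = "prod_topology (prod_topology X euclidean) (prod_topology X euclidean) :: (('x \<times> 'z) \<times> 'x \<times> 'z) topology"
  have eq: "(\<lambda>(a, b). sadd TB a b) = (\<lambda>p. (fst (fst p), snd (fst p) + snd (snd p)))"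
    by (auto simp: fun_eq_iff)
  have "continuous_map ?P X (\<lambda>p. fst (fst p))"
    "continuous_map ?P euclidean (\<lambda>p. snd (fst p))" "continuous_map ?P euclidean (\<lambda>p. snd (snd p))"
    using continuous_map_compose[OF continuous_map_fst continuous_map_fst]
      continuous_map_compose[OF continuous_map_fst continuous_map_snd]
      continuous_map_compose[OF continuous_map_snd continuous_map_snd]
    unfolding comp_def by blast+
  then have "continuous_map ?P (prod_topology X euclidean) (\<lambda>p. (fst (fst p), snd (fst p) + snd (snd p)))"
    by (simp add: continuous_map_paired continuous_map_add)
  then show ?thesis
    unfolding eq by (rule continuous_map_from_subtopology)
qed

lemma continuous_smult_TB:
  "continuous_map (prod_topology euclidean (prod_topology X euclidean))
     (prod_topology X euclidean) (\<lambda>(k, a). smult TB k a)"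
proof -
  let ?P = "prod_topology euclidean (prod_topology X euclidean) :: ('k \<times> 'x \<times> 'z) topology"
  have eq: "(\<lambda>(k, a). smult TB k a) = (\<lambda>p. (fst (snd p), sc (fst p) (snd (snd p))))"
    by (auto simp: fun_eq_iff)
  have 1: "continuous_map ?P X (\<lambda>p. fst (snd p))"
    "continuous_map ?P euclidean (\<lambda>p. fst p)" "continuous_map ?P euclidean (\<lambda>p. snd (snd p))"
    using continuous_map_compose[OF continuous_map_snd continuous_map_fst] continuous_map_fst
      continuous_map_compose[OF continuous_map_snd continuous_map_snd]
    unfolding comp_def by blast+
  then have "continuous_map ?P euclidean (\<lambda>p. sc (fst p) (snd (snd p)))"
    by (simp add: continuous_map_atin bounded_bilinear.tendsto[OF bounded_bilinear_sc])
  then show ?thesis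
    unfolding eq by (simp add: continuous_map_paired 1)
qed

lemma continuous_section_TB:
  assumes "continuous_map (subtopology X U) euclidean v"
  shows "continuous_map (subtopology X U) (prod_topology X euclidean) (\<lambda>x\<in>U. (x, v x))"
proof -
  have "continuous_map (subtopology X U) (prod_topology X euclidean) (\<lambda>x. (x, v x))"
    using assms continuous_map_from_subtopology[OF continuous_map_id]
    by (simp add: continuous_map_paired id_def)
  then show ?thesis
    by (rule continuous_map_eq) auto
qed

lemma section_in_Gamma_on_TB:
  assumes "U \<subseteq> topspace X" "continuous_map (subtopology X U) euclidean v" "bounded (v ` U)"
  shows "(\<lambda>x\<in>U. (x, v x)) \<in> Gamma_on TB U"
proof -
  have "bdd_above ((\<lambda>x. norm (snd ((\<lambda>x\<in>U. (x, v x)) x))) ` U)"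
  proof -
    obtain C where "\<forall>x\<in>U. norm (v x) \<le> C"
      using assms(3) unfolding bounded_iff by auto
    then show ?thesis
      by (intro bdd_above.I2[of _ _ C]) simp
  qed
  then show ?thesis
    unfolding Gamma_on_def bounded_sections_def
    using continuous_section_TB[OF assms(2)] assms(1) by (auto simp: stalk_def)
qed

text \<open>The tube is the preimage of an open half-line under a continuous function on U \<times>
  Z, and U \<times> Z is open in X \<times> Z.\<close>

lemma openin_tubes_TB:
  assumes "S \<in> tubes TB"
  shows "openin (prod_topology X euclidean) S"
proof -
  obtain U \<phi> \<epsilon> where S: "S = {\<beta> \<in> topspace X \<times> UNIV. fst \<beta> \<in> U \<and> norm (snd \<beta> - snd (\<phi> (fst \<beta>))) < \<epsilon>}"
    and U: "openin X U" and \<phi>: "\<phi> \<in> Gamma_on TB U"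
    using assms unfolding tubes_def by auto
  have "continuous_map (subtopology X U) (prod_topology X euclidean) \<phi>"
    using \<phi> unfolding Gamma_on_def by simp
  then have c: "continuous_map (subtopology X U) euclidean (\<lambda>x. snd (\<phi> x))"
    using continuous_map_compose[OF _ continuous_map_snd] unfolding comp_def by blast
  let ?P = "prod_topology (subtopology X U) euclidean :: ('x \<times> 'z) topology"
  have "continuous_map ?P euclidean (\<lambda>\<beta>. norm (snd \<beta> - snd (\<phi> (fst \<beta>))))"
    using continuous_map_compose[OF continuous_map_fst c] continuous_map_snd
    unfolding comp_def by (intro continuous_map_norm continuous_map_diff) blast+
  then have "openin ?P {\<beta> \<in> topspace ?P. norm (snd \<beta> - snd (\<phi> (fst \<beta>))) \<in> {..<\<epsilon>}}"
    by (rule openin_continuous_map_preimage) simp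
  moreover have "{\<beta> \<in> topspace ?P. norm (snd \<beta> - snd (\<phi> (fst \<beta>))) \<in> {..<\<epsilon>}} = S"
    unfolding S by auto
  moreover have "?P = subtopology (prod_topology X euclidean) (U \<times> UNIV)"
    by (simp add: subtopology_Times)
  ultimately show ?thesis
    using U by (metis openin_prod_Times_iff openin_topspace openin_trans_full topspace_euclidean)
qed

lemma is_omega_bundle_TB: "is_omega_bundle TB"
proof -
  have vs: "stalk_vector_space TB x" if "x \<in> topspace X" for x
    unfolding stalk_vector_space_def stalk_TB[OF that]
    by (auto simp: sc.scale_right_distrib sc.scale_left_distrib add.assoc add.commute)
  have sn: "stalk_seminorm TB x \<nu>" if "x \<in> topspace X" "\<nu> \<in> semi TB" for x \<nu>
    using that unfolding stalk_seminorm_def by (auto simp: norm_sc norm_triangle_ineq)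
  have dir: "\<exists>\<nu>\<in>semi TB. \<forall>a\<in>A. \<nu>\<^sub>1 a \<le> \<nu> a \<and> \<nu>\<^sub>2 a \<le> \<nu> a" if "\<nu>\<^sub>1 \<in> semi TB" "\<nu>\<^sub>2 \<in> semi TB" for \<nu>\<^sub>1 \<nu>\<^sub>2 A
    using that by auto
  have img: "fst ` topspace (prod_topology X (euclidean :: 'z topology)) = topspace X"
    by simp
  have ne: "semi TB \<noteq> {}"
    by simp
  have tubes: "openin (prod_topology X euclidean) = arbitrary union_of (\<lambda>S. S \<in> tubes TB)"
    unfolding openin_topology_base_unique
  proof (intro conjI allI impI)
    fix W :: "('x \<times> 'z) set" and p assume W: "openin (prod_topology X euclidean) W \<and> p \<in> W"
    obtain x z where p: "p = (x, z)" by fastforce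
    obtain U \<epsilon> where U: "openin X U" "x \<in> U" and \<epsilon>: "0 < \<epsilon>"
        "\<And>y a. y \<in> U \<Longrightarrow> norm (a - z) < \<epsilon> \<Longrightarrow> (y, a) \<in> W"
      by (rule openin_prod_euclidean_ballE[of X W x z]) (use W p in auto)
    \<comment> \<open>Constant local sections suffice for a base: their tubes are products of an
      open set and a ball.\<close>
    have "(\<lambda>x\<in>U. (x, z)) \<in> Gamma_on TB U"
      using openin_subset[OF U(1)] by (intro section_in_Gamma_on_TB) (auto intro: bounded_subset[of "{z}"])
    moreover define S where "S = {\<beta> \<in> topspace (tot TB). proj TB \<beta> \<in> U \<and>
        (\<lambda>p. norm (snd p)) (sdiff TB \<beta> ((\<lambda>x\<in>U. (x, z)) (proj TB \<beta>))) < \<epsilon>}"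
    ultimately have "S \<in> tubes TB"
      unfolding tubes_def mem_Collect_eq using U(1) \<epsilon>(1)
      by (intro exI[of _ U] exI[of _ "\<lambda>x\<in>U. (x, z)"] exI[of _ "\<lambda>p. norm (snd p)"] exI[of _ \<epsilon>]) simp
    moreover have "p \<in> S"
      using U(2) openin_subset[OF U(1)] \<epsilon>(1) by (auto simp: S_def p)
    moreover have "S \<subseteq> W"
    proof
      fix q assume "q \<in> S"
      then have "(fst q, snd q) \<in> W"
        by (intro \<epsilon>(2)) (auto simp: S_def)
      then show "q \<in> W"
        by simp
    qed
    ultimately show "\<exists>S. S \<in> tubes TB \<and> p \<in> S \<and> S \<subseteq> W" by blast
  qed (rule openin_tubes_TB)
  show ?thesis
    unfolding is_omega_bundle_def
    unfolding TB_simps(1-3)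
    by (intro conjI ballI continuous_map_fst open_map_fst img vs continuous_sadd_TB continuous_smult_TB
        ne sn dir stalk_top_TB Hausdorff_stalk_TB tubes; assumption)
qed

section \<open>The structure\<close>

abbreviation Esec :: "('x \<Rightarrow> 'x \<times> 'z) set" where
  "Esec \<equiv> graph_section X ` Cb X"

definition Bpt :: "('x \<Rightarrow> 'z) \<Rightarrow> 'x \<Rightarrow> ('x \<times> 'z) set" where
  "Bpt v = (\<lambda>x\<in>topspace X. {(x, v x)})"

lemma Theta_pt_eq: "Theta_pt X = Bpt ` Cb X"
  unfolding Theta_pt_def Bpt_def by auto

lemma graph_section_Gamma_TB: "v \<in> Cb X \<Longrightarrow> graph_section X v \<in> Gamma TB"
  unfolding Gamma_def graph_section_def TB_simps
  by (rule section_in_Gamma_on_TB) (auto simp: Cb_def cont_maps_def)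

text \<open>One-point fibres admit a single selection, so every supremum over \<open>DD\<close>
  collapses to one value.\<close>

lemma DD_Bpt:
  assumes "v \<in> Cb X"
  shows "DD X Esec (Bpt v) = {graph_section X v}"
proof
  show "{graph_section X v} \<subseteq> DD X Esec (Bpt v)"
    using assms by (auto simp: DD_def Bpt_def graph_section_def)
  show "DD X Esec (Bpt v) \<subseteq> {graph_section X v}"
  proof
    fix \<sigma> assume "\<sigma> \<in> DD X Esec (Bpt v)"
    then have \<sigma>: "\<sigma> \<in> extensional (topspace X)" "\<And>x. x \<in> topspace X \<Longrightarrow> \<sigma> x = (x, v x)"
      unfolding DD_def by (auto simp: Bpt_def PiE_iff)
    have "\<sigma> = graph_section X v"
      by (rule extensionalityI[OF \<sigma>(1)]) (auto simp: graph_section_def \<sigma>(2))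
    then show "\<sigma> \<in> {graph_section X v}" by simp
  qed
qed

lemma BB_Bpt: "v \<in> Cb X \<Longrightarrow> x \<in> topspace X \<Longrightarrow> BB X Esec (Bpt v) x = {(x, v x)}"
  unfolding BB_def DD_Bpt by (auto simp: graph_section_def)

text \<open>Constants reach every vector of the stalk. Hence the family consists of all singletons,
  and \<open>L_top\<close> becomes the topology of pointwise convergence, the analogue of the strong
  operator topology.\<close>

lemma BB_family:
  assumes x: "x \<in> topspace X"
  shows "{BB X Esec B x | B. B \<in> Theta_pt X} = (\<lambda>z. {(x, z)}) ` UNIV"
proof -
  have "{BB X Esec B x | B. B \<in> Theta_pt X} = (\<lambda>v. {(x, v x)}) ` Cb X"
    unfolding Theta_pt_eq Setcompr_eq_image image_image
    by (rule image_cong) (auto simp: BB_Bpt x)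
  also have "\<dots> = (\<lambda>z. {(x, z)}) ` UNIV"
  proof
    show "(\<lambda>z. {(x, z)}) ` (UNIV :: 'z set) \<subseteq> (\<lambda>v. {(x, v x)}) ` Cb X"
    proof
      fix A assume "A \<in> (\<lambda>z. {(x, z)}) ` (UNIV :: 'z set)"
      then obtain z where "A = {(x, z)}" by blast
      then have "A = (\<lambda>v. {(x, v x)}) (\<lambda>x\<in>topspace X. z)"
        using x by simp
      then show "A \<in> (\<lambda>v. {(x, v x)}) ` Cb X"
        using const_Cb by blast
    qed
  qed auto
  finally show ?thesis .
qed

lemma total_TB:
  assumes x: "x \<in> topspace X"
  shows "total_in_stalk TB x (\<Union>B\<in>Theta_pt X. BB X Esec B x)"
proof -
  have "(\<Union>B\<in>Theta_pt X. BB X Esec B x) = \<Union>{BB X Esec B x | B. B \<in> Theta_pt X}"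
    by blast
  also have "\<dots> = stalk TB x"
    unfolding BB_family[OF x] stalk_TB[OF x] by auto
  finally have eq: "(\<Union>B\<in>Theta_pt X. BB X Esec B x) = stalk TB x" .
  have "stalk_subspace TB x (stalk TB x)"
    unfolding stalk_subspace_def stalk_TB[OF x] by auto
  then have "stalk_subspace TB x hull stalk TB x = stalk TB x"
    by (rule hull_same)
  moreover have "topspace (stalk_top TB x) = stalk TB x"
    unfolding stalk_top_TB[OF x] by simp
  ultimately show ?thesis
    unfolding total_in_stalk_def eq using closure_of_topspace[of "stalk_top TB x"] by simp
qed

section \<open>Stalk elements as continuous maps into endomorphisms\<close>

lemma op_ev_apply: "s \<in> topspace Y \<Longrightarrow> op_ev Y (x, g) s (x, z) = (x, blinfun_apply (g s) z)"
  by (simp add: op_ev_def)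

lemma op_ev_inj:
  assumes x: "x \<in> topspace X"
  shows "inj_on (op_ev Y) (stalk GB x)"
proof (rule inj_onI)
  fix p q assume pq: "p \<in> stalk GB x" "q \<in> stalk GB x" "op_ev Y p = op_ev Y q"
  then obtain g h where gh: "p = (x, g)" "q = (x, h)" "g \<in> V" "h \<in> V"
    using stk_V[OF x] by (auto simp: stalk_GB[OF x])
  have "g = h"
  proof (rule extensionalityI[of _ "topspace Y"])
    fix s assume s: "s \<in> topspace Y"
    show "g s = h s"
    proof (rule blinfun_eqI)
      fix z
      have "op_ev Y (x, g) s (x, z) = op_ev Y (x, h) s (x, z)"
        using pq(3) gh by simp
      then show "blinfun_apply (g s) z = blinfun_apply (h s) z"
        by (simp add: op_ev_apply[OF s])
    qed
  qed (use gh V_extensional in auto)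
  then show "p = q"
    using gh by simp
qed

lemma op_ev_endo:
  assumes x: "x \<in> topspace X" and g: "g \<in> V" and s: "s \<in> topspace Y"
  shows "op_ev Y (x, g) s \<in> stalk_endo TB x"
proof -
  have eq: "op_ev Y (x, g) s = (\<lambda>a\<in>{x} \<times> UNIV. (x, blinfun_apply (g s) (snd a)))"
    using s by (simp add: op_ev_def)
  have lin: "blinfun_apply (g s) (sc k z) = sc k (blinfun_apply (g s) z)" for k z
    using g s unfolding V_iff Vector_Spaces.linear_def module_hom_def module_hom_axioms_def by blast
  have st: "stalk_top TB x = subtopology (prod_topology X euclidean) ({x} \<times> UNIV)"
    by (simp add: stalk_top_def stalk_TB[OF x])
  have "continuous_map (prod_topology X euclidean) euclidean (blinfun_apply (g s) \<circ> snd)"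
    by (rule continuous_map_compose[OF continuous_map_snd]) (simp add: blinfun.continuous_on)
  then have "continuous_map (prod_topology X euclidean) (prod_topology X euclidean)
      (\<lambda>a. (x, blinfun_apply (g s) (snd a)))"
    using x by (simp add: continuous_map_paired comp_def)
  then have "continuous_map (stalk_top TB x) (prod_topology X euclidean)
      (\<lambda>a. (x, blinfun_apply (g s) (snd a)))"
    unfolding st by (rule continuous_map_from_subtopology)
  then have "continuous_map (stalk_top TB x) (stalk_top TB x) (\<lambda>a. (x, blinfun_apply (g s) (snd a)))"
    unfolding st by (auto simp: continuous_map_in_subtopology)
  then have "continuous_map (stalk_top TB x) (stalk_top TB x) (op_ev Y (x, g) s)"
    by (rule continuous_map_eq) (auto simp: eq st)
  then show ?thesis
    unfolding stalk_endo_def stalk_TB[OF x]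
    by (auto simp: eq blinfun.add_right lin)
qed

text \<open>The gauges of \<open>L_top\<close> reduce to the distances of values at single vectors,
  so the claim is the strong continuity already contained in \<open>V\<close>.\<close>

lemma op_ev_continuous:
  assumes x: "x \<in> topspace X" and g: "g \<in> V"
  shows "op_ev Y (x, g) \<in> cont_maps Y (L_top TB x {BB X Esec B x | B. B \<in> Theta_pt X})"
proof -
  define d where "d z T T' = norm (snd (T' (x, z)) - snd (T (x, z)))"
    for z :: 'z and T T' :: "'x \<times> 'z \<Rightarrow> 'x \<times> 'z"
  have dz: "(\<lambda>T T'. nsup (\<lambda>a. norm (snd (sdiff TB (T' a) (T a)))) {(x, z)}) = d z" for z
    by (simp add: d_def fun_eq_iff nsup_singleton)
  have "{\<lambda>T T'. nsup (\<lambda>a. \<nu> (sdiff TB (T' a) (T a))) A | A \<nu>. A \<in> (\<lambda>z. {(x, z)}) ` UNIV \<and> \<nu> \<in> semi TB} = range d"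
    (is "?S = _")
  proof (intro set_eqI iffI)
    fix e assume "e \<in> ?S"
    then obtain z where "e = (\<lambda>T T'. nsup (\<lambda>a. norm (snd (sdiff TB (T' a) (T a)))) {(x, z)})"
      by auto
    then show "e \<in> range d"
      unfolding dz by simp
  next
    fix e assume "e \<in> range d"
    then obtain z where "e = d z" by blast
    then have "e = (\<lambda>T T'. nsup (\<lambda>a. (\<lambda>p. norm (snd p)) (sdiff TB (T' a) (T a))) {(x, z)})"
      unfolding dz .
    then show "e \<in> ?S"
      by (intro CollectI exI[of _ "{(x, z)}"] exI[of _ "\<lambda>p. norm (snd p)"] conjI) simp_all
  qed
  then have L: "L_top TB x {BB X Esec B x | B. B \<in> Theta_pt X} = gauge_topology (stalk_endo TB x) (range d)"
    unfolding L_top_def BB_family[OF x] by simp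
  have "norm (c - a) \<le> norm (b - a) + norm (c - b)" for a b c :: 'z
    using norm_triangle_ineq[of "b - a" "c - b"] by simp
  then have pm: "pseudometrics (stalk_endo TB x) (range d)"
    unfolding pseudometrics_def by (auto simp: d_def intro: norm_minus_commute)
  have "\<forall>\<^sub>F t in nhdsin Y s. d z (op_ev Y (x, g) s) (op_ev Y (x, g) t) < \<epsilon>"
    if s: "s \<in> topspace Y" and \<epsilon>: "0 < \<epsilon>" for s z \<epsilon>
  proof -
    have "\<forall>\<^sub>F t in nhdsin Y s. norm (blinfun_apply (g t) z - blinfun_apply (g s) z) < \<epsilon>"
      using g s \<epsilon> unfolding V_iff continuous_map_euclidean_iff_nhdsin by blast
    moreover have "\<forall>\<^sub>F t in nhdsin Y s. t \<in> topspace Y"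
      unfolding eventually_nhdsin using openin_subset by blast
    ultimately show ?thesis
      by eventually_elim (simp add: d_def op_ev_apply s)
  qed
  then have "topcontinuous_at Y (gauge_topology (stalk_endo TB x) (range d)) (op_ev Y (x, g)) s"
    if "s \<in> topspace Y" for s
    unfolding topcontinuous_at_gauge_topology[OF pm] using that op_ev_endo[OF x g] by auto
  then show ?thesis
    unfolding cont_maps_def L continuous_map_eq_topcontinuous_at by (simp add: op_ev_def)
qed

lemma q_semi_eq_mu:
  assumes "(x, g) \<in> Tot" "K \<in> Comp Y" "v \<in> Cb X"
  shows "q_semi Esec GB (op_ev Y) (K, \<lambda>p. norm (snd p), Bpt v) (x, g) = mu K v x g"
  unfolding q_semi_def prod.case GB_simps DD_Bpt[OF assms(3)] mu_def fst_conv
proof (rule nsup_cong[OF refl])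
  fix t assume "t \<in> K"
  then have "t \<in> topspace Y"
    using Comp_subset assms(2) by blast
  then show "nsup (\<lambda>u. norm (snd (op_ev Y (x, g) t (u x)))) {graph_section X v} = norm (blinfun_apply (g t) (v x))"
    using assms(1) by (subst nsup_singleton) (auto simp: graph_section_def op_ev_apply)
qed

text \<open>The map \<open>lift\<close> sends the pairs (K, v) onto the triples indexing the
  seminorms of the structure. A finite set of triples is the image of a finite set of pairs, and
  \<open>nsup\<close> is unchanged by reindexing along the map.\<close>

lemma semi_GB_q_semi:
  "(\<lambda>r. restrict r Tot) ` semi GB =
    {\<lambda>m\<in>Tot. nsup (\<lambda>i. q_semi Esec GB (op_ev Y) i m) Q | Q. finite Q \<and> Q \<subseteq> Comp Y \<times> semi TB \<times> Theta_pt X}"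
    (is "?L = ?R")
proof -
  define lift where "lift = (\<lambda>(K :: 'y set, v :: 'x \<Rightarrow> 'z). (K, \<lambda>p :: 'x \<times> 'z. norm (snd p), Bpt v))"
  have img: "lift ` (Comp Y \<times> Cb X) = Comp Y \<times> semi TB \<times> Theta_pt X"
    unfolding lift_def Theta_pt_eq TB_simps by force
  have eq: "restrict (\<lambda>(x, g). mu_sup P x g) Tot = (\<lambda>m\<in>Tot. nsup (\<lambda>i. q_semi Esec GB (op_ev Y) i m) (lift ` P))"
    if P: "P \<in> idx" for P
  proof (rule restrict_ext)
    fix m assume m: "m \<in> Tot"
    obtain x g where xg: "m = (x, g)" by fastforce
    show "(\<lambda>(x, g). mu_sup P x g) m = nsup (\<lambda>i. q_semi Esec GB (op_ev Y) i m) (lift ` P)"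
      unfolding nsup_image xg prod.case mu_sup_def
    proof (rule nsup_cong[OF refl])
      fix i assume i: "i \<in> P"
      obtain K v where Kv: "i = (K, v)" by fastforce
      have "K \<in> Comp Y" "v \<in> Cb X"
        using mu_index_pair[OF P] i Kv by auto
      then show "(case i of (K, w) \<Rightarrow> mu K w x g) = q_semi Esec GB (op_ev Y) (lift i) (x, g)"
        using q_semi_eq_mu[of x g K v] m xg by (simp add: Kv lift_def)
    qed
  qed
  show ?thesis
  proof (intro set_eqI iffI)
    fix r assume "r \<in> ?L"
    then obtain P where P: "P \<in> idx" "r = restrict (\<lambda>(x, g). mu_sup P x g) Tot"
      unfolding semi_GB by auto
    moreover have "finite (lift ` P)" "lift ` P \<subseteq> Comp Y \<times> semi TB \<times> Theta_pt X"
      using P(1) img unfolding mu_index_def by blast+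
    ultimately show "r \<in> ?R"
      using eq[OF P(1)] by blast
  next
    fix r assume "r \<in> ?R"
    then obtain Q where Q: "finite Q" "Q \<subseteq> lift ` (Comp Y \<times> Cb X)"
        "r = (\<lambda>m\<in>Tot. nsup (\<lambda>i. q_semi Esec GB (op_ev Y) i m) Q)"
      unfolding img by blast
    obtain P where P: "P \<subseteq> Comp Y \<times> Cb X" "finite P" "Q = lift ` P"
      using finite_subset_image[OF Q(1,2)] by (elim exE conjE) (rule that)
    have PI: "P \<in> idx"
      using P by (simp add: mu_index_def)
    then have "r = restrict (\<lambda>(x, g). mu_sup P x g) Tot"
      using eq[OF PI] Q(3) P(3) by simp
    then show "r \<in> ?L"
      unfolding semi_GB using PI by blast
  qed
qed

lemma is_structure_GB:
  assumes Y: "Hausdorff_space Y"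
  shows "is_structure (Theta_pt X) Esec TB GB (op_ev Y) X Y"
proof -
  have 1: "Esec \<subseteq> Gamma TB"
    using graph_section_Gamma_TB by blast
  have 2: "Theta_pt X \<subseteq> (\<Pi>\<^sub>E x\<in>topspace X. stalk_bounded TB x)"
    unfolding Theta_pt_eq Bpt_def by (auto simp: stalk_bounded_def stalk_def)
  have 3: "DD X Esec B \<noteq> {}" if "B \<in> Theta_pt X" for B
    using that DD_Bpt unfolding Theta_pt_eq by auto
  have 4: "op_ev Y ` stalk GB x \<subseteq> cont_maps Y (L_top TB x {BB X Esec B x | B. B \<in> Theta_pt X})"
    if "x \<in> topspace X" for x
    using op_ev_continuous[OF that] stk_V[OF that] by (auto simp only: stalk_GB[OF that])
  have 5: "op_ev Y (sadd GB m m') t a = sadd TB (op_ev Y m t a) (op_ev Y m' t a)"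
    if "x \<in> topspace X" "m \<in> stalk GB x" "m' \<in> stalk GB x" "t \<in> topspace Y" "a \<in> stalk TB x" for x m m' t a
    using that by (auto simp: stalk_GB stalk_TB op_ev_apply madd_def blinfun.add_left)
  have 6: "op_ev Y (smult GB k m) t a = smult TB k (op_ev Y m t a)"
    if "x \<in> topspace X" "m \<in> stalk GB x" "t \<in> topspace Y" "a \<in> stalk TB x" for x k m t a
    using that by (auto simp: stalk_GB stalk_TB op_ev_apply mscale_def)
  show ?thesis
    unfolding is_structure_def GB_simps(1) topspace_M_top
    by (intro conjI ballI allI is_omega_bundle_TB is_omega_bundle_GB TB_simps(3) GB_simps(3) 1 2 Y 3
        total_TB op_ev_inj 4 5 6 semi_GB_q_semi; assumption)
qed

text \<open>A section in \<Gamma>(\<pi>) comes without a norm bound, so the splitting of increments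
  cannot be applied to it directly. Instead it is compared with a member F of \<open>M\<close>,
  whose evaluation at t along w is continuous.\<close>

lemma is_compatible_GB: "is_compatible (Theta_pt X) Esec TB GB (op_ev Y) X Y"
  unfolding is_compatible_def
proof (intro ballI)
  fix t \<Phi> u
  assume t: "t \<in> topspace Y" and \<Phi>: "\<Phi> \<in> Gamma GB" and "u \<in> (\<Union>B\<in>Theta_pt X. DD X Esec B)"
  then obtain w where w: "w \<in> Cb X" "u = graph_section X w"
    unfolding Theta_pt_eq by (auto simp: DD_Bpt)
  define f where "f x = snd (\<Phi> x)" for x
  have f: "\<Phi> x = (x, f x)" "f x \<in> stk x" if "x \<in> topspace X" for x
  proof -
    have "\<Phi> x \<in> stalk GB x"
      using \<Phi> that unfolding Gamma_def Gamma_on_def bounded_sections_def by auto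
    then have "\<Phi> x \<in> {x} \<times> stk x"
      by (simp only: stalk_GB[OF that])
    then show "\<Phi> x = (x, f x)" "f x \<in> stk x"
      by (auto simp: f_def)
  qed
  have K: "{t} \<in> Comp Y"
    using t by (simp add: Comp_def)
  \<comment> \<open>The single seminorm indexed by ({t}, w) is exactly the norm of the evaluated
    section. It provides both the boundedness of v and the comparison with F.\<close>
  define Q where "Q = {({t}, w)}"
  have Q: "Q \<in> idx"
    unfolding Q_def by (intro mu_index_insert K w mu_index_empty)
  have mu: "mu_sup Q x g = norm (blinfun_apply (g t) (w x))" for x g
    by (simp add: mu_sup_def mu_def Q_def nsup_singleton)
  define v where "v x = blinfun_apply (f x t) (w x)" for x
  have sec: "(\<lambda>x\<in>topspace X. op_ev Y (\<Phi> x) t (u x)) = (\<lambda>x\<in>topspace X. (x, v x))"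
    by (rule restrict_ext) (simp add: w(2) graph_section_def f(1) op_ev_apply[OF t] v_def)
  have "(\<lambda>(x, g). mu_sup Q x g) \<in> semi GB"
    unfolding semi_GB using Q by blast
  then have "bdd_above ((\<lambda>x. (\<lambda>(x, g). mu_sup Q x g) (\<Phi> x)) ` topspace X)"
    using \<Phi> unfolding Gamma_def Gamma_on_def bounded_sections_def by auto
  moreover have "(\<lambda>x. (\<lambda>(x, g). mu_sup Q x g) (\<Phi> x)) ` topspace X = (\<lambda>x. norm (v x)) ` topspace X"
    by (rule image_cong) (auto simp: f(1) mu v_def)
  ultimately have bdd: "bounded (v ` topspace X)"
    unfolding bounded_iff bdd_above_def by auto
  have "continuous_map X (M_top sc X Y) \<Phi>"
    using \<Phi> unfolding Gamma_def Gamma_on_def by simp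
  then have cont: "section_cont f x" if "x \<in> topspace X" for x
    using topcontinuous_at_section_iff[OF openin_topspace that f(2,1)] that
    unfolding continuous_map_eq_topcontinuous_at by simp
  have "\<forall>\<^sub>F y in nhdsin X x. norm (v y - v x) < \<epsilon>" if x: "x \<in> topspace X" and \<epsilon>: "0 < \<epsilon>" for x \<epsilon>
  proof -
    \<comment> \<open>Three errors: f against F at y, the variation of F along w, and F against f at
      x.\<close>
    have \<epsilon>3: "0 < \<epsilon> / 3" using \<epsilon> by simp
    obtain F where F: "F \<in> M" "mu_sup Q x (fdiff Y (f x) (F x)) < \<epsilon> / 3"
      by (rule stk_approx[OF x f(2)[OF x] Q \<epsilon>3])
    have near: "norm (v y - blinfun_apply (F y t) (w y)) < \<epsilon> / 3"
      if "mu_sup Q y (fdiff Y (f y) (F y)) < \<epsilon> / 3" for y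
      using that t by (simp add: mu v_def fdiff_def blinfun.diff_left)
    have "\<forall>\<^sub>F y in nhdsin X x. mu_sup Q y (fdiff Y (f y) (F y)) < \<epsilon> / 3"
      using cont[OF x] Q F unfolding section_cont_def by blast
    moreover have "\<forall>\<^sub>F y in nhdsin X x. \<forall>s\<in>{t}. norm (blinfun_apply (F y s) (w y) - blinfun_apply (F x s) (w x)) < \<epsilon> / 3"
      by (rule tame_eventually_near[OF M_tame[OF F(1) x] x w(1) K \<epsilon>3])
    ultimately show ?thesis
    proof eventually_elim
      case (elim y)
      have "norm (v y - blinfun_apply (F y t) (w y)) < \<epsilon> / 3"
        "norm (v x - blinfun_apply (F x t) (w x)) < \<epsilon> / 3"
        "norm (blinfun_apply (F y t) (w y) - blinfun_apply (F x t) (w x)) < \<epsilon> / 3"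
        using near[OF elim(1)] near[OF F(2)] elim(2) by auto
      moreover have "norm (v y - v x) \<le> norm (v y - blinfun_apply (F y t) (w y)) +
          norm (blinfun_apply (F y t) (w y) - blinfun_apply (F x t) (w x)) + norm (v x - blinfun_apply (F x t) (w x))"
        using norm_triangle_ineq4[of "v y - blinfun_apply (F x t) (w x)" "v x - blinfun_apply (F x t) (w x)"]
          norm_triangle_ineq[of "v y - blinfun_apply (F y t) (w y)" "blinfun_apply (F y t) (w y) - blinfun_apply (F x t) (w x)"]
        by simp
      ultimately show ?case
        by linarith
    qed
  qed
  then have "continuous_map X euclidean v"
    unfolding continuous_map_euclidean_iff_nhdsin by blast
  then show "(\<lambda>x\<in>topspace X. op_ev Y (\<Phi> x) t (u x)) \<in> Gamma TB"
    unfolding sec Gamma_def TB_simps using bdd by (intro section_in_Gamma_on_TB) simp_all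
qed

section \<open>Continuity of selections\<close>

text \<open>The vector v is an arbitrary function of the base point, so the same equivalence serves
  moving vectors in (b) and constant ones in (d).\<close>

lemma tendsto_pn_iff:
  assumes "f \<in> topspace X \<rightarrow> V" "x \<in> topspace X" "K \<in> Comp Y"
  shows "((\<lambda>y. nsup (\<lambda>s. norm (blinfun_apply (f y s) (v y) - blinfun_apply (f x s) (v y))) K) \<longlongrightarrow> 0) (atin X x) \<longleftrightarrow>
    (\<forall>\<epsilon>>0. \<forall>\<^sub>F y in nhdsin X x. pn K (v y) (fdiff Y (f y) (f x)) < \<epsilon>)"
  unfolding pn_fdiff[OF assms(3), symmetric]
proof (rule tendsto_zero_atin_iff[OF assms(2)])
  show "pn K (v x) (fdiff Y (f x) (f x)) = 0"
    using assms(3) by (simp add: fdiff_self)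
  show "0 \<le> pn K (v y) (fdiff Y (f y) (f x))" if "y \<in> topspace X" for y
    using assms that by (intro pn_nonneg V_diff) auto
qed

text \<open>Constant vectors turn the stalk seminorms into those of \<open>Cc sc Y\<close>. A member
  F of \<open>M\<close> close to f at x stays close nearby by \<open>section_cont\<close>, so the
  continuity of F at x passes to f.\<close>

lemma section_cont_tame:
  assumes f: "\<And>y. y \<in> topspace X \<Longrightarrow> f y \<in> stk y" and nb: "norm_bounded f"
    and x: "x \<in> topspace X" and sc: "section_cont f x"
  shows "tame f x"
  unfolding tame_def
proof (intro conjI ballI allI impI nb)
  show V: "f \<in> topspace X \<rightarrow> V"
    using f stk_V by auto
  fix K z and \<epsilon> :: real assume K: "K \<in> Comp Y" and \<epsilon>: "0 < \<epsilon>"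
  define w :: "'x \<Rightarrow> 'z" where "w = (\<lambda>x\<in>topspace X. z)"
  define Q where "Q = {(K, w)}"
  have Q: "Q \<in> idx"
    unfolding Q_def w_def by (intro mu_index_insert K const_Cb mu_index_empty)
  have pn: "pn K z g < c" if "y \<in> topspace X" "mu_sup Q y g < c" for y g c
    using mu_sup_upper[OF Q, of K w y g] that by (simp add: Q_def w_def)
  have \<epsilon>3: "0 < \<epsilon> / 3" using \<epsilon> by simp
  obtain F where F: "F \<in> M" "mu_sup Q x (fdiff Y (f x) (F x)) < \<epsilon> / 3"
    by (rule stk_approx[OF x f[OF x] Q \<epsilon>3])
  have "\<forall>\<^sub>F y in nhdsin X x. mu_sup Q y (fdiff Y (f y) (F y)) < \<epsilon> / 3"
    using sc Q F unfolding section_cont_def by blast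
  moreover have "\<forall>\<^sub>F y in nhdsin X x. pn K z (fdiff Y (F y) (F x)) < \<epsilon> / 3"
    by (rule tame_eventually[OF M_tame[OF F(1) x] K \<epsilon>3])
  ultimately show "\<forall>\<^sub>F y in nhdsin X x. pn K z (fdiff Y (f y) (f x)) < \<epsilon>"
    using eventually_topspace
  proof eventually_elim
    case (elim y)
    have fV: "f y \<in> V" "f x \<in> V" "F y \<in> V" "F x \<in> V"
      using V M_V[OF F(1)] x elim(3) by auto
    have "pn K z (fdiff Y (f y) (f x)) \<le> pn K z (fdiff Y (f y) (F y)) + pn K z (fdiff Y (F y) (f x))"
      by (rule pn_fdiff_triangle[OF fV(1,3,2) K])
    also have "pn K z (fdiff Y (F y) (f x)) \<le> pn K z (fdiff Y (F y) (F x)) + pn K z (fdiff Y (F x) (f x))"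
      by (rule pn_fdiff_triangle[OF fV(3,4,2) K])
    finally show ?case
      using pn[OF elim(3,1)] pn[OF x F(2)] elim(2) pn_fdiff_commute[OF K, of z "F x" "f x"] by linarith
  qed
qed

lemma Gamma_at_iff:
  assumes f: "f \<in> (\<Pi>\<^sub>E x\<in>topspace X. stk x)" and nb: "norm_bounded f" and x: "x \<in> topspace X"
  shows "graph_section X f \<in> Gamma_at GB x \<longleftrightarrow> tame f x"
proof -
  have fs: "f y \<in> stk y" if "y \<in> topspace X" for y
    using f that by auto
  have V: "f \<in> topspace X \<rightarrow> V"
    using fs stk_V by auto
  have "graph_section X f \<in> (\<Pi>\<^sub>E x\<in>topspace X. stalk GB x)"
    using fs by (auto simp: graph_section_def stalk_def)
  moreover have "bdd_above ((\<lambda>x. \<nu> (graph_section X f x)) ` topspace X)" if "\<nu> \<in> semi GB" for \<nu>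
  proof -
    obtain Q where Q: "Q \<in> idx" "\<nu> = (\<lambda>(x, g). mu_sup Q x g)"
      using \<open>\<nu> \<in> semi GB\<close> by (auto simp: semi_GB)
    have "(\<lambda>x. \<nu> (graph_section X f x)) ` topspace X = (\<lambda>x. mu_sup Q x (f x)) ` topspace X"
      by (rule image_cong) (auto simp: Q(2) graph_section_def)
    then show ?thesis
      using mu_sup_bdd[OF V nb Q(1)] by simp
  qed
  ultimately have "graph_section X f \<in> Gamma_at GB x \<longleftrightarrow> topcontinuous_at X (M_top sc X Y) (graph_section X f) x"
    unfolding Gamma_at_def bounded_sections_def by simp
  also have "\<dots> \<longleftrightarrow> section_cont f x"
    using topcontinuous_at_section_iff[OF openin_topspace x fs, of "graph_section X f"]
    by (simp add: graph_section_def)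
  also have "\<dots> \<longleftrightarrow> tame f x"
    using tame_section_cont[OF _ x] section_cont_tame[OF fs nb x] by blast
  finally show ?thesis .
qed

text \<open>From right to left, constants are special choices of v. From left to right, the
  difference f - f(x) is tame with value zero at x, so upper semicontinuity of its seminorm along v
  makes it small near x.\<close>

lemma tame_iff_Cb:
  assumes V: "f \<in> topspace X \<rightarrow> V" and nb: "norm_bounded f" and x: "x \<in> topspace X"
  shows "tame f x \<longleftrightarrow> (\<forall>K\<in>Comp Y. \<forall>v\<in>Cb X. \<forall>\<epsilon>>0. \<forall>\<^sub>F y in nhdsin X x. pn K (v y) (fdiff Y (f y) (f x)) < \<epsilon>)"
    (is "_ \<longleftrightarrow> ?R")
proof
  assume R: ?R
  show "tame f x"
    unfolding tame_def
  proof (intro conjI ballI allI impI V nb)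
    fix K z and \<epsilon> :: real assume "K \<in> Comp Y" "0 < \<epsilon>"
    then have "\<forall>\<^sub>F y in nhdsin X x. pn K ((\<lambda>x\<in>topspace X. z) y) (fdiff Y (f y) (f x)) < \<epsilon>"
      using R const_Cb by blast
    with eventually_topspace show "\<forall>\<^sub>F y in nhdsin X x. pn K z (fdiff Y (f y) (f x)) < \<epsilon>"
      by eventually_elim simp
  qed
next
  assume t: "tame f x"
  have c: "tame (\<lambda>y. f x) x"
  proof -
    have "norm_bounded (\<lambda>y. f x)"
      using nb x unfolding norm_bounded_def by blast
    then show ?thesis
      using V x unfolding tame_def by (auto simp: fdiff_self)
  qed
  show ?R
  proof (intro ballI allI impI)
    fix K and v :: "'x \<Rightarrow> 'z" and \<epsilon> :: real assume K: "K \<in> Comp Y" and v: "v \<in> Cb X" and \<epsilon>: "0 < \<epsilon>"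
    define Q where "Q = {(K, v)}"
    have Q: "Q \<in> idx"
      unfolding Q_def by (intro mu_index_insert K v mu_index_empty)
    have "mu_sup Q x (fdiff Y (f x) (f x)) < \<epsilon>"
      using \<epsilon> by (simp add: fdiff_self mu_sup_zero[OF Q])
    from tame_eventually_mu_sup_less[OF tame_diff[OF t c x] x Q this]
    show "\<forall>\<^sub>F y in nhdsin X x. pn K (v y) (fdiff Y (f y) (f x)) < \<epsilon>"
      by eventually_elim (use mu_sup_less_iff[OF Q] in \<open>auto simp: Q_def\<close>)
  qed
qed

end

theorem theorem1p4p15:
  fixes sc :: "'k::real_normed_field \<Rightarrow> 'z::real_normed_vector \<Rightarrow> 'z"
    and X :: "'x topology" and Y :: "'y topology" and xinf :: 'x
  assumes "normed_space_over sc"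
    and "Hausdorff_space Y"
    and "xinf \<in> topspace X"
  shows
    "is_structure (Theta_pt X) (graph_section X ` Cb X)
       (trivial_bundle sc X) (generated_bundle sc X Y) (op_ev Y) X Y
     \<and> (compact_space X \<and> locally_compact_space Y \<longrightarrow>
         is_compatible (Theta_pt X) (graph_section X ` Cb X)
           (trivial_bundle sc X) (generated_bundle sc X Y) (op_ev Y) X Y)
     \<and> (\<forall>f \<in> (\<Pi>\<^sub>E x\<in>topspace X. M_stalk sc X Y x).
         (\<forall>K. compactin Y K \<longrightarrow> bdd_above ((\<lambda>(x, s). norm (f x s)) ` (topspace X \<times> K))) \<longrightarrow>
         (let a = graph_section X f \<in> Gamma_at (generated_bundle sc X Y) xinf;
              b = (\<forall>K v. compactin Y K \<and> v \<in> Cb X \<longrightarrow>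
                     ((\<lambda>x. nsup (\<lambda>s. norm (blinfun_apply (f x s) (v x)
                                           - blinfun_apply (f xinf s) (v x))) K)
                       \<longlongrightarrow> 0) (atin X xinf));
              c = topcontinuous_at X (Cc sc Y) f xinf;
              d = (\<forall>K w. compactin Y K \<longrightarrow>
                     ((\<lambda>x. nsup (\<lambda>s. norm (blinfun_apply (f x s) w
                                           - blinfun_apply (f xinf s) w)) K)
                       \<longlongrightarrow> 0) (atin X xinf))
          in (a \<longleftrightarrow> b) \<and> (b \<longleftrightarrow> c) \<and> (c \<longleftrightarrow> d)))"
proof -
  interpret operator_fields sc X Y
    using assms(1) by unfold_locales
  \<comment> \<open>\<open>tame f xinf\<close> is the hub: each of the four conditions is compared
    with it separately.\<close>
  have equivalent: "(graph_section X f \<in> Gamma_at GB xinf \<longleftrightarrow> tame f xinf) \<and>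
      ((\<forall>K v. compactin Y K \<and> v \<in> Cb X \<longrightarrow>
         ((\<lambda>x. nsup (\<lambda>s. norm (blinfun_apply (f x s) (v x) - blinfun_apply (f xinf s) (v x))) K) \<longlongrightarrow> 0) (atin X xinf))
       \<longleftrightarrow> tame f xinf) \<and>
      (topcontinuous_at X (Cc sc Y) f xinf \<longleftrightarrow> tame f xinf) \<and>
      ((\<forall>K w. compactin Y K \<longrightarrow>
         ((\<lambda>x. nsup (\<lambda>s. norm (blinfun_apply (f x s) w - blinfun_apply (f xinf s) w)) K) \<longlongrightarrow> 0) (atin X xinf))
       \<longleftrightarrow> tame f xinf)"
    if f: "f \<in> (\<Pi>\<^sub>E x\<in>topspace X. stk x)"
      and bdd: "\<forall>K. compactin Y K \<longrightarrow> bdd_above ((\<lambda>(x, s). norm (f x s)) ` (topspace X \<times> K))" for f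
  proof -
    have nb: "norm_bounded f"
      using bdd unfolding norm_bounded_iff by (simp add: Comp_def)
    have V: "f \<in> topspace X \<rightarrow> V"
      using f stk_V by fastforce
    have comp: "compactin Y K \<longleftrightarrow> K \<in> Comp Y" for K
      by (simp add: Comp_def)
    show ?thesis
      unfolding comp
    proof (intro conjI)
      show "graph_section X f \<in> Gamma_at GB xinf \<longleftrightarrow> tame f xinf"
        by (rule Gamma_at_iff[OF f nb assms(3)])
      show "topcontinuous_at X (Cc sc Y) f xinf \<longleftrightarrow> tame f xinf"
        using tame_iff[OF assms(3)] nb by blast
      show "(\<forall>K v. K \<in> Comp Y \<and> v \<in> Cb X \<longrightarrow>
         ((\<lambda>x. nsup (\<lambda>s. norm (blinfun_apply (f x s) (v x) - blinfun_apply (f xinf s) (v x))) K) \<longlongrightarrow> 0) (atin X xinf))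
         \<longleftrightarrow> tame f xinf"
        unfolding tame_iff_Cb[OF V nb assms(3)] using tendsto_pn_iff[OF V assms(3)] by auto
      show "(\<forall>K w. K \<in> Comp Y \<longrightarrow>
         ((\<lambda>x. nsup (\<lambda>s. norm (blinfun_apply (f x s) w - blinfun_apply (f xinf s) w)) K) \<longlongrightarrow> 0) (atin X xinf))
         \<longleftrightarrow> tame f xinf"
        unfolding tame_def using tendsto_pn_iff[OF V assms(3), of _ "\<lambda>_. _"] V nb by (simp add: Ball_def)
    qed
  qed
  show ?thesis
    unfolding Let_def
    by (intro conjI impI ballI is_structure_GB[OF assms(2)] is_compatible_GB) (simp_all only: equivalent)
qed

end
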